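(* Let $(\mathcal T,\mathcal E,(x_K)_{K\in\mathcal T})$ be an admissible mesh of $\Omega$, and let $\boldsymbol u^0=(u^0_{i,K})_{1\le i\le n,K\in\mathcal T}$ be defined by $u^0_{i,K}=\frac1{m_K}\int_K u^0_i(x)\,dx$ from an initial condition $u^0\in L^\infty(\Omega;\mathcal A)$ satisfying $M_i:=\int_\Omega u^0_i>0$ for all $1\le i\le n$; write $M=(M_i)_{1\le i\le n}$. Then, for all $1\le p\le P_T$, the nonlinear system (S$_p$) (with datum $\boldsymbol u^{p-1}$, which is the initial datum $\boldsymbol u^0$ if $p=1$, and the solution obtained at the previous time step if $p\ge2$) has at least one (strictly) positive solution $\boldsymbol u^p\in\mathcal A^{\mathcal T}$. This solution satisfies $\langle \boldsymbol u^p,\boldsymbol 1_{\mathcal T}\rangle_{\mathcal T}=M$, and the corresponding fluxes $\boldsymbol J^p=(J^p_{K\sigma})$ are uniquely determined by equations (F1), (F2), (F3) of (S$_p$) and belong to $(\mathcal V_0)^{\mathcal E}$, i.e. $\sum_{i=1}^n J^p_{i,K\sigma}=0$ for all $\sigma\in\mathcal E$. Moreover, the following entropy-entropy dissipation estimate holds: $$E_{\mathcal T}(\boldsymbol u^p)+\Delta t_p\sum_{\sigma=K|L\in\mathcal E_{\rm int}}\left(\frac{c^*}{2}m_\sigma d_\sigma |J^p_{K\sigma}|^2+\frac{\alpha}{2}\tau_\sigma\left|D_{K\sigma}\sqrt{\boldsymbol u^p}\right|^2\right)\le E_{\mathcal T}(\boldsymbol u^{p-1}).$$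
   Context: **Model data.** $\Omega\subset\mathbb R^d$ is open, connected, bounded and polyhedral; $T>0$; $n\ge2$ is an integer. For $1\le i\ne j\le n$, $c_{ij}=c_{ji}>0$ are given. Set $c^*=\min_{i\ne j}c_{ij}>0$, $\overline c_{ij}=c_{ij}-c^*\ge0$, $\overline c=\max_{i\ne j}\overline c_{ij}$, $\alpha=\frac{4}{c^*+2\overline c}$. For $v\in\mathbb R^n$, $\overline A(v)$ is the $n\times n$ matrix with $\overline A_{ii}(v)=\sum_{j\ne i}\overline c_{ij}v_j$ and $\overline A_{ij}(v)=-\overline c_{ij}v_i$ for $j\neq i$. $\mathcal A=\{v\in\mathbb R_+^n:\sum_i v_i=1\}$ with $\mathbb R_+=[0,\infty)$, and $\mathcal V_0=\{v\in\mathbb R^n:\sum_i v_i=0\}$. **Admissible mesh.** A triplet $(\mathcal T,\mathcal E,(x_K)_{K\in\mathcal T})$ such that: (i) each cell $K\in\mathcal T$ is non-empty, open, polyhedral and convex, distinct cells are disjoint, and $\bigcup_K\overline K=\overline\Omega$; (ii) each face $\sigma\in\mathcal E$ is closed and contained in a hyperplane of $\mathbb R^d$, with $(d-1)$-dimensional Hausdorff measure $m_\sigma>0$; distinct faces intersect in a set of zero $(d-1)$-dimensional measure; for each $K$ there is $\mathcal E_K\subset\mathcal E$ with $\partial K=\bigcup_{\sigma\in\mathcal E_K}\sigma$, and $\bigcup_K\mathcal E_K=\mathcal E$; for distinct $K,L\in\mathcal T$, $\overline K\cap\overline L$ is either a single face of $\mathcal E$, denoted $K|L$, or has zero $(d-1)$-dimensional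 measure; (iii) $x_K\in K$, and if $K,L$ share a face $K|L$ then $x_L-x_K$ is orthogonal to $K|L$. $m_K$ is the Lebesgue measure of $K$; $\mathcal E_{\rm int}$ is the set of faces of the form $K|L$; $\mathcal E_{\rm ext}=\mathcal E\setminus\mathcal E_{\rm int}$ is the set of faces contained in $\partial\Omega$; $\mathcal E_{K,\rm int}=\mathcal E_K\cap\mathcal E_{\rm int}$, $\mathcal E_{K,\rm ext}=\mathcal E_K\cap\mathcal E_{\rm ext}$. For $\sigma=K|L\in\mathcal E_{\rm int}$, $d_\sigma=|x_K-x_L|$ and $\tau_\sigma=m_\sigma/d_\sigma$. **Time discretization.** $0=t_0<t_1<\dots<t_{P_T}=T$, $\Delta t_p=t_p-t_{p-1}$. **Discrete notation.** For $\boldsymbol v=(v_K)_K\in\mathbb R^{\mathcal T}$ and $\sigma\in\mathcal E_K$: $v_{K\sigma}=v_L$ if $\sigma=K|L$, $v_{K\sigma}=v_K$ if $\sigma\in\mathcal E_{\rm ext}$; $D_{K\sigma}\boldsymbol v=v_{K\sigma}-v_K$. For $\boldsymbol u=(\boldsymbol u_i)_{1\le i\le n}\in(\mathbb R^{\mathcal T})^n$, $D_{K\sigma}\boldsymbol u=(D_{K\sigma}\boldsymbol u_i)_i\in\mathbb R^n$, and $\sqrt{\boldsymbol u}$ is taken componentwise. $\langle\boldsymbol u,\boldsymbol v\rangle_{\mathcal T}=\sum_K m_Ku_Kv_K$ for $\boldsymbol u,\boldsymbol v\in\mathbb R^{\mathcal T}$; for $\boldsymbol u\in(\mathbb R^{\mathcal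 T})^n$, $\langle\boldsymbol u,\boldsymbol 1_{\mathcal T}\rangle_{\mathcal T}\in\mathbb R^n$ is the vector with components $\langle\boldsymbol u_i,\boldsymbol 1_{\mathcal T}\rangle_{\mathcal T}=\sum_Km_Ku_{i,K}$. $\mathcal A^{\mathcal T}$ is the set of $\boldsymbol v\in(\mathbb R_+^{\mathcal T})^n$ with $(v_{i,K})_{1\le i\le n}\in\mathcal A$ for all $K\in\mathcal T$. "Strictly positive" means $u_{i,K}^p>0$ for all $i,K$. The discrete entropy is $E_{\mathcal T}(\boldsymbol v)=\sum_{i=1}^n\sum_{K\in\mathcal T}m_Kv_{i,K}\log v_{i,K}$ (with $0\log0=0$). **Scheme (S$_p$).** Given $\boldsymbol u^{p-1}$, the unknowns are $\boldsymbol u^p=(u^p_{i,K})\in(\mathbb R^{\mathcal T})^n$ and fluxes $\boldsymbol J^p$, made of $J^p_{K\sigma}=(J^p_{i,K\sigma})_{1\le i\le n}\in\mathbb R^n$ for $K\in\mathcal T$, $\sigma\in\mathcal E_K$. Edge values $u^p_\sigma=(u^p_{i,\sigma})_{1\le i\le n}$ are defined by: $u^p_{i,\sigma}=0$ if $\min(u^p_{i,K},u^p_{i,K\sigma})\le0$; $u^p_{i,\sigma}=u^p_{i,K}$ if $0\le u^p_{i,K}=u^p_{i,K\sigma}$; and $u^p_{i,\sigma}=\frac{u^p_{i,K}-u^p_{i,K\sigma}}{\log u^p_{i,K}-\log u^p_{i,K\sigma}}$ otherwise. The equations are - (C) $m_K\frac{u^p_{i,K}-u^{p-1}_{i,K}}{\Delta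 t_p}+\sum_{\sigma\in\mathcal E_K}m_\sigma J^p_{i,K\sigma}=0$ for all $K\in\mathcal T$, $1\le i\le n$; - (F1) $\frac1{d_\sigma}D_{K\sigma}\boldsymbol u^p+c^*J^p_{K\sigma}+\overline A(u^p_\sigma)J^p_{K\sigma}=0$ for all $K\in\mathcal T$, $\sigma\in\mathcal E_{K,\rm int}$; - (F2) $J^p_{K\sigma}+J^p_{L\sigma}=0$ for all $\sigma=K|L\in\mathcal E_{\rm int}$; - (F3) $J^p_{K\sigma}=0$ for all $K\in\mathcal T$, $\sigma\in\mathcal E_{K,\rm ext}$. *)

theory Defs
  imports "HOL-Analysis.Analysis"
begin

section \<open>Geometry\<close>

text \<open>The Hausdorff (outer) measure of integer dimension \<open>m\<close>, normalised so that it agrees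
  with Lebesgue measure on \<open>m\<close>-dimensional subspaces; for \<open>m = 0\<close> it is the counting measure,
  because \<open>0 ^ 0 = 1\<close> and the empty set has weight \<open>0\<close>.\<close>

definition hausdorff_weight :: "nat \<Rightarrow> 'a::metric_space set \<Rightarrow> ennreal" where
  "hausdorff_weight m U =
     (if U = {} then 0 else ennreal (unit_ball_vol (real m) * (diameter U / 2) ^ m))"

definition hausdorff_pre_measure :: "nat \<Rightarrow> real \<Rightarrow> 'a::metric_space set \<Rightarrow> ennreal" where
  "hausdorff_pre_measure m \<delta> A =
     (INF U \<in> {U :: nat \<Rightarrow> 'a set. A \<subseteq> (\<Union>k. U k) \<and> (\<forall>k. bounded (U k) \<and> diameter (U k) \<le> \<delta>)}.
        (\<Sum>k. hausdorff_weight m (U k)))"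

definition hausdorff_measure :: "nat \<Rightarrow> 'a::metric_space set \<Rightarrow> ennreal" where
  "hausdorff_measure m A = (SUP \<delta> \<in> {0<..}. hausdorff_pre_measure m \<delta> A)"

definition is_hyperplane :: "'a::euclidean_space set \<Rightarrow> bool" where
  "is_hyperplane h \<longleftrightarrow> (\<exists>a b. a \<noteq> 0 \<and> h = {x. a \<bullet> x = b})"

text \<open>For open sets, convex or not. The notion \<^const>\<open>polyhedron\<close> of the library is restricted to
  closed convex sets; an open convex \<open>S\<close> is polyhedral in the sense below iff its closure is a
  \<^const>\<open>polyhedron\<close>.\<close>

definition polyhedral :: "'a::euclidean_space set \<Rightarrow> bool" where
  "polyhedral S \<longleftrightarrow> (\<exists>H. finite H \<and> (\<forall>h\<in>H. is_hyperplane h) \<and> frontier S \<subseteq> \<Union>H)"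

text \<open>A mesh is a set \<open>\<T>\<close> of cells, a set \<open>\<E>\<close> of faces and points \<open>x\<^sub>K\<close>; the sets \<open>\<E>\<^sub>K\<close> are made
  explicit in the field \<open>cell_faces\<close>.\<close>

record 'a mesh =
  cells :: "'a set set"
  faces :: "'a set set"
  cell_faces :: "'a set \<Rightarrow> 'a set set"
  center :: "'a set \<Rightarrow> 'a"

definition codim1_measure :: "'a::euclidean_space set \<Rightarrow> ennreal" where
  "codim1_measure A = hausdorff_measure (DIM('a) - 1) A"

definition face_measure :: "'a::euclidean_space set \<Rightarrow> real" where
  "face_measure \<sigma> = enn2real (codim1_measure \<sigma>)"

definition cell_measure :: "'a::euclidean_space set \<Rightarrow> real" where
  "cell_measure K = measure lebesgue K"

text \<open>\<open>common_face M K L \<sigma>\<close> means \<open>\<sigma> = K|L\<close>.\<close>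

definition common_face ::
  "'a::euclidean_space mesh \<Rightarrow> 'a set \<Rightarrow> 'a set \<Rightarrow> 'a set \<Rightarrow> bool" where
  "common_face M K L \<sigma> \<longleftrightarrow>
     K \<in> cells M \<and> L \<in> cells M \<and> K \<noteq> L \<and> \<sigma> \<in> faces M \<and> \<sigma> = closure K \<inter> closure L"

definition admissible_mesh :: "'a::euclidean_space set \<Rightarrow> 'a mesh \<Rightarrow> bool" where
  "admissible_mesh \<Omega> M \<longleftrightarrow>
     finite (cells M) \<and> finite (faces M) \<and>
     (\<forall>K\<in>cells M. K \<noteq> {} \<and> open K \<and> polyhedral K \<and> convex K) \<and>
     (\<forall>K\<in>cells M. \<forall>L\<in>cells M. K \<noteq> L \<longrightarrow> K \<inter> L = {}) \<and>
     (\<Union>K\<in>cells M. closure K) = closure \<Omega> \<and>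
     (\<forall>\<sigma>\<in>faces M. closed \<sigma> \<and> (\<exists>h. is_hyperplane h \<and> \<sigma> \<subseteq> h) \<and> 0 < face_measure \<sigma>) \<and>
     (\<forall>\<sigma>\<in>faces M. \<forall>\<sigma>'\<in>faces M. \<sigma> \<noteq> \<sigma>' \<longrightarrow> codim1_measure (\<sigma> \<inter> \<sigma>') = 0) \<and>
     (\<forall>K\<in>cells M. cell_faces M K \<subseteq> faces M \<and> frontier K = \<Union>(cell_faces M K)) \<and>
     (\<Union>K\<in>cells M. cell_faces M K) = faces M \<and>
     (\<forall>K\<in>cells M. \<forall>L\<in>cells M. K \<noteq> L \<longrightarrow>
        closure K \<inter> closure L \<in> faces M \<or> codim1_measure (closure K \<inter> closure L) = 0) \<and>
     (\<forall>K\<in>cells M. center M K \<in> K) \<and>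
     (\<forall>K L \<sigma>. common_face M K L \<sigma> \<longrightarrow>
        (\<forall>y\<in>\<sigma>. \<forall>z\<in>\<sigma>. (center M L - center M K) \<bullet> (y - z) = 0))"

definition interior_faces :: "'a::euclidean_space mesh \<Rightarrow> 'a set set" where
  "interior_faces M = {\<sigma> \<in> faces M. \<exists>K L. common_face M K L \<sigma>}"

definition exterior_faces :: "'a::euclidean_space mesh \<Rightarrow> 'a set set" where
  "exterior_faces M = faces M - interior_faces M"

definition neighbour :: "'a::euclidean_space mesh \<Rightarrow> 'a set \<Rightarrow> 'a set \<Rightarrow> 'a set" where
  "neighbour M K \<sigma> = (THE L. common_face M K L \<sigma>)"

text \<open>The cells \<open>K, L\<close> with \<open>\<sigma> = K|L\<close> are unique up to exchanging them.\<close>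

definition face_dist :: "'a::euclidean_space mesh \<Rightarrow> 'a set \<Rightarrow> real" where
  "face_dist M \<sigma> = (THE r. \<exists>K L. common_face M K L \<sigma> \<and> r = norm (center M K - center M L))"

definition transmissibility :: "'a::euclidean_space mesh \<Rightarrow> 'a set \<Rightarrow> real" where
  "transmissibility M \<sigma> = face_measure \<sigma> / face_dist M \<sigma>"

text \<open>One of the two cells adjacent to an interior face, used for sums over \<open>\<sigma> = K|L\<close> of terms
  that are invariant under exchanging \<open>K\<close> and \<open>L\<close>.\<close>

definition adjacent_cell :: "'a::euclidean_space mesh \<Rightarrow> 'a set \<Rightarrow> 'a set" where
  "adjacent_cell M \<sigma> = (SOME K. \<exists>L. common_face M K L \<sigma>)"

section \<open>Coefficients\<close>

definition c_star :: "('n::finite \<Rightarrow> 'n \<Rightarrow> real) \<Rightarrow> real" where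
  "c_star c = Min {c i j | i j. i \<noteq> j}"

definition c_bar :: "('n::finite \<Rightarrow> 'n \<Rightarrow> real) \<Rightarrow> 'n \<Rightarrow> 'n \<Rightarrow> real" where
  "c_bar c i j = c i j - c_star c"

definition c_bar_max :: "('n::finite \<Rightarrow> 'n \<Rightarrow> real) \<Rightarrow> real" where
  "c_bar_max c = Max {c_bar c i j | i j. i \<noteq> j}"

definition alpha :: "('n::finite \<Rightarrow> 'n \<Rightarrow> real) \<Rightarrow> real" where
  "alpha c = 4 / (c_star c + 2 * c_bar_max c)"

definition A_bar :: "('n::finite \<Rightarrow> 'n \<Rightarrow> real) \<Rightarrow> real ^ 'n \<Rightarrow> real ^ 'n ^ 'n" where
  "A_bar c v = (\<chi> i j. if i = j then (\<Sum>k \<in> UNIV - {i}. c_bar c i k * v $ k)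
                        else - c_bar c i j * v $ i)"

definition conc_simplex :: "(real ^ 'n::finite) set" where
  "conc_simplex = {v. (\<forall>i. 0 \<le> v $ i) \<and> (\<Sum>i\<in>UNIV. v $ i) = 1}"

definition zero_sum_space :: "(real ^ 'n::finite) set" where
  "zero_sum_space = {v. (\<Sum>i\<in>UNIV. v $ i) = 0}"

section \<open>Discrete functions\<close>

text \<open>An element \<open>u\<close> of \<open>(\<real>\<^sup>\<T>)\<^sup>n\<close> is represented as a map from cells to \<open>\<real>\<^sup>n\<close>, with
  \<open>u\<^sub>i\<^sub>,\<^sub>K = u K $ i\<close>, and a family of fluxes as a map \<open>J\<close> with \<open>J\<^sub>K\<^sub>\<sigma> = J K \<sigma>\<close>. Only values at
  \<open>K \<in> \<T>\<close> and \<open>\<sigma> \<in> \<E>\<^sub>K\<close> are meaningful.\<close>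

type_synonym ('d, 'n) cell_fun = "(real ^ 'd) set \<Rightarrow> real ^ 'n"
type_synonym ('d, 'n) flux = "(real ^ 'd) set \<Rightarrow> (real ^ 'd) set \<Rightarrow> real ^ 'n"

definition across ::
  "(real ^ 'd::finite) mesh \<Rightarrow> ('d, 'n::finite) cell_fun \<Rightarrow> (real ^ 'd) set \<Rightarrow> (real ^ 'd) set \<Rightarrow> real ^ 'n"
where
  "across M u K \<sigma> = (if \<sigma> \<in> interior_faces M then u (neighbour M K \<sigma>) else u K)"

definition jump ::
  "(real ^ 'd::finite) mesh \<Rightarrow> ('d, 'n::finite) cell_fun \<Rightarrow> (real ^ 'd) set \<Rightarrow> (real ^ 'd) set \<Rightarrow> real ^ 'n"
where
  "jump M u K \<sigma> = across M u K \<sigma> - u K"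

definition sqrt_fun :: "('d, 'n::finite) cell_fun \<Rightarrow> ('d, 'n) cell_fun" where
  "sqrt_fun u K = (\<chi> i. sqrt (u K $ i))"

definition total_mass :: "(real ^ 'd::finite) mesh \<Rightarrow> ('d, 'n::finite) cell_fun \<Rightarrow> real ^ 'n" where
  "total_mass M u = (\<chi> i. \<Sum>K\<in>cells M. cell_measure K * u K $ i)"

definition in_simplex :: "(real ^ 'd::finite) mesh \<Rightarrow> ('d, 'n::finite) cell_fun \<Rightarrow> bool" where
  "in_simplex M u \<longleftrightarrow> (\<forall>K\<in>cells M. u K \<in> conc_simplex)"

definition strictly_positive :: "(real ^ 'd::finite) mesh \<Rightarrow> ('d, 'n::finite) cell_fun \<Rightarrow> bool" where
  "strictly_positive M u \<longleftrightarrow> (\<forall>K\<in>cells M. \<forall>i. 0 < u K $ i)"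

definition entropy :: "(real ^ 'd::finite) mesh \<Rightarrow> ('d, 'n::finite) cell_fun \<Rightarrow> real" where
  "entropy M v = (\<Sum>i\<in>UNIV. \<Sum>K\<in>cells M. cell_measure K * (v K $ i * ln (v K $ i)))"

definition cell_average :: "(real ^ 'd::finite \<Rightarrow> real ^ 'n::finite) \<Rightarrow> ('d, 'n) cell_fun" where
  "cell_average f K = (\<chi> i. (1 / cell_measure K) * (LINT x | lebesgue_on K. f x $ i))"

section \<open>The scheme\<close>

definition edge_mean :: "real \<Rightarrow> real \<Rightarrow> real" where
  "edge_mean a b = (if min a b \<le> 0 then 0 else if 0 \<le> a \<and> a = b then a
                    else (a - b) / (ln a - ln b))"

definition edge_value ::
  "(real ^ 'd::finite) mesh \<Rightarrow> ('d, 'n::finite) cell_fun \<Rightarrow> (real ^ 'd) set \<Rightarrow> (real ^ 'd) set \<Rightarrow> real ^ 'n"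
where
  "edge_value M u K \<sigma> = (\<chi> i. edge_mean (u K $ i) (across M u K \<sigma> $ i))"

definition eq_C ::
  "(real ^ 'd::finite) mesh \<Rightarrow> real \<Rightarrow> ('d, 'n::finite) cell_fun \<Rightarrow> ('d, 'n) cell_fun \<Rightarrow> ('d, 'n) flux \<Rightarrow> bool"
where
  "eq_C M dt u_old u J \<longleftrightarrow>
     (\<forall>K\<in>cells M. \<forall>i. cell_measure K * ((u K $ i - u_old K $ i) / dt)
        + (\<Sum>\<sigma>\<in>cell_faces M K. face_measure \<sigma> * J K \<sigma> $ i) = 0)"

definition eq_F1 ::
  "(real ^ 'd::finite) mesh \<Rightarrow> ('n::finite \<Rightarrow> 'n \<Rightarrow> real) \<Rightarrow> ('d, 'n) cell_fun \<Rightarrow> ('d, 'n) flux \<Rightarrow> bool"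
where
  "eq_F1 M c u J \<longleftrightarrow>
     (\<forall>K\<in>cells M. \<forall>\<sigma>\<in>cell_faces M K \<inter> interior_faces M.
        (1 / face_dist M \<sigma>) *\<^sub>R jump M u K \<sigma> + c_star c *\<^sub>R J K \<sigma>
        + A_bar c (edge_value M u K \<sigma>) *v J K \<sigma> = 0)"

definition eq_F2 :: "(real ^ 'd::finite) mesh \<Rightarrow> ('d, 'n::finite) flux \<Rightarrow> bool" where
  "eq_F2 M J \<longleftrightarrow> (\<forall>K L \<sigma>. common_face M K L \<sigma> \<longrightarrow> J K \<sigma> + J L \<sigma> = 0)"

definition eq_F3 :: "(real ^ 'd::finite) mesh \<Rightarrow> ('d, 'n::finite) flux \<Rightarrow> bool" where
  "eq_F3 M J \<longleftrightarrow> (\<forall>K\<in>cells M. \<forall>\<sigma>\<in>cell_faces M K \<inter> exterior_faces M. J K \<sigma> = 0)"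

definition flux_equations ::
  "(real ^ 'd::finite) mesh \<Rightarrow> ('n::finite \<Rightarrow> 'n \<Rightarrow> real) \<Rightarrow> ('d, 'n) cell_fun \<Rightarrow> ('d, 'n) flux \<Rightarrow> bool"
where
  "flux_equations M c u J \<longleftrightarrow> eq_F1 M c u J \<and> eq_F2 M J \<and> eq_F3 M J"

definition scheme ::
  "(real ^ 'd::finite) mesh \<Rightarrow> ('n::finite \<Rightarrow> 'n \<Rightarrow> real) \<Rightarrow> real \<Rightarrow> ('d, 'n) cell_fun
    \<Rightarrow> ('d, 'n) cell_fun \<Rightarrow> ('d, 'n) flux \<Rightarrow> bool"
where
  "scheme M c dt u_old u J \<longleftrightarrow> eq_C M dt u_old u J \<and> flux_equations M c u J"

definition dissipation ::
  "(real ^ 'd::finite) mesh \<Rightarrow> ('n::finite \<Rightarrow> 'n \<Rightarrow> real) \<Rightarrow> ('d, 'n) cell_fun \<Rightarrow> ('d, 'n) flux \<Rightarrow> real"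
where
  "dissipation M c u J =
     (\<Sum>\<sigma>\<in>interior_faces M. let K = adjacent_cell M \<sigma> in
        c_star c / 2 * face_measure \<sigma> * face_dist M \<sigma> * (norm (J K \<sigma>))\<^sup>2
        + alpha c / 2 * transmissibility M \<sigma> * (norm (jump M (sqrt_fun u) K \<sigma>))\<^sup>2)"

end

theory Submission
  imports Defs
begin

text \<open>A single time step is solved on the compact convex set \<open>\<A>\<^sup>\<T>\<close> by Brouwer's theorem, without any
  regularisation. The matrix \<open>B(w) = c\<^sup>* I + A_bar(w)\<close> with \<open>w \<ge> 0\<close> has column sums \<open>c\<^sup>*\<close> and nonpositive
  off-diagonal entries, so \<open>c\<^sup>* |J|\<^sub>1 \<le> |B(w) J|\<^sub>1\<close>: the flux across an edge is a continuous function of the two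
  adjacent states, and it has zero sum when these lie in the simplex. Write \<open>G(u)\<close> for the residual of the
  conservation law with these fluxes. If \<open>u\<^sub>i\<^sub>,\<^sub>K = 0\<close>, the edge values of species \<open>i\<close> around \<open>K\<close> vanish, row
  \<open>i\<close> of \<open>B\<close> becomes diagonal, and \<open>G\<^sub>i\<^sub>,\<^sub>K(u) \<le> 0\<close>: the field \<open>-G\<close> is tangent to the simplices and does not
  point outwards. A fixed point of the map \<open>u\<^sub>i \<mapsto> (u\<^sub>i + max(0, -G\<^sub>i)) / (1 + \<Sum>\<^sub>j max(0, -G\<^sub>j))\<close>, taken cell by
  cell, is therefore a zero of \<open>G\<close> (\<open>discrete_problem_solvable\<close>). The number of unknowns is the number of cells
  times \<open>n\<close>, which is not the dimension of a type, so Brouwer's theorem is derived from the combinatorial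
  lemma of Kuhn for cubes in a function space (\<open>brouwer_unit_cube_fun\<close>).

  The same computation gives positivity: if \<open>u\<^sub>i\<close> vanishes in a cell, then it vanishes in the neighbouring
  cells, hence everywhere, because the graph of the mesh is connected; this contradicts conservation of the
  positive mass of species \<open>i\<close> (\<open>discrete_solution_pos\<close>).

  For the entropy estimate, convexity of \<open>x ln x\<close> and summation by parts reduce everything to one edge. There
  \<open>r\<^sub>i = J\<^sub>i / w\<^sub>i\<close> satisfies \<open>D ln u\<^sub>i = -d (c\<^sup>* r\<^sub>i + T\<^sub>i)\<close> with \<open>T\<^sub>i = \<Sum>\<^sub>j c_bar\<^sub>i\<^sub>j w\<^sub>j (r\<^sub>i - r\<^sub>j)\<close>, the dissipation is
  \<open>d (c\<^sup>* \<Sum> w\<^sub>i r\<^sub>i\<^sup>2 + Q)\<close> with \<open>Q = \<Sum> w\<^sub>i r\<^sub>i T\<^sub>i \<ge> 0\<close>, and the Cauchy-Schwarz bound \<open>\<Sum> w\<^sub>i T\<^sub>i\<^sup>2 \<le> 2 \<beta> Q\<close>,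
  where \<open>\<beta>\<close> is the largest \<open>c_bar\<^sub>i\<^sub>j\<close>, produces the constant \<open>\<alpha>\<close> (\<open>edge_dissipation\<close>).

  Two geometric facts about admissible meshes are behind this. A face contained in the closures of two cells
  spans its hyperplane, since a bounded set of smaller dimension is Hausdorff-null; the hyperplane then
  separates the two cells, and three cells cannot lie pairwise on opposite sides of it, so that neighbours
  are well defined (\<open>no_three_cells\<close>). And a connected open set is not disconnected by the null intersections
  of closures of cells, since almost every translate of a segment avoids them (\<open>cells_connected\<close>).\<close>

section \<open>Brouwer's theorem on cubes of arbitrary finite dimension\<close>

lemma compact_unit_cube_fun: "compact {x :: nat \<Rightarrow> real. \<forall>i. x i \<in> {0..1}}"
proof -
  have "compactin (product_topology (\<lambda>_. euclidean) UNIV) (PiE UNIV (\<lambda>_::nat. {0..1::real}))"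
    by (subst compactin_PiE) simp
  moreover have "PiE UNIV (\<lambda>_::nat. {0..1::real}) = {x. \<forall>i. x i \<in> {0..1}}"
    by (auto simp: PiE_def Pi_def extensional_def)
  ultimately show ?thesis
    by (metis compactin_euclidean_iff euclidean_product_topology)
qed

text \<open>Uniform continuity with respect to the supremum of the coordinate differences, which is what the
  grid of Kuhn's lemma controls.\<close>

lemma uniformly_continuous_coordinates:
  fixes f :: "(nat \<Rightarrow> real) \<Rightarrow> real"
  assumes "compact S" "continuous_on S f" "0 < e"
  obtains d where "0 < d" "\<And>x y. x \<in> S \<Longrightarrow> y \<in> S \<Longrightarrow> (\<And>i. \<bar>x i - y i\<bar> \<le> d) \<Longrightarrow> \<bar>f x - f y\<bar> < e"
proof -
  have "uniformly_continuous_on S f"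
    using assms compact_uniformly_continuous by blast
  then obtain \<delta> where \<delta>: "0 < \<delta>" "\<And>x y. x \<in> S \<Longrightarrow> y \<in> S \<Longrightarrow> dist y x < \<delta> \<Longrightarrow> dist (f y) (f x) < e"
    using assms(3) unfolding uniformly_continuous_on_def by meson
  obtain N where N: "(1/2::real) ^ N < \<delta> / 2"
    using \<delta>(1) real_arch_pow_inv[of "\<delta> / 2" "1/2"] by auto
  show ?thesis
  proof (rule that[of "\<delta> / 4"])
    show "0 < \<delta> / 4" using \<delta>(1) by simp
    fix x y assume xy: "x \<in> S" "y \<in> S" "\<And>i. \<bar>x i - y i\<bar> \<le> \<delta> / 4"
    have "Max {dist (x (from_nat n)) (y (from_nat n)) |n. n \<le> N} \<le> \<delta> / 4"
      using xy(3) by (intro Max.boundedI) (auto simp: dist_real_def)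
    then have "dist x y < \<delta>"
      using dist_fun_le_dist_first_terms[of x y N] N by linarith
    then show "\<bar>f x - f y\<bar> < e"
      using \<delta>(2)[OF xy(2,1)] by (simp add: dist_real_def dist_commute)
  qed
qed

text \<open>The dimension is a natural number: a point of the cube is a sequence in \<open>[0, 1]\<close> of which the map uses
  all entries but prescribes only the first \<open>n\<close>. The product topology on sequences is metrizable, which
  makes uniform continuity available.\<close>

lemma brouwer_unit_cube_nat:
  fixes f :: "(nat \<Rightarrow> real) \<Rightarrow> nat \<Rightarrow> real"
  assumes cont: "\<And>i. i < n \<Longrightarrow> continuous_on {x. \<forall>i. x i \<in> {0..1}} (\<lambda>x. f x i)"
    and cube: "\<And>x i. (\<And>j. x j \<in> {0..1}) \<Longrightarrow> i < n \<Longrightarrow> f x i \<in> {0..1}"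
  obtains x where "\<And>i. x i \<in> {0..1}" "\<And>i. i < n \<Longrightarrow> f x i = x i"
proof -
  define C where "C = {x :: nat \<Rightarrow> real. \<forall>i. x i \<in> {0..1}}"
  have C: "compact C" using compact_unit_cube_fun by (simp add: C_def)
  define g where "g = (\<lambda>i x. f x i - x i)"
  have g: "continuous_on C (g i)" if "i < n" for i
    unfolding g_def C_def
    by (intro continuous_on_diff cont that continuous_on_subset[OF continuous_on_product_coordinates]) auto
  have approx: "\<exists>x\<in>C. \<forall>i<n. \<bar>g i x\<bar> < e" if e: "0 < e" for e
  proof -
    have "\<forall>i. \<exists>d>0. i < n \<longrightarrow> (\<forall>x\<in>C. \<forall>y\<in>C. (\<forall>j. \<bar>x j - y j\<bar> \<le> d) \<longrightarrow> \<bar>g i x - g i y\<bar> < e)"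
      using uniformly_continuous_coordinates[OF C g e] by (metis zero_less_one)
    then obtain d where d: "\<And>i. d i > 0"
      "\<And>i x y. i < n \<Longrightarrow> x \<in> C \<Longrightarrow> y \<in> C \<Longrightarrow> (\<And>j. \<bar>x j - y j\<bar> \<le> d i) \<Longrightarrow> \<bar>g i x - g i y\<bar> < e"
      by metis
    define d0 where "d0 = Min (insert 1 (d ` {..<n}))"
    have d0: "0 < d0" "\<And>i. i < n \<Longrightarrow> d0 \<le> d i"
      using d(1) by (auto simp: d0_def)
    obtain p where p: "0 < p" "1 / real p < d0"
      using d0(1) by (metis nat_approx_posE zero_less_Suc of_nat_Suc)
    define pt where "pt = (\<lambda>(q::nat\<Rightarrow>nat) j. if j < n then real (q j) / real p else 0)"
    \<comment> \<open>Label 0 forces \<open>f x i \<ge> x i\<close> at the grid point \<open>x\<close>, label 1 forces \<open>f x i \<le> x i\<close>; the case distinction at the face \<open>q i = p\<close>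
      is needed because Kuhn's lemma prescribes the labels on the boundary.\<close>
    define lab where "lab = (\<lambda>q i. if q i = p then 1 else if 0 \<le> g i (pt q) then 0 else (1::nat))"
    have ptC: "pt q \<in> C" if "\<forall>i<n. q i \<le> p" for q
      using that p by (auto simp: C_def pt_def)
    have lab_bot: "lab q i = 0" if "\<forall>i<n. q i \<le> p" "i < n" "q i = 0" for q i
    proof -
      have "f (pt q) i \<in> {0..1}" using ptC[OF that(1)] that(2) by (intro cube) (auto simp: C_def)
      then show ?thesis using that p by (simp add: lab_def g_def pt_def)
    qed
    have nonpos: "g i (pt q) \<le> 0" if "\<forall>i<n. q i \<le> p" "i < n" "lab q i \<noteq> 0" for q i
    proof -
      have "f (pt q) i \<in> {0..1}" using ptC[OF that(1)] that(2) by (intro cube) (auto simp: C_def)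
      then show ?thesis using that p by (auto simp: lab_def g_def pt_def split: if_splits)
    qed
    have nonneg: "0 \<le> g i (pt q)" if "lab q i = 0" for q i
      using that by (auto simp: lab_def split: if_splits)
    obtain q where q: "\<forall>i<n. q i < p"
      "\<forall>i<n. \<exists>r s. (\<forall>j<n. q j \<le> r j \<and> r j \<le> q j + 1) \<and> (\<forall>j<n. q j \<le> s j \<and> s j \<le> q j + 1) \<and> lab r i \<noteq> lab s i"
      by (rule kuhn_lemma[of p n lab]) (use p lab_bot in \<open>auto simp: lab_def\<close>)
    have "\<bar>g i (pt q)\<bar> < e" if i: "i < n" for i
    proof -
      have near: "\<bar>g i (pt r) - g i (pt q)\<bar> < e \<and> (\<forall>i<n. r i \<le> p)"
        if r: "\<forall>j<n. q j \<le> r j \<and> r j \<le> q j + 1" for r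
      proof -
        have rp: "\<forall>i<n. r i \<le> p" using r q(1) by fastforce
        have "\<bar>pt r j - pt q j\<bar> \<le> d i" for j
        proof (cases "j < n")
          case True
          have "\<bar>real (r j) - real (q j)\<bar> \<le> 1" using r True by fastforce
          then have "\<bar>pt r j - pt q j\<bar> \<le> 1 / real p"
            using True p(1) by (simp add: pt_def divide_right_mono flip: diff_divide_distrib)
          then show ?thesis using p(2) d0(2)[OF i] by linarith
        next
          case False
          then show ?thesis using d(1)[of i] by (simp add: pt_def)
        qed
        then have "\<bar>g i (pt r) - g i (pt q)\<bar> < e"
          using q(1) rp by (intro d(2)[OF i] ptC) auto
        with rp show ?thesis by blast
      qed
      from q(2) i obtain r s where rs: "\<forall>j<n. q j \<le> r j \<and> r j \<le> q j + 1"
        "\<forall>j<n. q j \<le> s j \<and> s j \<le> q j + 1" "lab r i \<noteq> lab s i" by blast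
      show ?thesis
      proof (cases "lab r i = 0")
        case True
        then show ?thesis using nonneg[OF True] nonpos[of s i] near[OF rs(1)] near[OF rs(2)] rs(3) i by force
      next
        case False
        then have *: "lab s i = 0" using rs(3) by (auto simp: lab_def split: if_splits)
        show ?thesis using nonneg[OF *] nonpos[OF _ i False] near[OF rs(1)] near[OF rs(2)] by force
      qed
    qed
    then show ?thesis using ptC q(1) by (meson less_imp_le)
  qed
  \<comment> \<open>The total displacement attains its infimum, which is 0 by the approximate fixed points.\<close>
  define h where "h = (\<lambda>x. \<Sum>i<n. \<bar>g i x\<bar>)"
  have "continuous_on C h" unfolding h_def by (intro continuous_intros g) auto
  moreover have "C \<noteq> {}" using approx[of 1] by auto
  ultimately obtain x where x: "x \<in> C" "\<And>y. y \<in> C \<Longrightarrow> h x \<le> h y"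
    using continuous_attains_inf[OF C] by blast
  have "h x \<le> 0"
  proof (rule field_le_epsilon)
    fix e :: real assume e: "0 < e"
    define e' where "e' = e / (real n + 1)"
    have "0 < e'" using e by (simp add: e'_def)
    then obtain y where y: "y \<in> C" "\<And>i. i < n \<Longrightarrow> \<bar>g i y\<bar> < e'" using approx by meson
    have "h y \<le> (\<Sum>i<n. e')" unfolding h_def using y(2) by (intro sum_mono) (auto intro: less_imp_le)
    also have "\<dots> \<le> (real n + 1) * e'" using \<open>0 < e'\<close> by simp
    also have "\<dots> = e" by (simp add: e'_def)
    finally show "h x \<le> 0 + e" using x(2)[OF y(1)] by simp
  qed
  then have "h x = 0"
    unfolding h_def by (intro antisym sum_nonneg) auto
  then have "g i x = 0" if "i < n" for i
    using that by (simp add: h_def sum_nonneg_eq_0_iff)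
  then show ?thesis using that[of x] x(1) by (auto simp: C_def g_def)
qed

lemma brouwer_unit_cube_fun:
  fixes f :: "('i \<Rightarrow> real) \<Rightarrow> 'i \<Rightarrow> real"
  assumes fin: "finite I"
    and cont: "\<And>i. i \<in> I \<Longrightarrow> continuous_on {x. \<forall>i. x i \<in> {0..1}} (\<lambda>x. f x i)"
    and cube: "\<And>x i. (\<And>j. x j \<in> {0..1}) \<Longrightarrow> i \<in> I \<Longrightarrow> f x i \<in> {0..1}"
  obtains x where "\<And>i. x i \<in> {0..1}" "\<And>i. i \<in> I \<Longrightarrow> f x i = x i"
proof -
  obtain b where b: "bij_betw b {0..<card I} I"
    using ex_bij_betw_nat_finite[OF fin] by blast
  define b' where "b' = inv_into {0..<card I} b"
  have b': "b' (b k) = k" "b k \<in> I" if "k < card I" for k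
    using that b by (auto simp: b'_def bij_betw_def)
  have b'I: "b (b' i) = i" "b' i < card I" if "i \<in> I" for i
    using that b by (auto simp: b'_def f_inv_into_f bij_betw_def)
      (metis atLeastLessThan_iff bij_betw_def inv_into_into b)
  define e where "e = (\<lambda>(y::nat\<Rightarrow>real) i. y (b' i))"
  obtain y where y: "\<And>k. y k \<in> {0..1}" "\<And>k. k < card I \<Longrightarrow> f (e y) (b k) = y k"
  proof (rule brouwer_unit_cube_nat[of "card I" "\<lambda>y k. f (e y) (b k)"])
    fix k assume k: "k < card I"
    have e: "continuous_on {x. \<forall>i. x i \<in> {0..1}} e"
      unfolding e_def
      by (intro continuous_on_coordinatewise_then_product continuous_on_product_coordinates[THEN continuous_on_subset]) auto
    show "continuous_on {x. \<forall>i. x i \<in> {0..1}} (\<lambda>x. f (e x) (b k))"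
      using continuous_on_compose2[OF cont[OF b'(2)[OF k]] e] by (auto simp: e_def)
  next
    show "f (e y) (b k) \<in> {0..1}" if "\<And>j. y j \<in> {0..1}" "k < card I" for y k
      using that b' by (intro cube) (auto simp: e_def)
  qed (use that in blast)
  show ?thesis
  proof (rule that[of "e y"])
    show "e y i \<in> {0..1}" for i using y(1) by (simp add: e_def)
    show "f (e y) i = e y i" if "i \<in> I" for i using y(2)[of "b' i"] b'I[OF that] by (simp add: e_def)
  qed
qed

section \<open>The logarithmic mean\<close>

text \<open>The logarithmic mean is at most the arithmetic mean, in a form free of division.\<close>

lemma diff_le_arith_mean_ln:
  fixes a b :: real
  assumes "0 < b" "b \<le> a"
  shows "a - b \<le> (a + b) / 2 * (ln a - ln b)"
proof -
  define f where "f = (\<lambda>r::real. ln r - 2 * (r - 1) / (r + 1))"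
  have "f 1 \<le> f (a / b)"
  proof (rule DERIV_nonneg_imp_nondecreasing[of 1 "a / b" f])
    show "1 \<le> a / b" using assms by simp
    fix x :: real assume x: "1 \<le> x"
    have "(f has_real_derivative 1 / x - (2 * (x + 1) - 2 * (x - 1) * 1) / ((x + 1) * (x + 1))) (at x)"
      unfolding f_def using x by (auto intro!: derivative_eq_intros)
    moreover have "1 / x - (2 * (x + 1) - 2 * (x - 1) * 1) / ((x + 1) * (x + 1)) = (x - 1)\<^sup>2 / (x * (x + 1)\<^sup>2)"
      using x by (simp add: divide_simps power2_eq_square) (simp add: algebra_simps)
    moreover have "0 \<le> (x - 1)\<^sup>2 / (x * (x + 1)\<^sup>2)" using x by simp
    ultimately show "\<exists>y. (f has_real_derivative y) (at x) \<and> 0 \<le> y" by auto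
  qed
  then have "2 * (a / b - 1) / (a / b + 1) \<le> ln a - ln b"
    using assms by (simp add: f_def ln_div)
  moreover have "2 * (a / b - 1) / (a / b + 1) = 2 * (a - b) / (a + b)"
    using assms by (simp add: divide_simps)
  ultimately show ?thesis using assms by (simp add: divide_simps mult.commute)
qed

lemma edge_mean_commute: "edge_mean a b = edge_mean b a"
proof -
  have "(a - b) / (ln a - ln b) = (b - a) / (ln b - ln a)"
    by (metis minus_diff_eq minus_divide_divide)
  then show ?thesis by (auto simp: edge_mean_def min.commute)
qed

lemma edge_mean_zero: "a \<le> 0 \<or> b \<le> 0 \<Longrightarrow> edge_mean a b = 0"
  by (auto simp: edge_mean_def min_def)

lemma edge_mean_mult_ln_diff:
  assumes "0 < a" "0 < b"
  shows "edge_mean a b * (ln a - ln b) = a - b"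
  using assms by (auto simp: edge_mean_def)

lemma edge_mean_pos:
  assumes "0 < a" "0 < b"
  shows "0 < edge_mean a b"
  using assms by (cases "a < b") (auto simp: edge_mean_def divide_neg_neg)

lemma edge_mean_nonneg: "0 \<le> edge_mean a b"
  by (metis edge_mean_pos edge_mean_zero less_eq_real_def linorder_not_less)

lemma edge_mean_le_arith_mean:
  assumes "0 \<le> a" "0 \<le> b"
  shows "edge_mean a b \<le> (a + b) / 2"
proof -
  have main: "edge_mean a b \<le> (a + b) / 2" if "0 < b" "b \<le> a" for a b :: real
  proof (cases "a = b")
    case True
    then show ?thesis using that by (simp add: edge_mean_def)
  next
    case False
    then have "0 < ln a - ln b" using that by simp
    then show ?thesis
      using edge_mean_mult_ln_diff[of a b] diff_le_arith_mean_ln[OF that] that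
      by (metis less_le_trans mult_le_cancel_right_pos)
  qed
  show ?thesis
  proof (cases "a = 0 \<or> b = 0")
    case True
    then show ?thesis using assms by (auto simp: edge_mean_zero)
  next
    case False
    then show ?thesis
      using main[of a b] main[of b a] assms edge_mean_commute[of a b] by (cases "b \<le> a") auto
  qed
qed

text \<open>The right-hand side equals \<open>(a - b) (ln a - ln b) / 4\<close>, so this is again the comparison with the
  arithmetic mean, for the square roots of \<open>a\<close> and \<open>b\<close>.\<close>

lemma sqrt_diff_squared_le:
  assumes "0 < a" "0 < b"
  shows "(sqrt a - sqrt b)\<^sup>2 \<le> edge_mean a b * (ln a - ln b)\<^sup>2 / 4"
proof -
  have main: "(sqrt a - sqrt b)\<^sup>2 \<le> (a - b) * (ln a - ln b) / 4" if "0 < b" "b \<le> a" for a b :: real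
  proof -
    define s t where "s = sqrt a" and "t = sqrt b"
    have st: "0 < t" "t \<le> s" "a = s * s" "b = t * t" using that by (auto simp: s_def t_def)
    have "(s - t) * (s - t) \<le> (s - t) * ((s + t) / 2 * (ln s - ln t))"
      using st by (intro mult_left_mono diff_le_arith_mean_ln) auto
    also have "\<dots> = (a - b) * (ln a - ln b) / 4"
      using st by (simp add: ln_mult field_simps)
    finally show ?thesis by (simp add: s_def t_def power2_eq_square)
  qed
  have "(sqrt a - sqrt b)\<^sup>2 \<le> (a - b) * (ln a - ln b) / 4"
    using main[of a b] main[of b a] assms
    by (smt (verit) mult_minus_left mult_minus_right power2_commute)
  then show ?thesis
    using edge_mean_mult_ln_diff[OF assms] by (simp add: power2_eq_square flip: mult.assoc)
qed

text \<open>The logarithmic mean extends by 0 to the boundary of the quadrant, but not with a modulus of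
  continuity that is a power: for fixed \<open>b > 0\<close> it tends to 0 only like \<open>1 / ln(1/a)\<close>.\<close>

lemma tendsto_edge_mean_zero:
  assumes f: "(f \<longlongrightarrow> 0) F" and g: "(g \<longlongrightarrow> b) F"
    and nonneg: "\<forall>\<^sub>F x in F. 0 \<le> f x" "\<forall>\<^sub>F x in F. 0 \<le> g x"
  shows "((\<lambda>x. edge_mean (f x) (g x)) \<longlongrightarrow> 0) F"
proof (rule tendstoI)
  fix e :: real assume e: "0 < e"
  define \<epsilon> where "\<epsilon> = e / 2"
  define B where "B = \<bar>b\<bar> + 1"
  have pos: "0 < \<epsilon>" "0 < B" using e by (auto simp: \<epsilon>_def B_def)
  \<comment> \<open>Chosen such that \<open>a < x1\<close> and \<open>y > \<epsilon>\<close> imply \<open>ln y - ln a \<ge> B / \<epsilon>\<close>.\<close>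
  define x1 where "x1 = \<epsilon> * exp (- (B / \<epsilon>))"
  have x1: "0 < x1" "x1 \<le> \<epsilon>" "ln x1 = ln \<epsilon> - B / \<epsilon>"
    using pos by (auto simp: x1_def ln_mult)
  have "\<forall>\<^sub>F x in F. f x < x1" using order_tendstoD(2)[OF f x1(1)] .
  moreover have "\<forall>\<^sub>F x in F. g x < B" by (rule order_tendstoD(2)[OF g]) (simp add: B_def)
  ultimately show "\<forall>\<^sub>F x in F. dist (edge_mean (f x) (g x)) 0 < e"
    using nonneg
  proof eventually_elim
    case (elim x)
    define a y where "a = f x" and "y = g x"
    have ay: "a < x1" "y < B" "0 \<le> a" "0 \<le> y" using elim by (auto simp: a_def y_def)
    have "edge_mean a y \<le> \<epsilon>"
    proof (cases "y \<le> \<epsilon> \<or> a = 0")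
      case True
      then show ?thesis
        using edge_mean_le_arith_mean[OF ay(3,4)] ay(1) x1(2) pos by (auto simp: edge_mean_zero)
    next
      case False
      then have y: "\<epsilon> < y" "0 < a" using ay by auto
      have "ln a < ln \<epsilon> - B / \<epsilon>" using ay(1) y x1 by (metis ln_less_cancel_iff)
      moreover have "ln \<epsilon> \<le> ln y" using y pos by simp
      ultimately have "B / \<epsilon> \<le> ln y - ln a" by linarith
      then have "edge_mean y a * (B / \<epsilon>) \<le> edge_mean y a * (ln y - ln a)"
        by (intro mult_left_mono edge_mean_nonneg)
      also have "\<dots> \<le> B"
        using edge_mean_mult_ln_diff[of y a] y pos ay by simp
      finally show ?thesis using pos by (simp add: edge_mean_commute[of a y] field_simps)
    qed
    then show ?case using edge_mean_nonneg[of a y] e by (simp add: a_def y_def \<epsilon>_def)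
  qed
qed

lemma tendsto_edge_mean_pos:
  assumes f: "(f \<longlongrightarrow> a) F" and g: "(g \<longlongrightarrow> b) F" and "0 < a" "0 < b"
  shows "((\<lambda>x. edge_mean (f x) (g x)) \<longlongrightarrow> edge_mean a b) F"
proof -
  define h where "h = (\<lambda>r::real. edge_mean r 1)"
  \<comment> \<open>By homogeneity, only the function \<open>h\<close> of the quotient has to be studied.\<close>
  have hom: "edge_mean x y = y * h (x / y)" if "0 < x" "0 < y" for x y :: real
  proof (cases "x = y")
    case True
    then show ?thesis using that by (simp add: h_def edge_mean_def)
  next
    case False
    then have "y * h (x / y) = y * ((x / y - 1) / (ln x - ln y))"
      using that False by (simp add: h_def edge_mean_def ln_div min_def divide_le_0_iff)
    also have "\<dots> = y * (x / y - 1) / (ln x - ln y)" by simp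
    also have "y * (x / y - 1) = x - y" using that by (simp add: right_diff_distrib)
    finally show ?thesis using that False by (simp add: edge_mean_def)
  qed
  have cont: "isCont h r" if r: "0 < r" for r
  proof (cases "r = 1")
    case True
    have "((\<lambda>r. (ln r - ln 1) / (r - 1)) \<longlongrightarrow> 1) (at (1::real))"
      using DERIV_ln[of "1::real"] by (simp add: has_field_derivative_iff)
    then have "((\<lambda>r. inverse ((ln r - ln 1) / (r - 1))) \<longlongrightarrow> inverse 1) (at (1::real))"
      by (intro tendsto_inverse) auto
    moreover have "\<forall>\<^sub>F r in at (1::real). 0 < r"
      using eventually_at_in_open'[of "{0<..}" "1::real"] by simp
    then have "\<forall>\<^sub>F r in at (1::real). inverse ((ln r - ln 1) / (r - 1)) = h r"
      using eventually_neq_at_within[of 1 1 UNIV]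
      by eventually_elim (auto simp: h_def edge_mean_def)
    ultimately have "(h \<longlongrightarrow> inverse 1) (at 1)" by (rule Lim_transform_eventually)
    then show ?thesis unfolding isCont_def True by (simp add: h_def edge_mean_def)
  next
    case False
    have "isCont (\<lambda>r. (r - 1) / (ln r - ln 1)) r"
      using r False by (intro isCont_divide isCont_diff isCont_ln) auto
    moreover have "\<forall>\<^sub>F x in nhds r. x \<in> {0<..} - {1}"
      using r False by (intro eventually_nhds_in_open) auto
    then have "\<forall>\<^sub>F x in nhds r. (x - 1) / (ln x - ln 1) = h x"
      by eventually_elim (auto simp: h_def edge_mean_def)
    ultimately show ?thesis using isCont_cong[of "\<lambda>r. (r - 1) / (ln r - ln 1)" h r] by simp
  qed
  have "((\<lambda>x. g x * h (f x / g x)) \<longlongrightarrow> b * h (a / b)) F"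
    using assms by (intro tendsto_mult g isCont_tendsto_compose[OF cont] tendsto_divide f) auto
  moreover have "\<forall>\<^sub>F x in F. g x * h (f x / g x) = edge_mean (f x) (g x)"
    using order_tendstoD(1)[OF f assms(3)] order_tendstoD(1)[OF g assms(4)]
    by eventually_elim (simp add: hom)
  ultimately show ?thesis unfolding hom[OF assms(3,4)] by (rule Lim_transform_eventually)
qed

lemma continuous_on_edge_mean [continuous_intros]:
  assumes "continuous_on S f" "continuous_on S g" "\<And>x. x \<in> S \<Longrightarrow> 0 \<le> f x" "\<And>x. x \<in> S \<Longrightarrow> 0 \<le> g x"
  shows "continuous_on S (\<lambda>x. edge_mean (f x) (g x))"
  unfolding continuous_on_def
proof
  fix x assume x: "x \<in> S"
  let ?F = "at x within S"
  have lim: "(f \<longlongrightarrow> f x) ?F" "(g \<longlongrightarrow> g x) ?F" using assms(1,2) x by (auto simp: continuous_on_def)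
  have nonneg: "\<forall>\<^sub>F y in ?F. 0 \<le> f y" "\<forall>\<^sub>F y in ?F. 0 \<le> g y"
    using assms(3,4) by (auto simp: eventually_at_filter)
  consider "f x = 0" | "g x = 0" | "0 < f x" "0 < g x" using assms(3,4)[OF x] by linarith
  then show "((\<lambda>y. edge_mean (f y) (g y)) \<longlongrightarrow> edge_mean (f x) (g x)) ?F"
  proof cases
    case 1
    then show ?thesis using tendsto_edge_mean_zero[OF _ lim(2) nonneg] lim(1) by (simp add: edge_mean_zero)
  next
    case 2
    then show ?thesis using tendsto_edge_mean_zero[OF _ lim(1) nonneg(2,1)] lim(2)
      by (simp add: edge_mean_zero edge_mean_commute)
  next
    case 3
    then show ?thesis using tendsto_edge_mean_pos[OF lim] by blast
  qed
qed

section \<open>Fluxes across a single edge and their dissipation\<close>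

lemma matrix_inv_inverse:
  fixes A :: "'a::semiring_1 ^ 'n ^ 'n"
  assumes "invertible A"
  shows matrix_inv_right: "A ** matrix_inv A = mat 1" and matrix_inv_left: "matrix_inv A ** A = mat 1"
  using assms someI_ex[of "\<lambda>A'. A ** A' = mat 1 \<and> A' ** A = mat 1"]
  by (auto simp: invertible_def matrix_inv_def)

text \<open>The diagonal entries of \<open>c\<close> are unconstrained; no coefficient of the model refers to them.\<close>

locale cross_diffusion =
  fixes c :: "'n::finite \<Rightarrow> 'n \<Rightarrow> real"
  assumes card_ge_2: "2 \<le> CARD('n)"
    and c_sym: "\<And>i j. i \<noteq> j \<Longrightarrow> c i j = c j i"
    and c_pos: "\<And>i j. i \<noteq> j \<Longrightarrow> 0 < c i j"
begin

text \<open>The coefficients \<open>c_bar i j\<close>, set to 0 on the diagonal so that sums may range over all indices.\<close>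

definition cross_coeff :: "'n \<Rightarrow> 'n \<Rightarrow> real" where
  "cross_coeff i j = (if i = j then 0 else c_bar c i j)"

lemma finite_coefficients: "finite {f i j | i j. i \<noteq> (j::'n)}"
proof (rule finite_subset)
  show "{f i j | i j. i \<noteq> j} \<subseteq> (\<lambda>(i, j). f i j) ` UNIV" by auto
qed simp

lemma ex_distinct: "\<exists>i j. i \<noteq> (j::'n)"
proof (rule ccontr)
  assume "\<not> ?thesis"
  then have "CARD('n) \<le> card {undefined::'n}" by (intro card_mono) auto
  then show False using card_ge_2 by simp
qed

lemma c_star_pos: "0 < c_star c"
  unfolding c_star_def using ex_distinct c_pos
  by (subst Min_gr_iff) (auto simp: finite_coefficients)

lemma c_bar_nonneg: "i \<noteq> j \<Longrightarrow> 0 \<le> c_bar c i j"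
  unfolding c_bar_def c_star_def by (auto intro!: Min_le finite_coefficients)

lemma c_bar_le_max: "i \<noteq> j \<Longrightarrow> c_bar c i j \<le> c_bar_max c"
  unfolding c_bar_max_def by (rule Max_ge) (auto intro!: finite_coefficients)

lemma c_bar_max_nonneg: "0 \<le> c_bar_max c"
  using ex_distinct c_bar_nonneg c_bar_le_max by (meson order_trans)

lemma cross_coeff_nonneg: "0 \<le> cross_coeff i j"
  by (simp add: cross_coeff_def c_bar_nonneg)

lemma cross_coeff_le_max: "cross_coeff i j \<le> c_bar_max c"
  by (simp add: cross_coeff_def c_bar_le_max c_bar_max_nonneg)

lemma cross_coeff_commute: "cross_coeff i j = cross_coeff j i"
  using c_sym by (auto simp: cross_coeff_def c_bar_def)

lemma A_bar_mult:
  "(A_bar c w *v x) $ i = (\<Sum>j\<in>UNIV. cross_coeff i j * (w $ j * x $ i - w $ i * x $ j))"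
proof -
  have "(A_bar c w *v x) $ i
      = (\<Sum>k\<in>UNIV - {i}. c_bar c i k * w $ k) * x $ i + (\<Sum>j\<in>UNIV - {i}. - c_bar c i j * w $ i * x $ j)"
    unfolding matrix_vector_mult_def by (subst vec_lambda_beta, subst sum.remove[of _ i]) (auto simp: A_bar_def)
  also have "\<dots> = (\<Sum>j\<in>UNIV - {i}. cross_coeff i j * (w $ j * x $ i - w $ i * x $ j))"
    unfolding sum_distrib_right by (subst sum.distrib[symmetric]) (auto intro!: sum.cong simp: cross_coeff_def algebra_simps)
  also have "\<dots> = (\<Sum>j\<in>UNIV. cross_coeff i j * (w $ j * x $ i - w $ i * x $ j))"
    by (rule sum.mono_neutral_left) (auto simp: cross_coeff_def)
  finally show ?thesis .
qed

lemma sum_A_bar_mult: "(\<Sum>i\<in>UNIV. (A_bar c w *v x) $ i) = 0"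
proof -
  let ?f = "\<lambda>i j. cross_coeff i j * (w $ j * x $ i - w $ i * x $ j)"
  have "(\<Sum>i\<in>UNIV. \<Sum>j\<in>UNIV. ?f i j) = (\<Sum>i\<in>UNIV. \<Sum>j\<in>UNIV. ?f j i)"
    by (rule sum.swap)
  also have "\<dots> = (\<Sum>i\<in>UNIV. \<Sum>j\<in>UNIV. - ?f i j)"
    by (intro sum.cong refl) (simp add: cross_coeff_commute algebra_simps)
  finally show ?thesis by (simp add: A_bar_mult sum_negf)
qed

text \<open>The matrix \<open>c\<^sup>* I + A_bar(w)\<close> that relates the flux across an edge to the jump.\<close>

definition flux_matrix :: "real ^ 'n \<Rightarrow> real ^ 'n ^ 'n" where
  "flux_matrix w = (\<chi> i j. (if i = j then c_star c else 0) + A_bar c w $ i $ j)"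

lemma flux_matrix_mult: "flux_matrix w *v x = c_star c *\<^sub>R x + A_bar c w *v x"
proof (rule vec_eq_iff[THEN iffD2], rule allI)
  fix i
  have "(flux_matrix w *v x) $ i
      = (\<Sum>j\<in>UNIV. (if i = j then c_star c * x $ j else 0)) + (\<Sum>j\<in>UNIV. A_bar c w $ i $ j * x $ j)"
    unfolding matrix_vector_mult_def flux_matrix_def
    by (subst sum.distrib[symmetric]) (auto intro!: sum.cong simp: algebra_simps)
  then show "(flux_matrix w *v x) $ i = (c_star c *\<^sub>R x + A_bar c w *v x) $ i"
    by (simp add: matrix_vector_mult_def)
qed

text \<open>Strict diagonal dominance by columns: testing row \<open>i\<close> with the sign of \<open>x\<^sub>i\<close>, the contributions of the
  cross-diffusion terms cancel after summation over the rows.\<close>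

lemma flux_matrix_l1_bound:
  assumes w: "\<And>i. 0 \<le> w $ i"
  shows "c_star c * (\<Sum>i\<in>UNIV. \<bar>x $ i\<bar>) \<le> (\<Sum>i\<in>UNIV. \<bar>(flux_matrix w *v x) $ i\<bar>)"
proof -
  let ?p = "\<lambda>i j. cross_coeff i j * (w $ j * \<bar>x $ i\<bar>)"
  let ?q = "\<lambda>i j. cross_coeff i j * (w $ i * \<bar>x $ j\<bar>)"
  have "(\<Sum>i\<in>UNIV. \<Sum>j\<in>UNIV. ?p i j) = (\<Sum>i\<in>UNIV. \<Sum>j\<in>UNIV. ?p j i)"
    by (rule sum.swap)
  also have "\<dots> = (\<Sum>i\<in>UNIV. \<Sum>j\<in>UNIV. ?q i j)"
    by (simp add: cross_coeff_commute)
  finally have swap: "(\<Sum>i\<in>UNIV. \<Sum>j\<in>UNIV. ?p i j) = (\<Sum>i\<in>UNIV. \<Sum>j\<in>UNIV. ?q i j)" .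
  have row: "c_star c * \<bar>x $ i\<bar> + (\<Sum>j\<in>UNIV. ?p i j) - (\<Sum>j\<in>UNIV. ?q i j) \<le> \<bar>(flux_matrix w *v x) $ i\<bar>" for i
  proof -
    define s where "s = sgn (x $ i)"
    have s: "\<bar>s\<bar> \<le> 1" "s * x $ i = \<bar>x $ i\<bar>" unfolding s_def by (auto simp: sgn_if abs_if)
    have "s * (cross_coeff i j * (w $ j * x $ i - w $ i * x $ j)) \<ge> ?p i j - ?q i j" for j
    proof -
      have "s * x $ j \<le> \<bar>x $ j\<bar>"
        using abs_ge_self[of "s * x $ j"] mult_left_le_one_le[of "\<bar>x $ j\<bar>" "\<bar>s\<bar>"] s(1)
        by (simp add: abs_mult)
      then have "cross_coeff i j * (w $ i * (s * x $ j)) \<le> ?q i j"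
        by (intro mult_left_mono cross_coeff_nonneg w)
      moreover have "s * (cross_coeff i j * (w $ j * x $ i - w $ i * x $ j))
        = cross_coeff i j * (w $ j * (s * x $ i)) - cross_coeff i j * (w $ i * (s * x $ j))"
        by (simp add: algebra_simps)
      ultimately show ?thesis using s(2) by simp
    qed
    then have "(\<Sum>j\<in>UNIV. ?p i j - ?q i j) \<le> (\<Sum>j\<in>UNIV. s * (cross_coeff i j * (w $ j * x $ i - w $ i * x $ j)))"
      by (intro sum_mono) auto
    also have "\<dots> = s * (A_bar c w *v x) $ i"
      by (simp add: A_bar_mult sum_distrib_left)
    finally have "c_star c * \<bar>x $ i\<bar> + (\<Sum>j\<in>UNIV. ?p i j) - (\<Sum>j\<in>UNIV. ?q i j) \<le> s * (flux_matrix w *v x) $ i"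
      by (simp add: mult.left_commute[of s "c_star c"] s(2) flux_matrix_mult sum_subtractf distrib_left)
    also have "\<dots> \<le> \<bar>(flux_matrix w *v x) $ i\<bar>" (is "_ \<le> \<bar>?y\<bar>")
      using abs_ge_self[of "s * ?y"] mult_left_le_one_le[of "\<bar>?y\<bar>" "\<bar>s\<bar>"] s(1)
      by (simp add: abs_mult)
    finally show ?thesis .
  qed
  have "c_star c * (\<Sum>i\<in>UNIV. \<bar>x $ i\<bar>)
      = (\<Sum>i\<in>UNIV. c_star c * \<bar>x $ i\<bar> + (\<Sum>j\<in>UNIV. ?p i j) - (\<Sum>j\<in>UNIV. ?q i j))"
    using swap by (simp add: sum.distrib sum_subtractf sum_distrib_left)
  also have "\<dots> \<le> (\<Sum>i\<in>UNIV. \<bar>(flux_matrix w *v x) $ i\<bar>)"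
    by (intro sum_mono row)
  finally show ?thesis .
qed

lemma invertible_flux_matrix:
  assumes "\<And>i. 0 \<le> w $ i"
  shows "invertible (flux_matrix w)"
proof -
  have "x = 0" if "flux_matrix w *v x = 0" for x
  proof -
    have "(\<Sum>i\<in>UNIV. \<bar>x $ i\<bar>) \<le> 0"
      using flux_matrix_l1_bound[OF assms, of x] that c_star_pos by (simp add: mult_le_0_iff)
    then have "(\<Sum>i\<in>UNIV. \<bar>x $ i\<bar>) = 0" by (intro antisym sum_nonneg) auto
    then show ?thesis by (simp add: sum_nonneg_eq_0_iff vec_eq_iff)
  qed
  then show ?thesis
    by (simp add: invertible_left_inverse matrix_left_invertible_ker)
qed

text \<open>The edge value \<open>u\<^sub>\<sigma>\<close> as a function of the states \<open>x\<close> and \<open>y\<close> in the two adjacent cells.\<close>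

definition edge_means :: "real ^ 'n \<Rightarrow> real ^ 'n \<Rightarrow> real ^ 'n" where
  "edge_means x y = (\<chi> i. edge_mean (x $ i) (y $ i))"

lemma edge_means_nonneg: "0 \<le> edge_means x y $ i"
  by (simp add: edge_means_def edge_mean_nonneg)

lemma edge_means_commute: "edge_means x y = edge_means y x"
  by (simp add: edge_means_def edge_mean_commute)

text \<open>The flux across an edge between centers at distance \<open>d\<close>, out of the cell with state \<open>x\<close> into the cell with state \<open>y\<close>.\<close>

definition edge_flux :: "real \<Rightarrow> real ^ 'n \<Rightarrow> real ^ 'n \<Rightarrow> real ^ 'n" where
  "edge_flux d x y = matrix_inv (flux_matrix (edge_means x y)) *v (- (1 / d) *\<^sub>R (y - x))"

lemma flux_matrix_edge_flux:
  "flux_matrix (edge_means x y) *v edge_flux d x y = - (1 / d) *\<^sub>R (y - x)"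
  unfolding edge_flux_def using matrix_inv_right[OF invertible_flux_matrix[OF edge_means_nonneg]]
  by (simp add: matrix_vector_mul_assoc)

lemma edge_flux_unique:
  "(1 / d) *\<^sub>R (y - x) + c_star c *\<^sub>R J + A_bar c (edge_means x y) *v J = 0 \<longleftrightarrow> J = edge_flux d x y"
proof -
  let ?B = "flux_matrix (edge_means x y)"
  have inv: "invertible ?B" by (intro invertible_flux_matrix edge_means_nonneg)
  have neg: "u + v + z = 0 \<longleftrightarrow> v + z = - u" for u v z :: "real ^ 'n"
    by (simp add: eq_neg_iff_add_eq_0 ac_simps)
  have "(1 / d) *\<^sub>R (y - x) + c_star c *\<^sub>R J + A_bar c (edge_means x y) *v J = 0
     \<longleftrightarrow> ?B *v J = - (1 / d) *\<^sub>R (y - x)"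
    unfolding flux_matrix_mult neg by simp
  also have "\<dots> \<longleftrightarrow> J = edge_flux d x y"
  proof
    assume "?B *v J = - (1 / d) *\<^sub>R (y - x)"
    then have "edge_flux d x y = matrix_inv ?B *v (?B *v J)" by (simp add: edge_flux_def)
    then show "J = edge_flux d x y"
      using inv by (simp add: matrix_vector_mul_assoc matrix_inv_left)
  qed (simp add: flux_matrix_edge_flux)
  finally show ?thesis .
qed

lemma edge_flux_component:
  "(y $ i - x $ i) / d + c_star c * edge_flux d x y $ i
     + (\<Sum>j\<in>UNIV. cross_coeff i j * (edge_means x y $ j * edge_flux d x y $ i - edge_means x y $ i * edge_flux d x y $ j)) = 0"
proof -
  have "((1 / d) *\<^sub>R (y - x) + c_star c *\<^sub>R edge_flux d x y + A_bar c (edge_means x y) *v edge_flux d x y) $ i = 0"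
    by (simp only: edge_flux_unique[THEN iffD2, OF refl] zero_index)
  then show ?thesis by (simp add: A_bar_mult)
qed

lemma edge_flux_commute: "edge_flux d y x = - edge_flux d x y"
proof -
  have "(1 / d) *\<^sub>R (x - y) + c_star c *\<^sub>R (- edge_flux d x y) + A_bar c (edge_means y x) *v (- edge_flux d x y)
    = - ((1 / d) *\<^sub>R (y - x) + c_star c *\<^sub>R edge_flux d x y + A_bar c (edge_means x y) *v edge_flux d x y)"
    by (simp add: edge_means_commute[of y x] vec.neg algebra_simps)
  also have "\<dots> = 0" by (simp only: edge_flux_unique[THEN iffD2, OF refl] minus_zero)
  finally show ?thesis by (simp only: edge_flux_unique)
qed

lemma sum_edge_flux:
  assumes "(\<Sum>i\<in>UNIV. x $ i) = (\<Sum>i\<in>UNIV. y $ i)"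
  shows "(\<Sum>i\<in>UNIV. edge_flux d x y $ i) = 0"
proof -
  let ?J = "edge_flux d x y"
  have "0 = (\<Sum>i\<in>UNIV. ((1 / d) *\<^sub>R (y - x) + c_star c *\<^sub>R ?J + A_bar c (edge_means x y) *v ?J) $ i)"
    by (simp only: edge_flux_unique[THEN iffD2, OF refl]) simp
  also have "\<dots> = (1 / d) * (\<Sum>i\<in>UNIV. y $ i - x $ i) + c_star c * (\<Sum>i\<in>UNIV. ?J $ i) + (\<Sum>i\<in>UNIV. (A_bar c (edge_means x y) *v ?J) $ i)"
    by (simp add: sum.distrib sum_distrib_left)
  also have "\<dots> = c_star c * (\<Sum>i\<in>UNIV. ?J $ i)"
    using assms by (simp add: sum_A_bar_mult sum_subtractf)
  finally show ?thesis using c_star_pos by simp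
qed

text \<open>If species \<open>i\<close> is absent from a cell, then its edge value vanishes and its flux is decoupled from the
  other species: it can only enter the cell.\<close>

lemma edge_flux_at_zero:
  assumes "x $ i = 0" "0 < d"
  shows "0 \<le> y $ i \<Longrightarrow> edge_flux d x y $ i \<le> 0" "0 < y $ i \<Longrightarrow> edge_flux d x y $ i < 0"
proof -
  let ?J = "edge_flux d x y" and ?w = "edge_means x y"
  define q where "q = c_star c + (\<Sum>j\<in>UNIV. cross_coeff i j * ?w $ j)"
  have q: "0 < q" unfolding q_def
    using c_star_pos by (intro add_pos_nonneg sum_nonneg mult_nonneg_nonneg cross_coeff_nonneg edge_means_nonneg)
  have "?w $ i = 0" using assms by (simp add: edge_means_def edge_mean_zero)
  then have "y $ i / d + q * ?J $ i = 0"
    using edge_flux_component[of y i x d] assms(1)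
    by (simp add: q_def distrib_right sum_distrib_right mult.assoc)
  then have "q * ?J $ i = - (y $ i / d)" by linarith
  then have "?J $ i = - (y $ i / d) / q" using q by (metis less_irrefl nonzero_mult_div_cancel_left)
  then show "0 \<le> y $ i \<Longrightarrow> ?J $ i \<le> 0" "0 < y $ i \<Longrightarrow> ?J $ i < 0"
    using q assms(2) by (auto simp: divide_nonneg_pos)
qed

text \<open>Continuity of the inverse matrix is obtained from Cramer's rule.\<close>

lemma continuous_on_edge_flux:
  fixes f g :: "'z::topological_space \<Rightarrow> real ^ 'n"
  assumes f: "\<And>i. continuous_on S (\<lambda>z. f z $ i)" and g: "\<And>i. continuous_on S (\<lambda>z. g z $ i)"
    and nonneg: "\<And>z i. z \<in> S \<Longrightarrow> 0 \<le> f z $ i" "\<And>z i. z \<in> S \<Longrightarrow> 0 \<le> g z $ i"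
  shows "continuous_on S (\<lambda>z. edge_flux d (f z) (g z) $ i)"
proof -
  let ?B = "\<lambda>z. flux_matrix (edge_means (f z) (g z))"
  let ?b = "\<lambda>z. - (1 / d) *\<^sub>R (g z - f z)"
  have nz: "det (?B z) \<noteq> 0" for z
    using invertible_flux_matrix[OF edge_means_nonneg] invertible_det_nz by blast
  have J: "edge_flux d (f z) (g z) $ i = det (\<chi> k j. if j = i then ?b z $ k else ?B z $ k $ j) / det (?B z)" for z
    using cramer[OF nz, THEN iffD1, OF flux_matrix_edge_flux] by (rule arg_cong[THEN trans]) simp
  have w: "continuous_on S (\<lambda>z. edge_means (f z) (g z) $ k)" for k
    unfolding edge_means_def by (simp add: continuous_on_edge_mean f g nonneg)
  have A: "continuous_on S (\<lambda>z. ?B z $ k $ j)" for k j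
    unfolding flux_matrix_def A_bar_def by (cases "k = j") (auto intro!: continuous_intros w)
  have b: "continuous_on S (\<lambda>z. ?b z $ k)" for k
    unfolding vector_scaleR_component vector_minus_component
    by (intro continuous_on_scaleR continuous_on_const continuous_on_diff f g)
  have det: "continuous_on S (\<lambda>z. det (A z))" if "\<And>k j. continuous_on S (\<lambda>z. A z $ k $ j)"
    for A :: "'z \<Rightarrow> real ^ 'n ^ 'n"
    unfolding det_def by (intro continuous_intros that)
  have "continuous_on S (\<lambda>z. det (\<chi> k j. if j = i then ?b z $ k else ?B z $ k $ j) / det (?B z))"
  proof (intro continuous_on_divide det A ballI nz)
    fix k j
    show "continuous_on S (\<lambda>z. (\<chi> k j. if j = i then ?b z $ k else ?B z $ k $ j) $ k $ j)"
      using A[of k j] b[of k] by (cases "j = i") auto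
  qed
  then show ?thesis by (simp only: J)
qed

lemma edge_means_le_one:
  assumes "x \<in> conc_simplex" "y \<in> conc_simplex"
  shows "(\<Sum>i\<in>UNIV. edge_means x y $ i) \<le> 1" "edge_means x y $ i \<le> 1"
proof -
  have "(\<Sum>i\<in>UNIV. edge_means x y $ i) \<le> (\<Sum>i\<in>UNIV. (x $ i + y $ i) / 2)"
    using assms edge_mean_le_arith_mean unfolding edge_means_def conc_simplex_def
    by (intro sum_mono) force
  also have "\<dots> = 1" using assms by (simp add: conc_simplex_def sum.distrib flip: sum_divide_distrib)
  finally show *: "(\<Sum>i\<in>UNIV. edge_means x y $ i) \<le> 1" .
  have "edge_means x y $ i \<le> (\<Sum>i\<in>UNIV. edge_means x y $ i)"
    by (rule member_le_sum) (auto simp: edge_means_nonneg)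
  then show "edge_means x y $ i \<le> 1" using * by simp
qed

text \<open>The estimate on a single edge. In the notation of the proof, \<open>P = \<Sum> w\<^sub>i r\<^sub>i\<^sup>2\<close> and the entropy
  dissipation on the right-hand side is \<open>d (\<kappa> P + Q)\<close>. The flux part uses half of \<open>\<kappa> P\<close>; the rest
  dominates the part with the square roots because
  \<open>\<kappa>\<^sup>2 P + 2 \<kappa> Q + 2 \<beta> Q \<le> (\<kappa> P + 2 Q) (\<kappa> + 2 \<beta>)\<close>.\<close>

lemma edge_dissipation:
  assumes x: "x \<in> conc_simplex" "\<And>i. 0 < x $ i" and y: "y \<in> conc_simplex" "\<And>i. 0 < y $ i"
    and d: "0 < d"
  defines "J \<equiv> edge_flux d x y"
  shows "c_star c / 2 * d * (norm J)\<^sup>2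
      + alpha c / 2 * (1 / d) * (norm ((\<chi> i. sqrt (y $ i)) - (\<chi> i. sqrt (x $ i)) :: real ^ 'n))\<^sup>2
     \<le> - (\<Sum>i\<in>UNIV. J $ i * (ln (y $ i) - ln (x $ i)))"
proof -
  define w where "w = edge_means x y"
  have w: "0 < w $ i" "w $ i \<le> 1" for i
    using edge_means_le_one(2)[OF x(1) y(1), of i] x(2) y(2)
    by (auto simp: w_def edge_means_def edge_mean_pos)
  have sum_w: "(\<Sum>i\<in>UNIV. w $ i) \<le> 1" unfolding w_def by (rule edge_means_le_one(1)[OF x(1) y(1)])
  define r where "r = (\<lambda>i. J $ i / w $ i)"
  have J: "J $ i = w $ i * r i" for i using w(1)[of i] by (simp add: r_def)
  define T where "T = (\<lambda>i. \<Sum>j\<in>UNIV. cross_coeff i j * w $ j * (r i - r j))"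
  define P where "P = (\<Sum>i\<in>UNIV. w $ i * (r i)\<^sup>2)"
  define Q where "Q = (\<Sum>i\<in>UNIV. w $ i * r i * T i)"
  define \<kappa> \<beta> where "\<kappa> = c_star c" and "\<beta> = c_bar_max c"
  have \<kappa>: "0 < \<kappa>" and \<beta>: "0 \<le> \<beta>" using c_star_pos c_bar_max_nonneg by (auto simp: \<kappa>_def \<beta>_def)
  have ln_diff: "ln (y $ i) - ln (x $ i) = - d * (\<kappa> * r i + T i)" for i
  proof -
    have "w $ i * (ln (y $ i) - ln (x $ i)) = y $ i - x $ i"
      using edge_mean_mult_ln_diff[OF y(2) x(2)] by (simp add: w_def edge_means_def edge_mean_commute)
    moreover have "(y $ i - x $ i) / d + \<kappa> * (w $ i * r i)
        + (\<Sum>j\<in>UNIV. cross_coeff i j * (w $ j * (w $ i * r i) - w $ i * (w $ j * r j))) = 0"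
      using edge_flux_component[of y i x d] by (simp only: J_def[symmetric] w_def[symmetric] \<kappa>_def[symmetric] J)
    moreover have "(\<Sum>j\<in>UNIV. cross_coeff i j * (w $ j * (w $ i * r i) - w $ i * (w $ j * r j))) = w $ i * T i"
      unfolding T_def sum_distrib_left by (intro sum.cong) (auto simp: algebra_simps)
    ultimately have "w $ i * (ln (y $ i) - ln (x $ i)) / d + \<kappa> * (w $ i * r i) + w $ i * T i = 0"
      by (simp only:)
    then have "w $ i * ((ln (y $ i) - ln (x $ i)) / d + \<kappa> * r i + T i) = 0"
      by (simp only: distrib_left times_divide_eq_right mult.left_commute)
    then have "(ln (y $ i) - ln (x $ i)) / d + \<kappa> * r i + T i = 0" using w(1)[of i] by simp
    then show ?thesis using d by (simp add: field_simps)
  qed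
  have diss: "- (\<Sum>i\<in>UNIV. J $ i * (ln (y $ i) - ln (x $ i))) = d * (\<kappa> * P + Q)"
  proof -
    have "- (\<Sum>i\<in>UNIV. J $ i * (ln (y $ i) - ln (x $ i))) = (\<Sum>i\<in>UNIV. d * (\<kappa> * (w $ i * (r i)\<^sup>2) + w $ i * r i * T i))"
      unfolding sum_negf[symmetric] ln_diff J by (intro sum.cong) (auto simp: algebra_simps power2_eq_square)
    also have "\<dots> = d * (\<kappa> * P + Q)"
      unfolding P_def Q_def sum.distrib[symmetric] sum_distrib_left by simp
    finally show ?thesis .
  qed
  \<comment> \<open>Symmetrisation of \<open>Q\<close> in the two indices.\<close>
  define R where "R = (\<Sum>i\<in>UNIV. \<Sum>j\<in>UNIV. w $ i * (cross_coeff i j * w $ j * (r i - r j)\<^sup>2))"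
  have R: "R = 2 * Q"
  proof -
    have 1: "Q = (\<Sum>i\<in>UNIV. \<Sum>j\<in>UNIV. w $ i * r i * (cross_coeff i j * w $ j * (r i - r j)))"
      by (simp add: Q_def T_def sum_distrib_left)
    also have "\<dots> = (\<Sum>i\<in>UNIV. \<Sum>j\<in>UNIV. w $ j * r j * (cross_coeff j i * w $ i * (r j - r i)))"
      by (rule sum.swap)
    finally have 2: "Q = (\<Sum>i\<in>UNIV. \<Sum>j\<in>UNIV. w $ j * r j * (cross_coeff i j * w $ i * (r j - r i)))"
      by (simp add: cross_coeff_commute)
    have "2 * Q = Q + Q" by simp
    also have "\<dots> = (\<Sum>i\<in>UNIV. \<Sum>j\<in>UNIV. w $ i * r i * (cross_coeff i j * w $ j * (r i - r j)))
         + (\<Sum>i\<in>UNIV. \<Sum>j\<in>UNIV. w $ j * r j * (cross_coeff i j * w $ i * (r j - r i)))"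
      using 1 2 by simp
    also have "\<dots> = R"
      unfolding R_def sum.distrib[symmetric] by (intro sum.cong) (auto simp: algebra_simps power2_eq_square)
    finally show ?thesis by simp
  qed
  have Q_nonneg: "0 \<le> Q"
  proof -
    have "0 \<le> R" unfolding R_def
      using w(1) by (intro sum_nonneg mult_nonneg_nonneg cross_coeff_nonneg) (auto intro: less_imp_le)
    then show ?thesis using R by simp
  qed
  have T_sq: "(T i)\<^sup>2 \<le> \<beta> * (\<Sum>j\<in>UNIV. cross_coeff i j * w $ j * (r i - r j)\<^sup>2)" for i
  proof -
    let ?s = "\<lambda>j. sqrt (cross_coeff i j * w $ j)"
    have nn: "0 \<le> cross_coeff i j * w $ j" for j using w(1)[of j] by (simp add: cross_coeff_nonneg)
    have "T i = (\<Sum>j\<in>UNIV. ?s j * (?s j * (r i - r j)))"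
      unfolding T_def using nn by (intro sum.cong) (auto simp flip: mult.assoc)
    then have "(T i)\<^sup>2 \<le> (\<Sum>j\<in>UNIV. (?s j)\<^sup>2) * (\<Sum>j\<in>UNIV. (?s j * (r i - r j))\<^sup>2)"
      by (simp only:) (rule Cauchy_Schwarz_ineq_sum)
    also have "\<dots> = (\<Sum>j\<in>UNIV. cross_coeff i j * w $ j) * (\<Sum>j\<in>UNIV. cross_coeff i j * w $ j * (r i - r j)\<^sup>2)"
      using nn by (simp add: power_mult_distrib)
    also have "\<dots> \<le> \<beta> * (\<Sum>j\<in>UNIV. cross_coeff i j * w $ j * (r i - r j)\<^sup>2)"
    proof (rule mult_right_mono)
      have "(\<Sum>j\<in>UNIV. cross_coeff i j * w $ j) \<le> (\<Sum>j\<in>UNIV. \<beta> * w $ j)"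
        using w(1) cross_coeff_le_max unfolding \<beta>_def by (intro sum_mono mult_right_mono) (auto intro: less_imp_le)
      also have "\<dots> \<le> \<beta> * 1" unfolding sum_distrib_left[symmetric] using sum_w \<beta> by (rule mult_left_mono)
      finally show "(\<Sum>j\<in>UNIV. cross_coeff i j * w $ j) \<le> \<beta>" by simp
      show "0 \<le> (\<Sum>j\<in>UNIV. cross_coeff i j * w $ j * (r i - r j)\<^sup>2)" using nn by (intro sum_nonneg) simp
    qed
    finally show ?thesis .
  qed
  have wT: "(\<Sum>i\<in>UNIV. w $ i * (T i)\<^sup>2) \<le> 2 * \<beta> * Q"
  proof -
    have "(\<Sum>i\<in>UNIV. w $ i * (T i)\<^sup>2) \<le> (\<Sum>i\<in>UNIV. w $ i * (\<beta> * (\<Sum>j\<in>UNIV. cross_coeff i j * w $ j * (r i - r j)\<^sup>2)))"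
      using w(1) T_sq by (intro sum_mono mult_left_mono) (auto intro: less_imp_le)
    also have "\<dots> = \<beta> * R"
      unfolding R_def by (simp add: sum_distrib_left mult.left_commute)
    finally show ?thesis using R by simp
  qed
  have norm_J: "(norm J)\<^sup>2 \<le> P"
  proof -
    have "(norm J)\<^sup>2 = (\<Sum>i\<in>UNIV. (J $ i)\<^sup>2)"
      by (simp add: norm_vec_def L2_set_def sum_nonneg)
    also have "\<dots> \<le> P"
      unfolding P_def
    proof (rule sum_mono)
      fix i
      have "(J $ i)\<^sup>2 = w $ i * (w $ i * (r i)\<^sup>2)" by (simp add: J power2_eq_square)
      also have "\<dots> \<le> 1 * (w $ i * (r i)\<^sup>2)" using w[of i] by (intro mult_right_mono) auto
      finally show "(J $ i)\<^sup>2 \<le> w $ i * (r i)\<^sup>2" by simp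
    qed
    finally show ?thesis .
  qed
  have norm_sqrt: "(norm ((\<chi> i. sqrt (y $ i)) - (\<chi> i. sqrt (x $ i)) :: real ^ 'n))\<^sup>2
      \<le> d\<^sup>2 / 4 * (\<kappa>\<^sup>2 * P + 2 * \<kappa> * Q + 2 * \<beta> * Q)" (is "(norm ?D)\<^sup>2 \<le> _")
  proof -
    have "(norm ?D)\<^sup>2 = (\<Sum>i\<in>UNIV. (sqrt (y $ i) - sqrt (x $ i))\<^sup>2)"
      by (simp add: norm_vec_def L2_set_def sum_nonneg)
    also have "\<dots> \<le> (\<Sum>i\<in>UNIV. w $ i * (ln (y $ i) - ln (x $ i))\<^sup>2 / 4)"
      using sqrt_diff_squared_le[OF y(2) x(2)]
      by (intro sum_mono) (simp add: w_def edge_means_def edge_mean_commute)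
    also have "\<dots> = (\<Sum>i\<in>UNIV. d\<^sup>2 / 4 * (\<kappa>\<^sup>2 * (w $ i * (r i)\<^sup>2) + 2 * \<kappa> * (w $ i * r i * T i) + w $ i * (T i)\<^sup>2))"
      unfolding ln_diff by (intro sum.cong) (auto simp: algebra_simps power2_eq_square)
    also have "\<dots> = d\<^sup>2 / 4 * (\<kappa>\<^sup>2 * P + 2 * \<kappa> * Q + (\<Sum>i\<in>UNIV. w $ i * (T i)\<^sup>2))"
      unfolding P_def Q_def sum.distrib[symmetric] sum_distrib_left by simp
    also have "\<dots> \<le> d\<^sup>2 / 4 * (\<kappa>\<^sup>2 * P + 2 * \<kappa> * Q + 2 * \<beta> * Q)"
      using wT by (intro mult_left_mono add_left_mono) auto
    finally show ?thesis .
  qed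
  have P_nonneg: "0 \<le> P" unfolding P_def using w(1) by (intro sum_nonneg) (simp add: less_imp_le)
  have "alpha c / 2 * (1 / d) * (norm ?D)\<^sup>2
      \<le> alpha c / 2 * (1 / d) * (d\<^sup>2 / 4 * (\<kappa>\<^sup>2 * P + 2 * \<kappa> * Q + 2 * \<beta> * Q))"
    using d \<kappa> \<beta> by (intro mult_left_mono norm_sqrt) (auto simp: alpha_def \<kappa>_def \<beta>_def)
  also have "\<dots> = d * ((\<kappa>\<^sup>2 * P + 2 * \<kappa> * Q + 2 * \<beta> * Q) / (2 * (\<kappa> + 2 * \<beta>)))"
    using d by (simp add: alpha_def \<kappa>_def \<beta>_def power2_eq_square divide_simps)
  also have "\<dots> \<le> d * (\<kappa> / 2 * P + Q)"
  proof (rule mult_left_mono)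
    have "0 \<le> \<beta> * \<kappa> * P" "0 \<le> \<beta> * Q" using \<beta> \<kappa> P_nonneg Q_nonneg by auto
    then have "\<kappa>\<^sup>2 * P + 2 * \<kappa> * Q + 2 * \<beta> * Q \<le> (\<kappa> / 2 * P + Q) * (2 * (\<kappa> + 2 * \<beta>))"
      by (simp add: algebra_simps power2_eq_square)
    then show "(\<kappa>\<^sup>2 * P + 2 * \<kappa> * Q + 2 * \<beta> * Q) / (2 * (\<kappa> + 2 * \<beta>)) \<le> \<kappa> / 2 * P + Q"
      using \<kappa> \<beta> by (intro pos_divide_le_eq[THEN iffD2]) auto
  qed (use d in auto)
  finally have sqrt_part: "alpha c / 2 * (1 / d) * (norm ?D)\<^sup>2 \<le> d * (\<kappa> / 2 * P + Q)" .
  have "\<kappa> / 2 * d * (norm J)\<^sup>2 \<le> \<kappa> / 2 * d * P"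
    using \<kappa> d by (intro mult_left_mono norm_J) auto
  then have "\<kappa> / 2 * d * (norm J)\<^sup>2 + alpha c / 2 * (1 / d) * (norm ?D)\<^sup>2
      \<le> \<kappa> / 2 * d * P + d * (\<kappa> / 2 * P + Q)"
    using sqrt_part by (rule add_mono)
  also have "\<dots> = d * (\<kappa> * P + Q)"
    by (simp add: algebra_simps)
  finally have "\<kappa> / 2 * d * (norm J)\<^sup>2 + alpha c / 2 * (1 / d) * (norm ?D)\<^sup>2 \<le> d * (\<kappa> * P + Q)" .
  then show ?thesis unfolding diss \<kappa>_def .
qed

end

section \<open>Solvability and positivity on a finite graph\<close>

lemma continuous_on_coordinate_fun: "continuous_on S (\<lambda>z :: 'i \<Rightarrow> 'a::topological_space. z k)"
  by (rule continuous_on_subset[OF continuous_on_product_coordinates]) auto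

text \<open>A continuous retraction of the nonnegative orthant onto the simplex: \<open>x\<close> is scaled down if its sum exceeds
  1, and the missing mass is distributed evenly.\<close>

definition to_simplex :: "real ^ 'n::finite \<Rightarrow> real ^ 'n" where
  "to_simplex x = (let s = max 1 (\<Sum>j\<in>UNIV. x $ j)
     in \<chi> i. x $ i / s + (1 - (\<Sum>j\<in>UNIV. x $ j) / s) / CARD('n))"

lemma to_simplex_in:
  fixes x :: "real ^ 'n::finite"
  assumes "\<And>i. 0 \<le> x $ i"
  shows "to_simplex x \<in> conc_simplex"
proof -
  define t where "t = (\<Sum>j\<in>UNIV. x $ j)"
  define s where "s = max 1 t"
  have s: "0 < s" "t \<le> s" by (auto simp: s_def)
  have comp: "to_simplex x $ i = x $ i / s + (1 - t / s) / CARD('n)" for i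
    by (simp add: to_simplex_def Let_def s_def t_def)
  have "(\<Sum>i\<in>UNIV. to_simplex x $ i) = t / s + (1 - t / s)"
    unfolding comp by (simp add: sum.distrib t_def flip: sum_divide_distrib)
  moreover have "0 \<le> to_simplex x $ i" for i
    unfolding comp using assms s by (intro add_nonneg_nonneg divide_nonneg_nonneg) auto
  ultimately show ?thesis by (simp add: conc_simplex_def)
qed

lemma to_simplex_id: "x \<in> conc_simplex \<Longrightarrow> to_simplex x = x"
  by (simp add: to_simplex_def conc_simplex_def vec_eq_iff)

lemma continuous_on_to_simplex:
  fixes f :: "'z::topological_space \<Rightarrow> real ^ 'n::finite"
  assumes "\<And>i. continuous_on S (\<lambda>z. f z $ i)"
  shows "continuous_on S (\<lambda>z. to_simplex (f z) $ i)"
proof -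
  have "continuous_on S (\<lambda>z. f z $ i / max 1 (\<Sum>j\<in>UNIV. f z $ j)
      + (1 - (\<Sum>j\<in>UNIV. f z $ j) / max 1 (\<Sum>j\<in>UNIV. f z $ j)) / CARD('n))"
    by (intro continuous_on_add continuous_on_divide continuous_on_diff continuous_on_max
        continuous_on_sum continuous_on_const assms) auto
  then show ?thesis by (simp add: to_simplex_def Let_def)
qed

context cross_diffusion
begin

text \<open>The time step on an abstract finite graph: \<open>E K\<close> is the set of edges at the vertex \<open>K\<close>, and \<open>nb K e\<close> is the
  vertex reached from \<open>K\<close> through \<open>e\<close>. No symmetry between the two ends of an edge is needed.\<close>

lemma discrete_problem_solvable:
  fixes V :: "'v set" and m :: "'v \<Rightarrow> real" and E :: "'v \<Rightarrow> 'e set" and nb :: "'v \<Rightarrow> 'e \<Rightarrow> 'v"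
    and wt d :: "'e \<Rightarrow> real" and old :: "'v \<Rightarrow> real ^ 'n" and dt :: real
  assumes V: "finite V" and m: "\<And>K. K \<in> V \<Longrightarrow> 0 < m K"
    and nb: "\<And>K e. K \<in> V \<Longrightarrow> e \<in> E K \<Longrightarrow> nb K e \<in> V"
    and wt: "\<And>K e. K \<in> V \<Longrightarrow> e \<in> E K \<Longrightarrow> 0 \<le> wt e" and d: "\<And>K e. K \<in> V \<Longrightarrow> e \<in> E K \<Longrightarrow> 0 < d e"
    and old: "\<And>K. K \<in> V \<Longrightarrow> old K \<in> conc_simplex" and dt: "0 < dt"
  shows "\<exists>u. \<forall>K\<in>V. u K \<in> conc_simplex \<and> (\<forall>i. m K * ((u K $ i - old K $ i) / dt)
        + (\<Sum>e\<in>E K. wt e * edge_flux (d e) (u K) (u (nb K e)) $ i) = 0)"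
proof -
  define C where "C = {z :: 'v \<times> 'n \<Rightarrow> real. \<forall>k. z k \<in> {0..1}}"
  define U where "U = (\<lambda>(z :: 'v \<times> 'n \<Rightarrow> real) K. to_simplex (\<chi> i. z (K, i)))"
  define G where "G = (\<lambda>u K i. u K $ i - old K $ i
      + dt / m K * (\<Sum>e\<in>E K. wt e * edge_flux (d e) (u K) (u (nb K e)) $ i))"
  define g where "g = (\<lambda>z K i. max 0 (- G (U z) K i))"
  \<comment> \<open>At a fixed point of \<open>\<phi>\<close> the positive parts of \<open>-G\<close> in a cell are proportional to the state in that cell.\<close>
  define \<phi> where "\<phi> = (\<lambda>z k. case k of (K, i) \<Rightarrow> (U z K $ i + g z K i) / (1 + (\<Sum>j\<in>UNIV. g z K j)))"
  have U: "U z K \<in> conc_simplex" if "z \<in> C" for z K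
    unfolding U_def using that by (intro to_simplex_in) (auto simp: C_def)
  have g: "0 \<le> g z K i" "0 < 1 + (\<Sum>j\<in>UNIV. g z K j)" for z K i
    by (auto simp: g_def intro!: add_pos_nonneg sum_nonneg)
  have contU: "continuous_on C (\<lambda>z. U z K $ i)" for K i
    unfolding U_def by (intro continuous_on_to_simplex) (simp add: continuous_on_coordinate_fun)
  have contg: "continuous_on C (\<lambda>z. g z K i)" for K i
    unfolding g_def G_def
    by (intro continuous_on_max continuous_on_const continuous_on_minus continuous_on_add continuous_on_diff
        continuous_on_mult continuous_on_sum contU continuous_on_edge_flux)
      (use U in \<open>auto simp: conc_simplex_def\<close>)
  obtain z where z: "\<And>k. z k \<in> {0..1}" "\<And>k. k \<in> V \<times> UNIV \<Longrightarrow> \<phi> z k = z k"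
  proof (rule brouwer_unit_cube_fun[of "V \<times> UNIV" \<phi>])
    show "finite (V \<times> (UNIV::'n set))" using V by simp
  next
    fix k :: "'v \<times> 'n"
    obtain K i where k: "k = (K, i)" by force
    have "continuous_on C (\<lambda>z. (U z K $ i + g z K i) / (1 + (\<Sum>j\<in>UNIV. g z K j)))"
      by (intro continuous_on_divide continuous_on_add continuous_on_sum continuous_on_const contU contg)
        (metis g(2) less_irrefl)
    then show "continuous_on {x. \<forall>i. x i \<in> {0..1}} (\<lambda>z. \<phi> z k)"
      by (simp add: \<phi>_def k C_def)
  next
    fix z :: "'v \<times> 'n \<Rightarrow> real" and k :: "'v \<times> 'n" assume "\<And>k. z k \<in> {0..1}"
    then have zC: "z \<in> C" by (simp add: C_def)
    obtain K i where k: "k = (K, i :: 'n)" by force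
    have "g z K i \<le> (\<Sum>j\<in>UNIV. g z K j)" by (rule member_le_sum) (auto simp: g)
    moreover have "U z K $ i \<le> (\<Sum>j\<in>UNIV. U z K $ j)"
      using U[OF zC, of K] by (intro member_le_sum) (auto simp: conc_simplex_def)
    then have "0 \<le> U z K $ i" "U z K $ i \<le> 1" using U[OF zC, of K] by (auto simp: conc_simplex_def)
    ultimately show "\<phi> z k \<in> {0..1}"
      using g(2)[of z K] g(1)[of z K i] by (auto simp: \<phi>_def k)
  qed blast
  have zC: "z \<in> C" using z(1) by (simp add: C_def)
  have fixpt: "(U z K $ i + g z K i) / (1 + (\<Sum>j\<in>UNIV. g z K j)) = z (K, i)" if "K \<in> V" for K i
    using z(2)[of "(K, i)"] that by (simp add: \<phi>_def)
  have Uz: "U z K $ i = z (K, i)" if K: "K \<in> V" for K i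
  proof -
    have "(\<Sum>i\<in>UNIV. z (K, i)) = (\<Sum>i\<in>UNIV. (U z K $ i + g z K i) / (1 + (\<Sum>j\<in>UNIV. g z K j)))"
      by (simp only: fixpt[OF K])
    also have "\<dots> = 1"
      using U[OF zC, of K] g(2)[of z K] by (simp add: conc_simplex_def sum.distrib flip: sum_divide_distrib)
    finally have "(\<chi> i. z (K, i)) \<in> conc_simplex" using z(1) by (simp add: conc_simplex_def)
    then show ?thesis by (simp add: U_def to_simplex_id)
  qed
  have G0: "G (U z) K i = 0" if K: "K \<in> V" for K i
  proof -
    have UK: "0 \<le> U z L $ j" "(\<Sum>j\<in>UNIV. U z L $ j) = 1" for L j
      using U[OF zC, of L] by (auto simp: conc_simplex_def)
    have oldK: "0 \<le> old K $ j" "(\<Sum>j\<in>UNIV. old K $ j) = 1" for j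
      using old[OF K] by (auto simp: conc_simplex_def)
    have sum_G: "(\<Sum>j\<in>UNIV. G (U z) K j) = 0"
    proof -
      have "(\<Sum>j\<in>UNIV. \<Sum>e\<in>E K. wt e * edge_flux (d e) (U z K) (U z (nb K e)) $ j)
          = (\<Sum>e\<in>E K. wt e * (\<Sum>j\<in>UNIV. edge_flux (d e) (U z K) (U z (nb K e)) $ j))"
        by (subst sum.swap) (simp add: sum_distrib_left)
      also have "\<dots> = 0" by (simp add: sum_edge_flux UK)
      finally show ?thesis
        unfolding G_def sum.distrib sum_subtractf sum_distrib_left[symmetric] by (simp add: UK oldK)
    qed
    define S where "S = (\<Sum>j\<in>UNIV. g z K j)"
    have S_nonneg: "0 \<le> S" unfolding S_def by (intro sum_nonneg g)
    have gS: "g z K j = U z K $ j * S" for j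
    proof -
      have "U z K $ j + g z K j = U z K $ j * (1 + S)"
        using fixpt[OF K, of j] Uz[OF K, of j] g(2)[of z K] by (simp add: S_def field_simps)
      then show ?thesis by (simp add: algebra_simps)
    qed
    have zero: "G (U z) K j \<le> 0" if "U z K $ j = 0" for j
    proof -
      have "(\<Sum>e\<in>E K. wt e * edge_flux (d e) (U z K) (U z (nb K e)) $ j) \<le> 0"
        using that K by (intro sum_nonpos mult_nonneg_nonpos wt[OF K] edge_flux_at_zero(1) d[OF K] UK) auto
      then have "dt / m K * (\<Sum>e\<in>E K. wt e * edge_flux (d e) (U z K) (U z (nb K e)) $ j) \<le> 0"
        using m[OF K] dt by (intro mult_nonneg_nonpos) auto
      then show ?thesis
        unfolding G_def using that oldK(1)[of j] by linarith
    qed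
    \<comment> \<open>Otherwise \<open>G < 0\<close> for all species present in \<open>K\<close> and \<open>G \<le> 0\<close> for the others, although the sum is 0.\<close>
    have "S = 0"
    proof (rule ccontr)
      assume "S \<noteq> 0"
      then have S: "0 < S" using S_nonneg by simp
      have neg: "G (U z) K j < 0" if "0 < U z K $ j" for j
        using gS[of j] mult_pos_pos[OF that S] by (simp add: g_def max_def split: if_splits)
      have "\<exists>j. 0 < U z K $ j"
        using UK(2)[of K] UK(1)[of K] by (metis less_eq_real_def sum.neutral zero_neq_one)
      then obtain j0 where "0 < U z K $ j0" by blast
      then have "(\<Sum>j\<in>UNIV. G (U z) K j) < (\<Sum>j\<in>(UNIV::'n set). 0)"
        using neg zero UK(1)[of K] by (intro sum_strict_mono_ex1) (auto simp: less_eq_real_def)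
      then show False using sum_G by simp
    qed
    then have "0 \<le> G (U z) K j" for j
      using gS[of j] by (simp add: g_def max_def split: if_splits)
    then show ?thesis using sum_G by (simp add: sum_nonneg_eq_0_iff)
  qed
  show ?thesis
  proof (intro exI[of _ "U z"] ballI conjI allI)
    show "U z K \<in> conc_simplex" for K by (rule U[OF zC])
    fix K i assume K: "K \<in> V"
    have "m K / dt * G (U z) K i = 0" using G0[OF K] by simp
    then show "m K * ((U z K $ i - old K $ i) / dt)
        + (\<Sum>e\<in>E K. wt e * edge_flux (d e) (U z K) (U z (nb K e)) $ i) = 0"
      using m[OF K] dt by (simp add: G_def distrib_left)
  qed
qed

text \<open>The set of vertices where species \<open>i\<close> is absent is closed under passing to neighbours. Connectedness of
  the graph is expressed by the assumption that such a set is empty or everything.\<close>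

lemma discrete_solution_pos:
  fixes V :: "'v set" and m :: "'v \<Rightarrow> real" and E :: "'v \<Rightarrow> 'e set" and nb :: "'v \<Rightarrow> 'e \<Rightarrow> 'v"
    and wt d :: "'e \<Rightarrow> real" and u old :: "'v \<Rightarrow> real ^ 'n" and dt :: real
  assumes m: "\<And>K. K \<in> V \<Longrightarrow> 0 < m K"
    and fin: "\<And>K. K \<in> V \<Longrightarrow> finite (E K)"
    and nb: "\<And>K e. K \<in> V \<Longrightarrow> e \<in> E K \<Longrightarrow> nb K e \<in> V"
    and wt: "\<And>K e. K \<in> V \<Longrightarrow> e \<in> E K \<Longrightarrow> 0 < wt e" and d: "\<And>K e. K \<in> V \<Longrightarrow> e \<in> E K \<Longrightarrow> 0 < d e"
    and old: "\<And>K. K \<in> V \<Longrightarrow> old K \<in> conc_simplex" and dt: "0 < dt"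
    and u: "\<And>K. K \<in> V \<Longrightarrow> u K \<in> conc_simplex"
    and eq: "\<And>K i. K \<in> V \<Longrightarrow> m K * ((u K $ i - old K $ i) / dt)
        + (\<Sum>e\<in>E K. wt e * edge_flux (d e) (u K) (u (nb K e)) $ i) = 0"
    and connected: "\<And>W. W \<subseteq> V \<Longrightarrow> W \<noteq> {} \<Longrightarrow> (\<And>K e. K \<in> W \<Longrightarrow> e \<in> E K \<Longrightarrow> nb K e \<in> W) \<Longrightarrow> W = V"
    and mass: "\<And>i. 0 < (\<Sum>K\<in>V. m K * u K $ i)"
    and K: "K \<in> V"
  shows "0 < u K $ i"
proof (rule ccontr)
  assume "\<not> 0 < u K $ i"
  define W where "W = {K \<in> V. u K $ i = 0}"
  have nonneg: "0 \<le> u L $ i" "0 \<le> old L $ i" if "L \<in> V" for L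
    using u[OF that] old[OF that] by (auto simp: conc_simplex_def)
  have "K \<in> W" using \<open>\<not> 0 < u K $ i\<close> K nonneg(1)[OF K] by (simp add: W_def)
  have "W = V"
  proof (rule connected)
    show "W \<subseteq> V" "W \<noteq> {}" using \<open>K \<in> W\<close> by (auto simp: W_def)
    fix L e assume "L \<in> W" and e: "e \<in> E L"
    then have L: "L \<in> V" "u L $ i = 0" by (auto simp: W_def)
    let ?f = "\<lambda>e. wt e * edge_flux (d e) (u L) (u (nb L e)) $ i"
    have f: "?f e' \<le> 0" if "e' \<in> E L" for e'
      using that L wt[OF L(1) that]
      by (intro mult_nonneg_nonpos edge_flux_at_zero(1) d[OF L(1)] nonneg nb) auto
    have "m L * ((u L $ i - old L $ i) / dt) \<le> 0"
      using L m[OF L(1)] dt nonneg(2)[OF L(1)] by (simp add: mult_nonneg_nonpos)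
    then have "0 \<le> (\<Sum>e\<in>E L. ?f e)" using eq[OF L(1), of i] by linarith
    then have "(\<Sum>e\<in>E L. - ?f e) \<le> 0" by (simp add: sum_negf)
    then have "(\<Sum>e\<in>E L. - ?f e) = 0"
      using f by (intro antisym sum_nonneg) auto
    then have "?f e = 0"
      using f e fin[OF L(1)] sum_nonneg_eq_0_iff[of "E L" "\<lambda>e. - ?f e"] by auto
    then have "edge_flux (d e) (u L) (u (nb L e)) $ i = 0" using wt[OF L(1) e] by simp
    then have "\<not> 0 < u (nb L e) $ i"
      using edge_flux_at_zero(2)[of "u L" i "d e" "u (nb L e)"] L d[OF L(1) e] by auto
    then show "nb L e \<in> W" using nb[OF L(1) e] nonneg(1) by (force simp: W_def)
  qed
  then have "(\<Sum>K\<in>V. m K * u K $ i) = 0" by (intro sum.neutral) (auto simp: W_def)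
  then show False using mass[of i] by simp
qed

end

section \<open>Null sets of Hausdorff measure of codimension one\<close>

text \<open>For null sets, the Hausdorff measure is handled through countable covers of arbitrarily small mesh and
  weight.\<close>

lemma hausdorff_nullI:
  assumes "\<And>\<delta> e. 0 < \<delta> \<Longrightarrow> 0 < e \<Longrightarrow> \<exists>U :: nat \<Rightarrow> 'a set. A \<subseteq> (\<Union>k. U k)
      \<and> (\<forall>k. bounded (U k) \<and> diameter (U k) \<le> \<delta>) \<and> (\<Sum>k. hausdorff_weight m (U k)) \<le> ennreal e"
  shows "hausdorff_measure m (A :: 'a::metric_space set) = 0"
proof -
  have "hausdorff_pre_measure m \<delta> A \<le> 0" if "0 < \<delta>" for \<delta>
  proof (rule ennreal_le_epsilon)
    fix e :: real assume "0 < e"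
    with assms[OF that] obtain U :: "nat \<Rightarrow> 'a set" where U: "A \<subseteq> (\<Union>k. U k)"
      "\<forall>k. bounded (U k) \<and> diameter (U k) \<le> \<delta>" "(\<Sum>k. hausdorff_weight m (U k)) \<le> ennreal e"
      by blast
    have "hausdorff_pre_measure m \<delta> A \<le> (\<Sum>k. hausdorff_weight m (U k))"
      unfolding hausdorff_pre_measure_def using U by (intro INF_lower) auto
    then show "hausdorff_pre_measure m \<delta> A \<le> 0 + ennreal e" using U(3) by simp
  qed
  then show ?thesis
    unfolding hausdorff_measure_def by (metis SUP_least greaterThan_iff le_zero_eq)
qed

lemma hausdorff_nullD:
  fixes A :: "'a::metric_space set"
  assumes "hausdorff_measure m A = 0" "0 < \<delta>" "0 < e"
  shows "\<exists>U :: nat \<Rightarrow> 'a set. A \<subseteq> (\<Union>k. U k)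
      \<and> (\<forall>k. bounded (U k) \<and> diameter (U k) \<le> \<delta>) \<and> (\<Sum>k. hausdorff_weight m (U k)) \<le> ennreal e"
proof -
  have "hausdorff_pre_measure m \<delta> A \<le> hausdorff_measure m A"
    unfolding hausdorff_measure_def using assms(2) by (intro SUP_upper) auto
  then have "hausdorff_pre_measure m \<delta> A < ennreal e" using assms by (simp add: le_zero_eq)
  then obtain U where U: "U \<in> {U :: nat \<Rightarrow> 'a set. A \<subseteq> (\<Union>k. U k) \<and> (\<forall>k. bounded (U k) \<and> diameter (U k) \<le> \<delta>)}"
    "(\<Sum>k. hausdorff_weight m (U k)) < ennreal e"
    unfolding hausdorff_pre_measure_def INF_less_iff by blast
  show ?thesis
    using U(1) less_imp_le[OF U(2)] by blast
qed

lemma hausdorff_null_subset: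
  assumes "hausdorff_measure m B = 0" "A \<subseteq> B"
  shows "hausdorff_measure m A = 0"
proof (rule hausdorff_nullI)
  fix \<delta> e :: real assume "0 < \<delta>" "0 < e"
  from hausdorff_nullD[OF assms(1) this] show "\<exists>U :: nat \<Rightarrow> 'a set. A \<subseteq> (\<Union>k. U k)
      \<and> (\<forall>k. bounded (U k) \<and> diameter (U k) \<le> \<delta>) \<and> (\<Sum>k. hausdorff_weight m (U k)) \<le> ennreal e"
    using assms(2) by (meson order_trans)
qed

lemma hausdorff_null_empty: "hausdorff_measure m {} = 0"
proof (rule hausdorff_nullI)
  fix \<delta> e :: real assume "0 < \<delta>" "0 < e"
  then show "\<exists>U :: nat \<Rightarrow> 'a set. {} \<subseteq> (\<Union>k. U k)
      \<and> (\<forall>k. bounded (U k) \<and> diameter (U k) \<le> \<delta>) \<and> (\<Sum>k. hausdorff_weight m (U k)) \<le> ennreal e"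
    by (intro exI[of _ "\<lambda>_. {}"]) (simp add: hausdorff_weight_def)
qed

lemma hausdorff_null_Un:
  fixes A B :: "'a::metric_space set"
  assumes "hausdorff_measure m A = 0" "hausdorff_measure m B = 0"
  shows "hausdorff_measure m (A \<union> B) = 0"
proof (rule hausdorff_nullI)
  fix \<delta> e :: real assume *: "0 < \<delta>" "0 < e"
  then have e2: "0 < e / 2" by simp
  let ?w = "\<lambda>U. hausdorff_weight m (U :: 'a set)"
  obtain U where U: "A \<subseteq> (\<Union>k. U k)" "\<And>k. bounded (U k)" "\<And>k. diameter (U k) \<le> \<delta>"
    "(\<Sum>k. ?w (U k)) \<le> ennreal (e / 2)"
    using hausdorff_nullD[OF assms(1) *(1) e2] by blast
  obtain V where V: "B \<subseteq> (\<Union>k. V k)" "\<And>k. bounded (V k)" "\<And>k. diameter (V k) \<le> \<delta>"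
    "(\<Sum>k. ?w (V k)) \<le> ennreal (e / 2)"
    using hausdorff_nullD[OF assms(2) *(1) e2] by blast
  \<comment> \<open>The two covers are interleaved.\<close>
  define W where "W = (\<lambda>k. if even k then U (k div 2) else V (k div 2))"
  have W: "W (2 * k) = U k" "W (2 * k + 1) = V k" for k by (auto simp: W_def)
  have "U k \<subseteq> (\<Union>k. W k)" "V k \<subseteq> (\<Union>k. W k)" for k
    unfolding W(1,2)[of k, symmetric] by auto
  then have "(\<Union>k. U k) \<subseteq> (\<Union>k. W k)" "(\<Union>k. V k) \<subseteq> (\<Union>k. W k)"
    by (simp_all add: UN_subset_iff)
  then have "A \<union> B \<subseteq> (\<Union>k. W k)"
    by (intro Un_least order_trans[OF U(1)] order_trans[OF V(1)])
  moreover have "\<forall>k. bounded (W k) \<and> diameter (W k) \<le> \<delta>"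
    using U V by (simp add: W_def)
  moreover have "(\<Sum>k. ?w (W k)) \<le> ennreal e"
    unfolding suminf_eq_SUP
  proof (rule SUP_least)
    fix n
    have "(\<Sum>k<2 * n. ?w (W k)) = (\<Sum>k<n. ?w (U k)) + (\<Sum>k<n. ?w (V k))"
    proof (induction n)
      case (Suc n)
      have "(\<Sum>k<2 * Suc n. ?w (W k)) = (\<Sum>k<2 * n. ?w (W k)) + ?w (W (2 * n)) + ?w (W (2 * n + 1))"
        by simp
      then show ?case unfolding Suc.IH W by (simp add: ac_simps)
    qed simp
    also have "\<dots> \<le> (\<Sum>k. ?w (U k)) + (\<Sum>k. ?w (V k))"
      by (intro add_mono sum_le_suminf) auto
    also have "\<dots> \<le> ennreal (e / 2) + ennreal (e / 2)" by (intro add_mono U V)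
    also have "\<dots> = ennreal e" using * by (simp flip: ennreal_plus)
    finally have "(\<Sum>k<2 * n. ?w (W k)) \<le> ennreal e" .
    moreover have "(\<Sum>k<n. ?w (W k)) \<le> (\<Sum>k<2 * n. ?w (W k))"
      by (intro sum_mono2) auto
    ultimately show "(\<Sum>k<n. ?w (W k)) \<le> ennreal e" by (rule order_trans[rotated])
  qed
  ultimately show "\<exists>W. A \<union> B \<subseteq> (\<Union>k. W k) \<and> (\<forall>k. bounded (W k) \<and> diameter (W k) \<le> \<delta>)
      \<and> (\<Sum>k. ?w (W k)) \<le> ennreal e" by blast
qed

lemma hausdorff_null_UN:
  assumes "finite I" "\<And>i. i \<in> I \<Longrightarrow> hausdorff_measure m (f i) = 0"
  shows "hausdorff_measure m (\<Union>i\<in>I. f i) = 0"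
  using assms by (induction I) (auto simp: hausdorff_null_empty hausdorff_null_Un)

text \<open>A ball in a \<open>k\<close>-dimensional subspace is covered by \<open>O(e\<^sup>-\<^sup>k)\<close> balls of radius \<open>k e\<close>. Each vector of the
  orthonormal basis adds \<open>O(1/e)\<close> translates and increases the radius by \<open>e\<close>.\<close>

lemma span_ball_cover:
  fixes B :: "'a::real_inner set"
  assumes "finite B" "pairwise orthogonal B" "\<And>x. x \<in> B \<Longrightarrow> norm x = 1" "0 \<le> R"
  shows "\<exists>C\<ge>0. \<forall>e. 0 < e \<longrightarrow> e \<le> 1 \<longrightarrow> (\<exists>P. finite P \<and> real (card P) * e ^ card B \<le> C
     \<and> {x \<in> span B. norm x \<le> R} \<subseteq> (\<Union>p\<in>P. cball p (real (card B) * e)))"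
  using assms(1-3)
proof (induction B)
  case empty
  have "finite {0::'a} \<and> real (card {0::'a}) * e ^ card ({}::'a set) \<le> 1
      \<and> {x \<in> span ({}::'a set). norm x \<le> R} \<subseteq> (\<Union>p\<in>{0}. cball p (real (card ({}::'a set)) * e))" for e :: real
    by auto
  then show ?case
    by (intro exI[of _ "1::real"] conjI[OF zero_le_one] allI impI exI[of _ "{0::'a}"])
next
  case (insert v B)
  have orth: "pairwise orthogonal B" and norm_B: "\<And>x. x \<in> B \<Longrightarrow> norm x = 1"
    using insert.prems by (auto simp: pairwise_insert)
  then obtain C where C: "0 \<le> C" "\<And>e. 0 < e \<Longrightarrow> e \<le> 1 \<Longrightarrow> \<exists>P. finite P \<and> real (card P) * e ^ card B \<le> C
     \<and> {x \<in> span B. norm x \<le> R} \<subseteq> (\<Union>p\<in>P. cball p (real (card B) * e))"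
    using insert.IH by blast
  have "orthogonal v y" if "y \<in> B" for y
    using insert.prems(1) insert.hyps(2) that by (auto simp: pairwise_insert)
  then have v: "norm v = 1" "\<And>y. y \<in> span B \<Longrightarrow> orthogonal v y"
    using insert.prems(2) by (simp_all add: orthogonal_to_span)
  show ?case
  proof (intro exI[of _ "C * (2 * R + 5)"] conjI allI impI)
    show "0 \<le> C * (2 * R + 5)" using C(1) assms(4) by simp
    fix e :: real assume e: "0 < e" "e \<le> 1"
    then obtain P where P: "finite P" "real (card P) * e ^ card B \<le> C"
      "{x \<in> span B. norm x \<le> R} \<subseteq> (\<Union>p\<in>P. cball p (real (card B) * e))" using C(2) by blast
    define N where "N = \<lceil>R / e\<rceil> + 1"
    have N: "R / e + 1 \<le> real_of_int N" "real_of_int N \<le> R / e + 2"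
      by (auto simp: N_def) linarith
    have N0: "0 \<le> N" unfolding N_def using e assms(4)
      by (metis add_nonneg_nonneg ceiling_mono ceiling_zero divide_nonneg_pos zero_le_one)
    define P' where "P' = (\<lambda>(p, j). p + (real_of_int j * e) *\<^sub>R v) ` (P \<times> {-N..N})"
    have fin: "finite P'" using P(1) by (simp add: P'_def)
    have "card P' \<le> card (P \<times> {-N..N})" unfolding P'_def by (rule card_image_le) (use P(1) in simp)
    also have "\<dots> = card P * nat (2 * N + 1)" by (simp add: card_cartesian_product)
    finally have "real (card P') \<le> real (card P * nat (2 * N + 1))" by (rule of_nat_mono)
    also have "\<dots> = real (card P) * (2 * N + 1)" using N0 by simp
    finally have "real (card P') \<le> real (card P) * (2 * N + 1)" .
    then have "real (card P') * e ^ card (insert v B) \<le> real (card P) * (2 * N + 1) * (e * e ^ card B)"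
      using e insert(1,2) by (simp add: mult_right_mono)
    also have "\<dots> = (real (card P) * e ^ card B) * ((2 * N + 1) * e)" by simp
    also have "\<dots> \<le> C * (2 * R + 5)"
    proof (rule mult_mono)
      have "(2 * real_of_int N + 1) * e \<le> (2 * (R / e + 2) + 1) * e" using N e by (intro mult_right_mono) auto
      also have "\<dots> = 2 * R + 5 * e" using e by (simp add: field_simps)
      finally show "real_of_int (2 * N + 1) * e \<le> 2 * R + 5" using e by simp
      show "0 \<le> real_of_int (2 * N + 1) * e" using N0 e by simp
    qed (use P C in auto)
    finally have card: "real (card P') * e ^ card (insert v B) \<le> C * (2 * R + 5)" .
    have "{x \<in> span (insert v B). norm x \<le> R} \<subseteq> (\<Union>p\<in>P'. cball p (real (card (insert v B)) * e))"
    proof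
      fix x assume "x \<in> {x \<in> span (insert v B). norm x \<le> R}"
      then obtain t where x: "x - t *\<^sub>R v \<in> span B" "norm x \<le> R"
        using span_breakdown_eq[of x v B] by blast
      define y where "y = x - t *\<^sub>R v"
      have y: "y \<in> span B" "x = t *\<^sub>R v + y" using x by (auto simp: y_def)
      have "(norm x)\<^sup>2 = (norm (t *\<^sub>R v))\<^sup>2 + (norm y)\<^sup>2"
        unfolding y(2) using v(2)[OF y(1)] by (intro norm_add_Pythagorean) (simp add: orthogonal_def)
      then have "(norm y)\<^sup>2 \<le> (norm x)\<^sup>2" "\<bar>t\<bar>\<^sup>2 \<le> (norm x)\<^sup>2" using v(1) by auto
      then have "norm y \<le> norm x" "\<bar>t\<bar> \<le> norm x" by (auto intro: power2_le_imp_le)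
      then have yt: "norm y \<le> R" "\<bar>t\<bar> \<le> R" using x(2) by auto
      then obtain p where p: "p \<in> P" "dist p y \<le> real (card B) * e" using P(3) y(1) by auto
      define j where "j = \<lfloor>t / e\<rfloor>"
      have "\<bar>t / e\<bar> \<le> R / e" using yt e by (simp add: divide_right_mono)
      then have "\<bar>real_of_int j\<bar> \<le> R / e + 1" unfolding j_def by linarith
      then have "\<bar>real_of_int j\<bar> \<le> real_of_int N" using N by linarith
      then have j: "j \<in> {-N..N}" by auto
      have "\<bar>real_of_int j - t / e\<bar> \<le> 1" unfolding j_def by linarith
      then have "\<bar>real_of_int j - t / e\<bar> * e \<le> 1 * e" using e by (intro mult_right_mono) auto
      also have "\<bar>real_of_int j - t / e\<bar> * e = \<bar>(real_of_int j - t / e) * e\<bar>" using e by (simp add: abs_mult)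
      also have "(real_of_int j - t / e) * e = real_of_int j * e - t" using e by (simp add: left_diff_distrib)
      finally have je: "\<bar>real_of_int j * e - t\<bar> \<le> e" by simp
      have "dist (p + (real_of_int j * e) *\<^sub>R v) x = norm ((p - y) + (real_of_int j * e - t) *\<^sub>R v)"
        by (simp add: dist_norm y(2) algebra_simps)
      also have "\<dots> \<le> dist p y + \<bar>real_of_int j * e - t\<bar>"
        using norm_triangle_ineq[of "p - y" "(real_of_int j * e - t) *\<^sub>R v"] v(1) by (simp add: dist_norm)
      also have "\<dots> \<le> real (card (insert v B)) * e"
        using p(2) je insert(1,2) by (simp add: distrib_right)
      finally have "x \<in> cball (p + (real_of_int j * e) *\<^sub>R v) (real (card (insert v B)) * e)" by simp
      moreover have "p + (real_of_int j * e) *\<^sub>R v \<in> P'" unfolding P'_def using p(1) j by force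
      ultimately show "x \<in> (\<Union>p\<in>P'. cball p (real (card (insert v B)) * e))" by blast
    qed
    then show "\<exists>P. finite P \<and> real (card P) * e ^ card (insert v B) \<le> C * (2 * R + 5)
        \<and> {x \<in> span (insert v B). norm x \<le> R} \<subseteq> (\<Union>p\<in>P. cball p (real (card (insert v B)) * e))"
      using fin card by blast
  qed
qed

lemma hausdorff_null_low_dim:
  fixes S :: "'a::euclidean_space set"
  assumes "bounded S" "aff_dim S < int m"
  shows "hausdorff_measure m S = 0"
proof (cases "S = {}")
  case True
  then show ?thesis by (simp add: hausdorff_null_empty)
next
  case False
  then obtain a where a: "a \<in> S" by blast
  define S' where "S' = (\<lambda>x. x - a) ` S"
  obtain B where B: "pairwise orthogonal B" "\<And>x. x \<in> B \<Longrightarrow> norm x = 1" "independent B"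
    "card B = dim (span S')" "span B = span S'"
    using orthonormal_basis_subspace[OF subspace_span[of S']] by metis
  define k where "k = card B"
  have "finite B" using B(3) by (rule finiteI_independent)
  have "aff_dim S = int (dim S')"
    unfolding S'_def using a by (intro aff_dim_eq_dim_subtract) (simp add: hull_inc)
  then have km: "k < m" using assms(2) B(4) by (simp add: k_def)
  have "bounded S'" unfolding S'_def using assms(1) by (rule bounded_translation_minus)
  then obtain R where R: "0 \<le> R" "\<And>x. x \<in> S' \<Longrightarrow> norm x \<le> R"
    unfolding bounded_pos by (meson less_imp_le)
  obtain C where C: "0 \<le> C" "\<And>e. 0 < e \<Longrightarrow> e \<le> 1 \<Longrightarrow> \<exists>P. finite P \<and> real (card P) * e ^ k \<le> C
     \<and> {x \<in> span B. norm x \<le> R} \<subseteq> (\<Union>p\<in>P. cball p (real k * e))"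
    using span_ball_cover[OF \<open>finite B\<close> B(1,2) R(1)] unfolding k_def by blast
  define D where "D = C * unit_ball_vol (real m) * real k ^ m"
  have D: "0 \<le> D" unfolding D_def using C(1) by simp
  show ?thesis
  proof (rule hausdorff_nullI)
    fix \<delta> \<eta> :: real assume \<delta>: "0 < \<delta>" and \<eta>: "0 < \<eta>"
    define e where "e = Min {1, \<delta> / (2 * real k + 1), \<eta> / (D + 1)}"
    have e: "0 < e" "e \<le> 1" "e \<le> \<delta> / (2 * real k + 1)" "e \<le> \<eta> / (D + 1)"
      using \<delta> \<eta> D by (auto simp: e_def)
    obtain P where P: "finite P" "real (card P) * e ^ k \<le> C"
      "{x \<in> span B. norm x \<le> R} \<subseteq> (\<Union>p\<in>P. cball p (real k * e))" using C(2)[OF e(1,2)] by blast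
    obtain h where h: "bij_betw h {0..<card P} P" using ex_bij_betw_nat_finite[OF P(1)] by blast
    define U where "U = (\<lambda>i. if i < card P then cball (a + h i) (real k * e) else {})"
    have ke: "0 \<le> real k * e" using e by simp
    have "S \<subseteq> (\<Union>i. U i)"
    proof
      fix x assume x: "x \<in> S"
      then have "x - a \<in> S'" by (simp add: S'_def)
      then have "x - a \<in> span B" "norm (x - a) \<le> R" using B(5) R(2) by (auto simp: span_base)
      then obtain p where p: "p \<in> P" "dist p (x - a) \<le> real k * e" using P(3) by auto
      then obtain i where i: "i < card P" "p = h i" using h unfolding bij_betw_def by force
      have "dist (a + h i) x = dist p (x - a)" by (simp add: dist_norm i algebra_simps)
      then have "x \<in> U i" using p i by (simp add: U_def)
      then show "x \<in> (\<Union>i. U i)" by blast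
    qed
    moreover have "bounded (U i) \<and> diameter (U i) \<le> \<delta>" for i
    proof -
      have "2 * (real k * e) \<le> (2 * real k + 1) * e" using e by (simp add: distrib_right)
      also have "\<dots> \<le> \<delta>" using e(3) by (simp add: pos_le_divide_eq add_nonneg_pos mult.commute)
      finally show ?thesis using e \<delta> by (simp add: U_def)
    qed
    moreover have "(\<Sum>i. hausdorff_weight m (U i)) \<le> ennreal \<eta>"
    proof -
      have "(\<Sum>i. hausdorff_weight m (U i)) = (\<Sum>i<card P. hausdorff_weight m (U i))"
        by (rule suminf_finite) (auto simp: U_def hausdorff_weight_def)
      also have "\<dots> = (\<Sum>i<card P. ennreal (unit_ball_vol (real m) * (real k * e) ^ m))"
        using ke by (intro sum.cong) (auto simp: U_def hausdorff_weight_def)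
      also have "\<dots> = ennreal (real (card P) * (unit_ball_vol (real m) * (real k * e) ^ m))"
        using e by (simp add: ennreal_mult ennreal_of_nat_eq_real_of_nat)
      also have "\<dots> \<le> ennreal \<eta>"
      proof (rule ennreal_leI)
        have "e ^ m = e ^ k * e ^ (m - k)" using km by (simp flip: power_add)
        moreover have "e ^ (m - k) \<le> e ^ 1" using e km by (intro power_decreasing) auto
        ultimately have em: "e ^ m \<le> e ^ k * e" using e by simp
        have "real (card P) * (unit_ball_vol (real m) * (real k * e) ^ m)
            = real (card P) * (unit_ball_vol (real m) * real k ^ m) * e ^ m"
          by (simp add: power_mult_distrib)
        also have "\<dots> \<le> real (card P) * (unit_ball_vol (real m) * real k ^ m) * (e ^ k * e)"
          using em by (intro mult_left_mono) auto
        also have "\<dots> = (real (card P) * e ^ k) * (unit_ball_vol (real m) * real k ^ m * e)" by simp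
        also have "\<dots> \<le> C * (unit_ball_vol (real m) * real k ^ m * e)"
          using P(2) e by (intro mult_right_mono) auto
        also have "\<dots> = D * e" by (simp add: D_def)
        also have "\<dots> \<le> (D + 1) * e" using e by simp
        also have "\<dots> \<le> \<eta>" using e(4) D by (simp add: pos_le_divide_eq add_nonneg_pos mult.commute)
        finally show "real (card P) * (unit_ball_vol (real m) * (real k * e) ^ m) \<le> \<eta>" .
      qed
      finally show ?thesis .
    qed
    ultimately show "\<exists>U. S \<subseteq> (\<Union>i. U i) \<and> (\<forall>i. bounded (U i) \<and> diameter (U i) \<le> \<delta>)
        \<and> (\<Sum>i. hausdorff_weight m (U i)) \<le> ennreal \<eta>" by blast
  qed
qed

text \<open>The cylinder swept out by \<open>A\<close> when it is translated along \<open>v\<close>.\<close>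

definition sweep :: "'a::real_vector \<Rightarrow> 'a set \<Rightarrow> 'a set" where
  "sweep v A = {x + t *\<^sub>R v | x t. x \<in> A \<and> t \<in> {0..1}}"

text \<open>The cylinder over a set of diameter \<open>r\<close> is covered by at most \<open>2/r\<close> balls of radius proportional to \<open>r\<close>, so
  its volume is at most of the order of \<open>r\<^sup>d\<^sup>-\<^sup>1\<close>, the weight of the set.\<close>

lemma sweep_cover:
  fixes U :: "'a::euclidean_space set" and v :: 'a
  assumes U: "bounded U" "diameter U \<le> r" and r: "0 < r" "r \<le> 1"
  defines "K \<equiv> 2 * unit_ball_vol (DIM('a)) * (1 + norm v) ^ DIM('a)"
  shows "\<exists>W. W \<in> sets borel \<and> sweep v U \<subseteq> W \<and> emeasure lborel W \<le> ennreal (K * r ^ (DIM('a) - 1))"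
proof (cases "U = {}")
  case True
  then show ?thesis by (intro exI[of _ "{}"]) (simp add: sweep_def)
next
  case False
  then obtain x0 where x0: "x0 \<in> U" by blast
  define q where "q = nat \<lfloor>1 / r\<rfloor>"
  define s where "s = r * (1 + norm v)"
  have s: "0 \<le> s" using r by (simp add: s_def)
  define b where "b = (\<lambda>j::nat. cball (x0 + (real j * r) *\<^sub>R v) s)"
  define W where "W = (\<Union>j\<in>{..q}. b j)"
  have "sweep v U \<subseteq> W"
  proof
    fix z assume "z \<in> sweep v U"
    then obtain x t where z: "z = x + t *\<^sub>R v" "x \<in> U" "0 \<le> t" "t \<le> 1" by (auto simp: sweep_def)
    define j where "j = nat \<lfloor>t / r\<rfloor>"
    have tr: "0 \<le> t / r" "t / r \<le> 1 / r" using z r by (auto simp: divide_right_mono)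
    then have j: "j \<le> q" unfolding j_def q_def by (intro nat_mono floor_mono)
    have "real j = of_int \<lfloor>t / r\<rfloor>" using tr by (simp add: j_def)
    then have "\<bar>t / r - real j\<bar> \<le> 1" by linarith
    then have "\<bar>t / r - real j\<bar> * r \<le> 1 * r" using r by (intro mult_right_mono) auto
    also have "\<bar>t / r - real j\<bar> * r = \<bar>(t / r - real j) * r\<bar>" using r by (simp add: abs_mult)
    also have "(t / r - real j) * r = t - real j * r" using r by (simp add: left_diff_distrib)
    finally have tj: "\<bar>t - real j * r\<bar> \<le> r" by simp
    have "dist (x0 + (real j * r) *\<^sub>R v) z = norm ((x - x0) + (t - real j * r) *\<^sub>R v)"
      by (subst dist_commute) (simp add: dist_norm z(1) algebra_simps)
    also have "\<dots> \<le> dist x x0 + \<bar>t - real j * r\<bar> * norm v"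
      using norm_triangle_ineq[of "x - x0" "(t - real j * r) *\<^sub>R v"] by (simp add: dist_norm)
    also have "\<dots> \<le> r + r * norm v"
      using diameter_bounded_bound[OF U(1) z(2) x0] U(2) tj by (intro add_mono mult_right_mono) auto
    finally show "z \<in> W" unfolding W_def b_def using j by (auto simp: s_def algebra_simps)
  qed
  moreover have "emeasure lborel W \<le> ennreal (K * r ^ (DIM('a) - 1))"
  proof -
    have "emeasure lborel W \<le> (\<Sum>j\<le>q. emeasure lborel (b j))"
      unfolding W_def by (rule emeasure_subadditive_finite) (auto simp: b_def)
    also have "\<dots> = (\<Sum>j\<le>q. ennreal (unit_ball_vol (DIM('a)) * s ^ DIM('a)))"
      using s by (intro sum.cong) (auto simp: b_def emeasure_cball)
    also have "\<dots> = ennreal ((1 + real q) * (unit_ball_vol (DIM('a)) * s ^ DIM('a)))"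
      using s by (simp add: ennreal_mult ennreal_of_nat_eq_real_of_nat ennreal_plus)
    also have "\<dots> \<le> ennreal (K * r ^ (DIM('a) - 1))"
    proof (rule ennreal_leI)
      have "real q \<le> 1 / r" using r by (simp add: q_def)
      moreover have "1 \<le> 1 / r" using r by simp
      ultimately have "1 + real q \<le> 2 / r" by linarith
      then have *: "(1 + real q) * (unit_ball_vol (DIM('a)) * s ^ DIM('a)) \<le> 2 / r * (unit_ball_vol (DIM('a)) * s ^ DIM('a))"
        using s by (intro mult_right_mono) auto
      have sd: "s ^ DIM('a) = r * r ^ (DIM('a) - 1) * (1 + norm v) ^ DIM('a)"
        by (simp add: s_def power_mult_distrib flip: power_Suc)
      have "2 / r * (unit_ball_vol (DIM('a)) * (r * r ^ (DIM('a) - 1) * (1 + norm v) ^ DIM('a))) = K * r ^ (DIM('a) - 1)"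
        using r by (simp add: K_def)
      then show "(1 + real q) * (unit_ball_vol (DIM('a)) * s ^ DIM('a)) \<le> K * r ^ (DIM('a) - 1)"
        using * unfolding sd by linarith
    qed
    finally show ?thesis .
  qed
  moreover have "W \<in> sets borel" unfolding W_def b_def by (intro sets.finite_UN) auto
  ultimately show ?thesis by blast
qed

text \<open>The error \<open>\<eta>\<close> accommodates sets of diameter 0, to which \<open>sweep_cover\<close> applies only with \<open>r > 0\<close>.\<close>

lemma sweep_cover_weight:
  fixes v :: "'a::euclidean_space"
  obtains K where "0 \<le> K"
    "\<And>U \<eta>. bounded U \<Longrightarrow> diameter U \<le> 1/2 \<Longrightarrow> 0 < \<eta> \<Longrightarrow> \<exists>W. W \<in> sets borel \<and> sweep v U \<subseteq> W
        \<and> emeasure lborel W \<le> ennreal K * hausdorff_weight (DIM('a) - 1) U + ennreal \<eta>"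
proof -
  let ?m = "DIM('a) - 1"
  define K where "K = 2 * unit_ball_vol (DIM('a)) * (1 + norm v) ^ DIM('a)"
  define vol where "vol = unit_ball_vol (real ?m)"
  have vol: "0 < vol" unfolding vol_def by (rule unit_ball_vol_pos) simp
  define K' where "K' = K * 2 ^ ?m / vol"
  have K: "0 \<le> K" by (simp add: K_def)
  have K': "0 \<le> K'" using K vol by (simp add: K'_def)
  show ?thesis
  proof (rule that[of K'])
    show "0 \<le> K'" by fact
    fix U :: "'a set" and \<eta> :: real
    assume U: "bounded U" "diameter U \<le> 1/2" and \<eta>: "0 < \<eta>"
    show "\<exists>W. W \<in> sets borel \<and> sweep v U \<subseteq> W
        \<and> emeasure lborel W \<le> ennreal K' * hausdorff_weight (DIM('a) - 1) U + ennreal \<eta>"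
    proof (cases "U = {}")
      case True
      then show ?thesis by (intro exI[of _ "{}"]) (simp add: sweep_def)
    next
      case False
      define \<delta> where "\<delta> = diameter U"
      have \<delta>: "0 \<le> \<delta>" "\<delta> \<le> 1/2" using U diameter_ge_0 by (auto simp: \<delta>_def)
      have "((\<lambda>r. K * r ^ ?m) \<longlongrightarrow> K * \<delta> ^ ?m) (at_right \<delta>)"
        by (intro tendsto_intros)
      then have "\<forall>\<^sub>F r in at_right \<delta>. K * r ^ ?m < K * \<delta> ^ ?m + \<eta>"
        using \<eta> by (intro order_tendstoD(2)) auto
      moreover have "\<forall>\<^sub>F r in at_right \<delta>. r < 1 \<and> \<delta> < r"
        using \<delta> unfolding eventually_at_right_field by (intro exI[of _ 1]) auto
      ultimately have "\<forall>\<^sub>F r in at_right \<delta>. K * r ^ ?m < K * \<delta> ^ ?m + \<eta> \<and> r < 1 \<and> \<delta> < r"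
        by eventually_elim auto
      then obtain r where r: "K * r ^ ?m < K * \<delta> ^ ?m + \<eta>" "r < 1" "\<delta> < r"
        using eventually_happens'[OF trivial_limit_at_right_real] by blast
      obtain W where W: "W \<in> sets borel" "sweep v U \<subseteq> W" "emeasure lborel W \<le> ennreal (K * r ^ ?m)"
        using sweep_cover[of U r v] U r \<delta> unfolding K_def \<delta>_def by auto
      note W(3)
      also have "ennreal (K * r ^ ?m) \<le> ennreal (K * \<delta> ^ ?m + \<eta>)"
        using r by (intro ennreal_leI) auto
      also have "\<dots> = ennreal K' * hausdorff_weight ?m U + ennreal \<eta>"
      proof -
        have "K * \<delta> ^ ?m = K' * (vol * (\<delta> / 2) ^ ?m)"
          using vol by (simp add: K'_def power_divide)
        moreover have "hausdorff_weight ?m U = ennreal (vol * (\<delta> / 2) ^ ?m)"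
          using False by (simp only: hausdorff_weight_def \<delta>_def vol_def if_False)
        ultimately show ?thesis
          using K' vol \<delta> \<eta> by (simp add: ennreal_mult ennreal_plus)
      qed
      finally show ?thesis using W by blast
    qed
  qed
qed

lemma negligible_sweep:
  fixes N :: "'a::euclidean_space set"
  assumes "codim1_measure N = 0"
  shows "negligible (sweep v N)"
  unfolding negligible_outer_le
proof (intro allI impI)
  fix e :: real assume e: "0 < e"
  obtain K where K: "0 \<le> K"
    "\<And>U \<eta>. bounded U \<Longrightarrow> diameter U \<le> 1/2 \<Longrightarrow> 0 < \<eta> \<Longrightarrow> \<exists>W. W \<in> sets borel \<and> sweep v U \<subseteq> W
        \<and> emeasure lborel W \<le> ennreal K * hausdorff_weight (DIM('a) - 1) U + ennreal \<eta>"
    using sweep_cover_weight[of v] by blast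
  have e': "0 < e / (2 * (K + 1))" using e K(1) by simp
  obtain U :: "nat \<Rightarrow> 'a set" where U: "N \<subseteq> (\<Union>k. U k)" "\<And>k. bounded (U k)" "\<And>k. diameter (U k) \<le> 1/2"
    "(\<Sum>k. hausdorff_weight (DIM('a) - 1) (U k)) \<le> ennreal (e / (2 * (K + 1)))"
    using hausdorff_nullD[OF assms[unfolded codim1_measure_def] half_gt_zero[OF zero_less_one] e'] by blast
  have "\<forall>k. \<exists>W. W \<in> sets borel \<and> sweep v (U k) \<subseteq> W
        \<and> emeasure lborel W \<le> ennreal K * hausdorff_weight (DIM('a) - 1) (U k) + ennreal (e / 2 * (1/2) ^ Suc k)"
    using U(2,3) e by (intro allI K(2)) auto
  then obtain W where W: "\<And>k. W k \<in> sets borel" "\<And>k. sweep v (U k) \<subseteq> W k"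
    "\<And>k. emeasure lborel (W k) \<le> ennreal K * hausdorff_weight (DIM('a) - 1) (U k) + ennreal (e / 2 * (1/2) ^ Suc k)"
    by metis
  let ?T = "\<Union>k. W k"
  have "sweep v N \<subseteq> (\<Union>k. sweep v (U k))"
    unfolding sweep_def using U(1) by blast
  then have sub: "sweep v N \<subseteq> ?T" using W(2) by blast
  have T: "?T \<in> sets borel" using W(1) by auto
  have "emeasure lborel ?T \<le> (\<Sum>k. emeasure lborel (W k))"
    using W(1) by (intro emeasure_subadditive_countably) auto
  also have "\<dots> \<le> (\<Sum>k. ennreal K * hausdorff_weight (DIM('a) - 1) (U k) + ennreal (e / 2 * (1/2) ^ Suc k))"
    by (intro suminf_le W(3)) auto
  also have "\<dots> = (\<Sum>k. ennreal K * hausdorff_weight (DIM('a) - 1) (U k)) + (\<Sum>k. ennreal (e / 2 * (1/2) ^ Suc k))"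
    by (intro suminf_add[symmetric]) auto
  also have "(\<Sum>k. ennreal (e / 2 * (1/2) ^ Suc k)) = ennreal (e / 2)"
  proof -
    have "(\<lambda>k. e / 2 * (1/2) ^ Suc k) sums (e / 2 * 1)"
      by (intro sums_mult power_half_series)
    then show ?thesis using e by (subst suminf_ennreal_eq) auto
  qed
  also have "(\<Sum>k. ennreal K * hausdorff_weight (DIM('a) - 1) (U k)) \<le> ennreal (e / 2)"
  proof -
    have "(\<Sum>k. ennreal K * hausdorff_weight (DIM('a) - 1) (U k)) \<le> ennreal K * ennreal (e / (2 * (K + 1)))"
      using U(4) by (simp add: mult_left_mono)
    also have "\<dots> = ennreal (K * (e / (2 * (K + 1))))"
      using K(1) e by (intro ennreal_mult[symmetric]) auto
    also have "\<dots> \<le> ennreal (e / 2)"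
      using K(1) e by (intro ennreal_leI) (simp add: field_simps)
    finally show ?thesis .
  qed
  finally have T_le: "emeasure lborel ?T \<le> ennreal (e / 2) + ennreal (e / 2)"
    by (simp add: add_right_mono)
  then have T_le: "emeasure lborel ?T \<le> ennreal e" using e by (simp flip: ennreal_plus)
  then have eT: "emeasure lebesgue ?T \<le> ennreal e" using T by simp
  show "\<exists>T. sweep v N \<subseteq> T \<and> T \<in> lmeasurable \<and> measure lebesgue T \<le> e"
  proof (intro exI[of _ ?T] conjI sub)
    show "?T \<in> lmeasurable"
      using eT T by (intro fmeasurableI) (auto simp: less_top[symmetric] top_unique intro: le_less_trans)
    show "measure lebesgue ?T \<le> e"
      unfolding measure_def using eT e by (intro enn2real_leI) auto
  qed
qed

section \<open>Combinatorics and connectedness of an admissible mesh\<close>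

text \<open>A hyperplane that separates \<open>K\<close> and \<open>L\<close> contains every set lying in both closures. If such a set
  spans a hyperplane, the separating hyperplane is that one.\<close>

lemma opposite_sides_of_common_face:
  fixes K L :: "'a::euclidean_space set"
  assumes "convex K" "convex L" "open K" "open L" "K \<inter> L = {}"
    and hull: "affine hull S = {x. a \<bullet> x = b}" and "a \<noteq> 0"
    and S: "S \<subseteq> closure K" "S \<subseteq> closure L" and k: "k \<in> K" and l: "l \<in> L"
  shows "(a \<bullet> k - b) * (a \<bullet> l - b) < 0"
proof -
  obtain a' b' where a': "a' \<noteq> 0" "\<And>x. x \<in> K \<Longrightarrow> a' \<bullet> x \<le> b'" "\<And>x. x \<in> L \<Longrightarrow> b' \<le> a' \<bullet> x"
    using separating_hyperplane_sets[OF assms(1,2) _ _ assms(5)] k l by blast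
  have strict: "a' \<bullet> k < b'" "b' < a' \<bullet> l"
  proof -
    have "K \<subseteq> interior {x. a' \<bullet> x \<le> b'}" using a' assms(3) by (intro interior_maximal) auto
    then show "a' \<bullet> k < b'" using interior_halfspace_le[OF a'(1)] k by blast
    have "L \<subseteq> interior {x. a' \<bullet> x \<ge> b'}" using a' assms(4) by (intro interior_maximal) auto
    then show "b' < a' \<bullet> l" using interior_halfspace_ge[OF a'(1)] l by blast
  qed
  have "closure K \<subseteq> {x. a' \<bullet> x \<le> b'}" using a' by (intro closure_minimal closed_halfspace_le) auto
  moreover have "closure L \<subseteq> {x. a' \<bullet> x \<ge> b'}" using a' by (intro closure_minimal closed_halfspace_ge) auto
  ultimately have "S \<subseteq> {x. a' \<bullet> x = b'}" using S by fastforce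
  then have "{x. a \<bullet> x = b} \<subseteq> {x. a' \<bullet> x = b'}"
    unfolding hull[symmetric] by (intro hull_minimal affine_hyperplane)
  moreover have "{x. a \<bullet> x = b} \<noteq> {}"
  proof -
    have "a \<bullet> ((b / (a \<bullet> a)) *\<^sub>R a) = b" using assms(7) by simp
    then show ?thesis by blast
  qed
  ultimately have eq: "{x. a \<bullet> x = b} = {x. a' \<bullet> x = b'}"
    using assms(7) a'(1) by (intro affine_dim_equal affine_hyperplane) auto
  have "\<not> 0 \<le> (a \<bullet> k - b) * (a \<bullet> l - b)"
  proof
    assume same: "0 \<le> (a \<bullet> k - b) * (a \<bullet> l - b)"
    have "a \<bullet> k \<noteq> b" "a \<bullet> l \<noteq> b" using eq strict by auto
    then consider "b < a \<bullet> k" "b < a \<bullet> l" | "a \<bullet> k < b" "a \<bullet> l < b"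
      using same by (auto simp: zero_le_mult_iff)
    moreover have "\<exists>x \<in> closed_segment k l. a' \<bullet> x = b'"
      using strict connected_ivt_hyperplane[OF connected_segment(1), of k k l l a' b'] by auto
    then obtain x where x: "x \<in> closed_segment k l" "a \<bullet> x = b" using eq by blast
    ultimately show False
    proof cases
      case 1
      then have "closed_segment k l \<subseteq> {x. b < a \<bullet> x}"
        by (intro closed_segment_subset convex_halfspace_gt) auto
      then show False using x by auto
    next
      case 2
      then have "closed_segment k l \<subseteq> {x. a \<bullet> x < b}"
        by (intro closed_segment_subset convex_halfspace_lt) auto
      then show False using x by auto
    qed
  qed
  then show ?thesis by simp
qed

text \<open>A connected bounded polyhedral domain with an admissible mesh.\<close>

locale mesh =
  fixes \<Omega> :: "'a::euclidean_space set" and M :: "'a mesh"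
  assumes open_dom: "open \<Omega>" and connected_dom: "connected \<Omega>"
    and bounded_dom: "bounded \<Omega>" and polyhedral_dom: "polyhedral \<Omega>"
    and admissible: "admissible_mesh \<Omega> M"
begin

lemmas admissible_conjs = admissible[unfolded admissible_mesh_def]

lemma finite_cells: "finite (cells M)" and finite_faces: "finite (faces M)"
  using admissible_conjs by simp_all

lemma open_cell: "K \<in> cells M \<Longrightarrow> open K" and convex_cell: "K \<in> cells M \<Longrightarrow> convex K"
  and cell_nonempty: "K \<in> cells M \<Longrightarrow> K \<noteq> {}"
  and cells_disjoint: "K \<in> cells M \<Longrightarrow> L \<in> cells M \<Longrightarrow> K \<noteq> L \<Longrightarrow> K \<inter> L = {}"
  and center_in: "K \<in> cells M \<Longrightarrow> center M K \<in> K"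
  using admissible_conjs by simp_all

lemma closure_cells: "(\<Union>K\<in>cells M. closure K) = closure \<Omega>"
  and cell_faces_subset: "K \<in> cells M \<Longrightarrow> cell_faces M K \<subseteq> faces M"
  and frontier_cell: "K \<in> cells M \<Longrightarrow> frontier K = \<Union>(cell_faces M K)"
  and closures_Int: "K \<in> cells M \<Longrightarrow> L \<in> cells M \<Longrightarrow> K \<noteq> L \<Longrightarrow>
        closure K \<inter> closure L \<in> faces M \<or> codim1_measure (closure K \<inter> closure L) = 0"
  using admissible_conjs by simp_all

lemma face_measure_pos: "\<sigma> \<in> faces M \<Longrightarrow> 0 < face_measure \<sigma>"
  and face_in_hyperplane: "\<sigma> \<in> faces M \<Longrightarrow> \<exists>h. is_hyperplane h \<and> \<sigma> \<subseteq> h"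
  and faces_Int_null: "\<sigma> \<in> faces M \<Longrightarrow> \<sigma>' \<in> faces M \<Longrightarrow> \<sigma> \<noteq> \<sigma>' \<Longrightarrow> codim1_measure (\<sigma> \<inter> \<sigma>') = 0"
  using admissible_conjs by simp_all

lemma bounded_closure_cell: "K \<in> cells M \<Longrightarrow> bounded (closure K)"
  using bounded_subset[OF bounded_closure[OF bounded_dom]] closure_cells by blast

lemma lmeasurable_cell: "K \<in> cells M \<Longrightarrow> K \<in> lmeasurable"
  using lmeasurable_open[OF bounded_subset[OF bounded_closure_cell closure_subset] open_cell] by blast

lemma cell_measure_pos: "K \<in> cells M \<Longrightarrow> 0 < cell_measure K"
  unfolding cell_measure_def
  using open_not_negligible[OF open_cell cell_nonempty] lmeasurable_cell
  by (metis measure_nonneg negligible_iff_measure0 less_eq_real_def)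

lemma face_not_null: "\<sigma> \<in> faces M \<Longrightarrow> codim1_measure \<sigma> \<noteq> 0"
  using face_measure_pos by (fastforce simp: face_measure_def)

lemma face_subset_closure: "K \<in> cells M \<Longrightarrow> \<sigma> \<in> cell_faces M K \<Longrightarrow> \<sigma> \<subseteq> closure K"
  using frontier_cell by (force simp: frontier_def)

lemma face_affine_hull:
  assumes "\<sigma> \<in> faces M" "K \<in> cells M" "\<sigma> \<subseteq> closure K"
  shows "\<exists>a b. a \<noteq> 0 \<and> affine hull \<sigma> = {x. a \<bullet> x = b}"
proof -
  obtain a b where a: "a \<noteq> 0" "\<sigma> \<subseteq> {x. a \<bullet> x = b}"
    using face_in_hyperplane[OF assms(1)] by (auto simp: is_hyperplane_def)
  have "bounded \<sigma>" using assms bounded_closure_cell bounded_subset by blast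
  then have "\<not> aff_dim \<sigma> < int (DIM('a) - 1)"
    using hausdorff_null_low_dim face_not_null[OF assms(1)] unfolding codim1_measure_def by blast
  then have dim: "int DIM('a) - 1 \<le> aff_dim (affine hull \<sigma>)"
    by (simp add: of_nat_diff)
  have sub: "affine hull \<sigma> \<subseteq> {x. a \<bullet> x = b}" using a(2) by (intro hull_minimal affine_hyperplane)
  moreover have "affine hull \<sigma> \<noteq> {}"
    using dim face_not_null[OF assms(1)] by (auto simp: codim1_measure_def hausdorff_null_empty)
  moreover have "aff_dim (affine hull \<sigma>) = aff_dim {x. a \<bullet> x = b}"
    using dim aff_dim_subset[OF sub] a(1) by simp
  ultimately have "affine hull \<sigma> = {x. a \<bullet> x = b}"
    by (intro affine_dim_equal affine_hyperplane affine_affine_hull)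
  then show ?thesis using a(1) by blast
qed

lemma no_three_cells:
  assumes \<sigma>: "\<sigma> \<in> faces M" and K: "K \<in> cells M" "L \<in> cells M" "L' \<in> cells M"
    and sub: "\<sigma> \<subseteq> closure K" "\<sigma> \<subseteq> closure L" "\<sigma> \<subseteq> closure L'" and "K \<noteq> L" "K \<noteq> L'"
  shows "L = L'"
proof (rule ccontr)
  assume "L \<noteq> L'"
  obtain a b where a: "a \<noteq> 0" "affine hull \<sigma> = {x. a \<bullet> x = b}"
    using face_affine_hull[OF \<sigma> K(1) sub(1)] by blast
  have opp: "(a \<bullet> center M K1 - b) * (a \<bullet> center M K2 - b) < 0"
    if "K1 \<in> cells M" "K2 \<in> cells M" "K1 \<noteq> K2" "\<sigma> \<subseteq> closure K1" "\<sigma> \<subseteq> closure K2" for K1 K2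
    using that a by (intro opposite_sides_of_common_face[of K1 K2 \<sigma>] convex_cell open_cell cells_disjoint center_in)
  have "(a \<bullet> center M K - b) * (a \<bullet> center M L - b) < 0"
    "(a \<bullet> center M K - b) * (a \<bullet> center M L' - b) < 0"
    "(a \<bullet> center M L - b) * (a \<bullet> center M L' - b) < 0"
    using opp K sub assms(8,9) \<open>L \<noteq> L'\<close> by auto
  then show False by (auto simp: mult_less_0_iff)
qed

lemma common_face_commute: "common_face M K L \<sigma> \<Longrightarrow> common_face M L K \<sigma>"
  by (auto simp: common_face_def)

lemma common_faceD:
  assumes "common_face M K L \<sigma>"
  shows "K \<in> cells M" "L \<in> cells M" "K \<noteq> L" "\<sigma> \<in> faces M" "\<sigma> \<subseteq> closure K" "\<sigma> \<subseteq> closure L"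
  using assms by (auto simp: common_face_def)

lemma common_face_cases:
  assumes "common_face M K L \<sigma>" "K' \<in> cells M" "\<sigma> \<subseteq> closure K'"
  shows "K' = K \<or> K' = L"
  using no_three_cells[of \<sigma> K L K'] common_faceD[OF assms(1)] assms(2,3) by blast

lemma neighbour_eq: "common_face M K L \<sigma> \<Longrightarrow> neighbour M K \<sigma> = L"
  unfolding neighbour_def using common_face_cases common_faceD by (intro the_equality) metis+

lemma face_dist_eq:
  assumes "common_face M K L \<sigma>"
  shows "face_dist M \<sigma> = norm (center M K - center M L)"
  unfolding face_dist_def
proof (rule the_equality)
  show "\<exists>K' L'. common_face M K' L' \<sigma> \<and> norm (center M K - center M L) = norm (center M K' - center M L')"
    using assms by blast
  fix r assume "\<exists>K' L'. common_face M K' L' \<sigma> \<and> r = norm (center M K' - center M L')"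
  then obtain K' L' where *: "common_face M K' L' \<sigma>" "r = norm (center M K' - center M L')" by blast
  then have "K' = K \<or> K' = L" "L' = K \<or> L' = L" "K' \<noteq> L'"
    using common_face_cases[OF assms] common_faceD[OF *(1)] by auto
  then show "r = norm (center M K - center M L)" using *(2) by (auto simp: norm_minus_commute)
qed

lemma face_dist_pos:
  assumes "\<sigma> \<in> interior_faces M"
  shows "0 < face_dist M \<sigma>"
proof -
  obtain K L where KL: "common_face M K L \<sigma>" using assms by (auto simp: interior_faces_def)
  then have "center M K \<noteq> center M L"
    using common_faceD[OF KL] center_in cells_disjoint by (metis disjoint_iff)
  then show ?thesis by (simp add: face_dist_eq[OF KL])
qed

text \<open>The common face lies in the boundary of each of its cells. Were it not one of the faces assigned to the
  cell, it would be covered by its null intersections with these.\<close>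

lemma common_face_in_cell_faces:
  assumes "common_face M K L \<sigma>"
  shows "\<sigma> \<in> cell_faces M K"
proof (rule ccontr)
  assume not_in: "\<sigma> \<notin> cell_faces M K"
  note KL = common_faceD[OF assms]
  have "K \<inter> closure L = {}"
    using open_Int_closure_eq_empty[OF open_cell[OF KL(1)]] cells_disjoint[OF KL(1,2,3)] by blast
  then have "\<sigma> \<subseteq> frontier K"
    using assms open_cell[OF KL(1)] by (auto simp: common_face_def frontier_def interior_open)
  then have "\<sigma> \<subseteq> (\<Union>\<sigma>'\<in>cell_faces M K. \<sigma> \<inter> \<sigma>')"
    using frontier_cell[OF KL(1)] by blast
  moreover have "hausdorff_measure (DIM('a) - 1) (\<Union>\<sigma>'\<in>cell_faces M K. \<sigma> \<inter> \<sigma>') = 0"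
  proof (rule hausdorff_null_UN)
    show "finite (cell_faces M K)"
      using cell_faces_subset[OF KL(1)] finite_faces by (rule finite_subset)
    fix \<sigma>' assume "\<sigma>' \<in> cell_faces M K"
    then show "hausdorff_measure (DIM('a) - 1) (\<sigma> \<inter> \<sigma>') = 0"
      using not_in KL(4) cell_faces_subset[OF KL(1)] faces_Int_null[of \<sigma> \<sigma>'] by (auto simp: codim1_measure_def)
  qed
  ultimately have "codim1_measure \<sigma> = 0"
    unfolding codim1_measure_def by (rule hausdorff_null_subset[rotated])
  then show False using face_not_null[OF KL(4)] by blast
qed

lemma common_face_neighbour:
  assumes "K \<in> cells M" "\<sigma> \<in> cell_faces M K \<inter> interior_faces M"
  shows "common_face M K (neighbour M K \<sigma>) \<sigma>"
proof -
  obtain K' L' where *: "common_face M K' L' \<sigma>" using assms(2) by (auto simp: interior_faces_def)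
  then have "K = K' \<or> K = L'" using assms face_subset_closure by (intro common_face_cases) auto
  then show ?thesis using neighbour_eq * common_face_commute by metis
qed

lemma adjacent_cell_common_face:
  assumes "\<sigma> \<in> interior_faces M"
  shows "common_face M (adjacent_cell M \<sigma>) (neighbour M (adjacent_cell M \<sigma>) \<sigma>) \<sigma>"
proof -
  have "\<exists>K L. common_face M K L \<sigma>" using assms by (simp add: interior_faces_def)
  from someI_ex[OF this] obtain L where "common_face M (adjacent_cell M \<sigma>) L \<sigma>"
    unfolding adjacent_cell_def by blast
  then show ?thesis using neighbour_eq by simp
qed

lemma common_face_interior: "common_face M K L \<sigma> \<Longrightarrow> \<sigma> \<in> interior_faces M"
  by (auto simp: interior_faces_def common_face_def)

lemma finite_cell_faces: "K \<in> cells M \<Longrightarrow> finite (cell_faces M K)"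
  using cell_faces_subset finite_faces finite_subset by blast

lemma finite_interior_faces: "finite (interior_faces M)"
  using finite_faces by (simp add: interior_faces_def)

lemma sum_cells_interior_faces:
  fixes g :: "'a set \<Rightarrow> 'a set \<Rightarrow> 'b::comm_monoid_add"
  shows "(\<Sum>K\<in>cells M. \<Sum>\<sigma>\<in>cell_faces M K \<inter> interior_faces M. g K \<sigma>)
    = (\<Sum>\<sigma>\<in>interior_faces M. g (adjacent_cell M \<sigma>) \<sigma> + g (neighbour M (adjacent_cell M \<sigma>) \<sigma>) \<sigma>)"
proof -
  have "(\<Sum>K\<in>cells M. \<Sum>\<sigma>\<in>cell_faces M K \<inter> interior_faces M. g K \<sigma>)
    = (\<Sum>K\<in>cells M. \<Sum>\<sigma> | \<sigma> \<in> interior_faces M \<and> \<sigma> \<in> cell_faces M K. g K \<sigma>)"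
    by (intro sum.cong) auto
  also have "\<dots> = (\<Sum>\<sigma>\<in>interior_faces M. \<Sum>K | K \<in> cells M \<and> \<sigma> \<in> cell_faces M K. g K \<sigma>)"
    by (rule sum.swap_restrict) (auto simp: finite_cells finite_interior_faces)
  also have "\<dots> = (\<Sum>\<sigma>\<in>interior_faces M. g (adjacent_cell M \<sigma>) \<sigma> + g (neighbour M (adjacent_cell M \<sigma>) \<sigma>) \<sigma>)"
  proof (rule sum.cong[OF refl])
    fix \<sigma> assume \<sigma>: "\<sigma> \<in> interior_faces M"
    define K L where "K = adjacent_cell M \<sigma>" and "L = neighbour M K \<sigma>"
    have KL: "common_face M K L \<sigma>" using adjacent_cell_common_face[OF \<sigma>] by (simp add: K_def L_def)
    have "K' = K \<or> K' = L" if "K' \<in> cells M" "\<sigma> \<in> cell_faces M K'" for K'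
      using common_face_cases[OF KL that(1) face_subset_closure[OF that]] .
    moreover have "K \<in> cells M" "L \<in> cells M" "\<sigma> \<in> cell_faces M K" "\<sigma> \<in> cell_faces M L"
      using common_faceD(1,2)[OF KL] common_face_in_cell_faces[OF KL]
        common_face_in_cell_faces[OF common_face_commute[OF KL]] .
    ultimately have "{K. K \<in> cells M \<and> \<sigma> \<in> cell_faces M K} = {K, L}" by blast
    then show "(\<Sum>K | K \<in> cells M \<and> \<sigma> \<in> cell_faces M K. g K \<sigma>)
        = g (adjacent_cell M \<sigma>) \<sigma> + g (neighbour M (adjacent_cell M \<sigma>) \<sigma>) \<sigma>"
      using common_faceD(3)[OF KL] by (simp add: K_def L_def)
  qed
  finally show ?thesis .
qed

text \<open>Connectedness of the graph of the mesh. If no face leads out of \<open>W\<close>, the closed unions \<open>F\<close> and \<open>F'\<close> of the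
  closures of the cells inside and outside of \<open>W\<close> meet only in null sets. They do meet in \<open>\<Omega>\<close>, and near a
  common point a segment from a cell in \<open>W\<close> to a cell outside can be translated so as to avoid these sets;
  but then it is disconnected by \<open>F\<close> and \<open>F'\<close>.\<close>

lemma cells_connected:
  assumes W: "W \<subseteq> cells M" "W \<noteq> {}"
    and nb: "\<And>K \<sigma>. K \<in> W \<Longrightarrow> \<sigma> \<in> cell_faces M K \<inter> interior_faces M \<Longrightarrow> neighbour M K \<sigma> \<in> W"
  shows "W = cells M"
proof (rule ccontr)
  define W' where "W' = cells M - W"
  assume "W \<noteq> cells M"
  then have W': "W' \<noteq> {}" "W' \<subseteq> cells M" using W(1) by (auto simp: W'_def)
  have null: "codim1_measure (closure K \<inter> closure L) = 0" if "K \<in> W" "L \<in> W'" for K L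
  proof -
    have KL: "K \<in> cells M" "L \<in> cells M" "K \<noteq> L" using that W(1) by (auto simp: W'_def)
    have "closure K \<inter> closure L \<notin> faces M"
    proof
      assume "closure K \<inter> closure L \<in> faces M"
      then have c: "common_face M K L (closure K \<inter> closure L)" using KL by (simp add: common_face_def)
      have "L \<in> W"
        using nb[OF that(1) IntI[OF common_face_in_cell_faces[OF c] common_face_interior[OF c]]]
        unfolding neighbour_eq[OF c] .
      then show False using that(2) by (simp add: W'_def)
    qed
    then show ?thesis using closures_Int[OF KL] by blast
  qed
  define F F' where "F = (\<Union>K\<in>W. closure K)" and "F' = (\<Union>K\<in>W'. closure K)"
  have fin: "finite W" "finite W'" using W(1) W'(2) finite_cells by (auto intro: finite_subset)
  have closed: "closed F" "closed F'" unfolding F_def F'_def using fin by auto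
  have cover: "\<Omega> \<subseteq> F \<union> F'"
  proof -
    have "F \<union> F' = (\<Union>K\<in>W \<union> W'. closure K)" by (simp add: F_def F'_def UN_Un)
    also have "W \<union> W' = cells M" using W(1) by (auto simp: W'_def)
    finally have "F \<union> F' = closure \<Omega>" using closure_cells by simp
    then show ?thesis using closure_subset by blast
  qed
  have meets: "K \<inter> \<Omega> \<noteq> {}" if "K \<in> cells M" for K
  proof -
    have "K \<subseteq> closure \<Omega>" using that closure_cells closure_subset by blast
    then show ?thesis
      using open_Int_closure_eq_empty[OF open_cell[OF that], of \<Omega>] cell_nonempty[OF that] by blast
  qed
  have FK: "K \<subseteq> F" if "K \<in> W" for K
    unfolding F_def using closure_subset UN_upper[OF that, of closure] by (rule order_trans)
  have FK': "K \<subseteq> F'" if "K \<in> W'" for K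
    unfolding F'_def using closure_subset UN_upper[OF that, of closure] by (rule order_trans)
  obtain K0 L0 where KL0: "K0 \<in> W" "L0 \<in> W'" using W(2) W'(1) by blast
  have "F \<inter> \<Omega> \<noteq> {}" using meets[of K0] FK[OF KL0(1)] W(1) KL0(1) by blast
  moreover have "F' \<inter> \<Omega> \<noteq> {}" using meets[of L0] FK'[OF KL0(2)] W'(2) KL0(2) by blast
  ultimately have "F \<inter> F' \<inter> \<Omega> \<noteq> {}"
    using connected_closedD[OF connected_dom _ cover closed] by blast
  then obtain z K L where z: "z \<in> \<Omega>" "K \<in> W" "z \<in> closure K" "L \<in> W'" "z \<in> closure L"
    unfolding F_def F'_def by blast
  obtain r where r: "0 < r" "ball z r \<subseteq> \<Omega>" using open_dom z(1) open_contains_ball by blast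
  have KL: "K \<in> cells M" "L \<in> cells M" using z W W' by auto
  obtain a where a: "a \<in> K \<inter> ball z r"
    using z(3) r(1) closure_approachable[of z K] by (auto simp: dist_commute)
  obtain b where b: "b \<in> L \<inter> ball z r"
    using z(5) r(1) closure_approachable[of z L] by (auto simp: dist_commute)
  obtain \<rho>1 where \<rho>1: "0 < \<rho>1" "ball a \<rho>1 \<subseteq> K \<inter> ball z r"
    using a open_contains_ball[THEN iffD1, OF open_Int[OF open_cell[OF KL(1)] open_ball]] by blast
  obtain \<rho>2 where \<rho>2: "0 < \<rho>2" "ball b \<rho>2 \<subseteq> L \<inter> ball z r"
    using b open_contains_ball[THEN iffD1, OF open_Int[OF open_cell[OF KL(2)] open_ball]] by blast
  define \<rho> v where "\<rho> = min \<rho>1 \<rho>2" and "v = b - a"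
  have "negligible (\<Union>(K', L')\<in>W \<times> W'. sweep (- v) (closure K' \<inter> closure L'))"
    using fin null by (intro negligible_Union) (auto intro!: negligible_sweep)
  moreover have "\<not> negligible (ball a \<rho>)"
    using \<rho>1 \<rho>2 by (intro open_not_negligible) (auto simp: \<rho>_def)
  ultimately obtain y where y: "y \<in> ball a \<rho>"
    "y \<notin> (\<Union>(K', L')\<in>W \<times> W'. sweep (- v) (closure K' \<inter> closure L'))"
    using negligible_subset by blast
  have yK: "y \<in> K" "y \<in> ball z r" using y(1) \<rho>1 by (auto simp: \<rho>_def)
  have "y + v \<in> ball b \<rho>2" using y(1) by (simp add: v_def \<rho>_def dist_norm)
  then have yL: "y + v \<in> L" "y + v \<in> ball z r" using \<rho>2 by auto
  let ?S = "closed_segment y (y + v)"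
  have "?S \<subseteq> ball z r" using yK yL by (intro closed_segment_subset) auto
  then have "?S \<subseteq> F \<union> F'" using r(2) cover by blast
  moreover have "y \<in> F \<inter> ?S" "y + v \<in> F' \<inter> ?S"
    using FK[OF z(2)] FK'[OF z(4)] yK yL by auto
  ultimately have "F \<inter> F' \<inter> ?S \<noteq> {}"
    using connected_closedD[OF connected_segment(1)[of y "y + v"] _ _ closed] by blast
  then obtain w K' L' where w: "w \<in> ?S" "K' \<in> W" "L' \<in> W'" "w \<in> closure K' \<inter> closure L'"
    unfolding F_def F'_def by blast
  obtain t where t: "0 \<le> t" "t \<le> 1" "w = y + t *\<^sub>R v"
    using w(1) by (auto simp: in_segment algebra_simps)
  then have "y = w + t *\<^sub>R (- v)" by simp
  then have "\<exists>x s. y = x + s *\<^sub>R (- v) \<and> x \<in> closure K' \<inter> closure L' \<and> s \<in> {0..1}"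
    using w(4) t(1,2) by (intro exI[of _ w] exI[of _ t] conjI) auto
  then have "y \<in> sweep (- v) (closure K' \<inter> closure L')"
    unfolding sweep_def by (rule CollectI)
  then show False using y(2) w(2,3) by auto
qed

end

section \<open>The discretised initial datum\<close>

lemma integrable_lebesgue_on_iff:
  fixes f :: "'a::euclidean_space \<Rightarrow> real"
  assumes "S \<in> sets lebesgue"
  shows "integrable (lebesgue_on S) f \<longleftrightarrow> f absolutely_integrable_on S"
  unfolding set_integrable_def using assms by (subst integrable_restrict_space) auto

context mesh
begin

text \<open>A cell is contained in the closure of \<open>\<Omega>\<close>, but not necessarily in \<open>\<Omega>\<close>, which may have slits. The exceptional
  set is null because the boundary of \<open>\<Omega>\<close> is contained in finitely many hyperplanes.\<close>

lemma negligible_cell_outside: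
  assumes "K \<in> cells M"
  shows "negligible (K - \<Omega>)"
proof -
  obtain H where H: "finite H" "\<And>h. h \<in> H \<Longrightarrow> is_hyperplane h" "frontier \<Omega> \<subseteq> \<Union>H"
    using polyhedral_dom by (auto simp: polyhedral_def)
  have "negligible h" if "h \<in> H" for h
    using H(2)[OF that] negligible_hyperplane by (auto simp: is_hyperplane_def)
  then have "negligible (\<Union>H)" using H(1) by (intro negligible_Union)
  moreover have "K \<subseteq> closure \<Omega>" using assms closure_cells closure_subset by blast
  then have "K - \<Omega> \<subseteq> \<Union>H" using H(3) open_dom by (auto simp: frontier_def interior_open)
  ultimately show ?thesis by (rule negligible_subset)
qed

lemma negligible_outside_cells: "negligible (\<Omega> - \<Union>(cells M))"
proof -
  have "negligible (\<Union>(frontier ` cells M))"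
    using finite_cells convex_cell by (intro negligible_Union) (auto intro: negligible_convex_frontier)
  moreover have "\<Omega> - \<Union>(cells M) \<subseteq> \<Union>(frontier ` cells M)"
  proof
    fix x assume x: "x \<in> \<Omega> - \<Union>(cells M)"
    then have "x \<in> (\<Union>K\<in>cells M. closure K)" using closure_cells closure_subset by blast
    then obtain K where K: "K \<in> cells M" "x \<in> closure K" by blast
    then have "x \<in> frontier K" using x open_cell[OF K(1)] by (auto simp: frontier_def interior_open)
    then show "x \<in> \<Union>(frontier ` cells M)" using K(1) by blast
  qed
  ultimately show ?thesis by (rule negligible_subset)
qed

lemma sets_cell: "K \<in> cells M \<Longrightarrow> K \<in> sets lebesgue" and sets_dom: "\<Omega> \<in> sets lebesgue"
  using lmeasurable_cell open_dom by (auto dest: fmeasurableD)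

lemma AE_cell:
  assumes "AE x in lebesgue_on \<Omega>. P x" "K \<in> cells M"
  shows "AE x in lebesgue_on K. P x"
proof -
  have "AE x in lebesgue. x \<in> \<Omega> \<longrightarrow> P x"
    using assms(1) sets_dom by (subst (asm) AE_restrict_space_iff) auto
  moreover have "AE x in lebesgue. x \<notin> K - \<Omega>"
    using negligible_cell_outside[OF assms(2)] by (intro AE_not_in) (simp add: negligible_iff_null_sets)
  ultimately have "AE x in lebesgue. x \<in> K \<longrightarrow> P x" by eventually_elim auto
  then show ?thesis using sets_cell[OF assms(2)] by (subst AE_restrict_space_iff) auto
qed

lemma integrable_cell:
  fixes f :: "'a \<Rightarrow> real"
  assumes "integrable (lebesgue_on \<Omega>) f" and K: "K \<in> cells M"
  shows "integrable (lebesgue_on K) f"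
proof -
  have "f absolutely_integrable_on \<Omega>" using assms sets_dom by (simp add: integrable_lebesgue_on_iff)
  then have "f absolutely_integrable_on (K \<inter> \<Omega>)"
    by (rule set_integrable_subset[OF _ sets.Int[OF sets_cell[OF K] sets_dom] Int_lower2])
  moreover have "f absolutely_integrable_on (K \<inter> \<Omega>) \<longleftrightarrow> f absolutely_integrable_on K"
    by (rule absolutely_integrable_spike_set_eq)
      (auto intro: negligible_subset[OF negligible_cell_outside[OF K]] negligible_subset[OF negligible_empty])
  ultimately show ?thesis using sets_cell[OF K] by (simp add: integrable_lebesgue_on_iff)
qed

lemma sum_integral_cells:
  fixes f :: "'a \<Rightarrow> real"
  assumes f: "integrable (lebesgue_on \<Omega>) f"
  shows "(\<Sum>K\<in>cells M. LINT x | lebesgue_on K. f x) = (LINT x | lebesgue_on \<Omega>. f x)"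
proof -
  have "(f has_integral (\<Sum>K\<in>cells M. LINT x | lebesgue_on K. f x)) (\<Union>(cells M))"
  proof (rule has_integral_Union[OF finite_cells])
    show "(f has_integral (LINT x | lebesgue_on K. f x)) K" if "K \<in> cells M" for K
      using that by (intro has_integral_integral_lebesgue_on integrable_cell[OF f] sets_cell)
    show "pairwise (\<lambda>K L. negligible (K \<inter> L)) (cells M)"
      by (rule pairwiseI) (simp add: cells_disjoint)
  qed
  moreover have "negligible (\<Union>(cells M) - \<Omega>)"
  proof -
    have "negligible (\<Union>((\<lambda>K. K - \<Omega>) ` cells M))"
      using finite_cells negligible_cell_outside by (intro negligible_Union) auto
    then show ?thesis by (rule negligible_subset) auto
  qed
  then have "(f has_integral y) (\<Union>(cells M)) \<longleftrightarrow> (f has_integral y) \<Omega>" for y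
    using negligible_outside_cells
    by (intro has_integral_spike_set_eq) (auto intro: negligible_subset)
  moreover have "(f has_integral (LINT x | lebesgue_on \<Omega>. f x)) \<Omega>"
    by (rule has_integral_integral_lebesgue_on[OF f sets_dom])
  ultimately show ?thesis using has_integral_unique by blast
qed

end

lemma integrable_simplex_valued:
  fixes w :: "'a::euclidean_space \<Rightarrow> real ^ 'n::finite"
  assumes "S \<in> lmeasurable" "w \<in> borel_measurable (lebesgue_on S)" "AE x in lebesgue_on S. w x \<in> conc_simplex"
  shows "integrable (lebesgue_on S) (\<lambda>x. w x $ i)"
proof -
  interpret finite_measure "lebesgue_on S"
    by (rule finite_measure_lebesgue_on[OF assms(1)])
  have "(\<lambda>x. w x $ i) \<in> borel_measurable (lebesgue_on S)"
    by (rule measurable_compose[OF assms(2) borel_measurable_continuous_onI])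
      (intro continuous_on_component continuous_on_id)
  moreover have "AE x in lebesgue_on S. norm (w x $ i) \<le> 1"
    using assms(3)
  proof eventually_elim
    case (elim x)
    then have "w x $ i \<le> (\<Sum>i\<in>UNIV. w x $ i)" by (intro member_le_sum) (auto simp: conc_simplex_def)
    then show ?case using elim by (simp add: conc_simplex_def)
  qed
  ultimately show ?thesis by (intro integrable_const_bound)
qed

text \<open>Discrete functions are defined for meshes of \<open>\<real>\<^sup>d\<close> with coordinates.\<close>

locale mesh_vec = mesh \<Omega> M for \<Omega> :: "(real ^ 'd::finite) set" and M
begin

context
  fixes u0 :: "real ^ 'd \<Rightarrow> real ^ 'n::finite"
  assumes meas: "u0 \<in> borel_measurable (lebesgue_on \<Omega>)"
    and simplex: "AE x in lebesgue_on \<Omega>. u0 x \<in> conc_simplex"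
begin

lemma integrable_u0: "integrable (lebesgue_on \<Omega>) (\<lambda>x. u0 x $ i)"
  by (rule integrable_simplex_valued[OF lmeasurable_open[OF bounded_dom open_dom] meas simplex])

lemma cell_average_in_simplex:
  assumes K: "K \<in> cells M"
  shows "cell_average u0 K \<in> conc_simplex"
proof -
  note AE = AE_cell[OF simplex K]
  have int: "integrable (lebesgue_on K) (\<lambda>x. u0 x $ i)" for i by (rule integrable_cell[OF integrable_u0 K])
  have nonneg: "0 \<le> (LINT x | lebesgue_on K. u0 x $ i)" for i
    using AE by (intro integral_nonneg_AE) (auto simp: conc_simplex_def elim: eventually_mono)
  have "(\<Sum>i\<in>UNIV. LINT x | lebesgue_on K. u0 x $ i) = (LINT x | lebesgue_on K. (\<Sum>i\<in>UNIV. u0 x $ i))"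
    by (rule Bochner_Integration.integral_sum[symmetric]) (rule int)
  also have "\<dots> = (LINT x | lebesgue_on K. 1)"
  proof (rule integral_cong_AE)
    show "(\<lambda>x. \<Sum>i\<in>UNIV. u0 x $ i) \<in> borel_measurable (lebesgue_on K)"
      by (intro borel_measurable_sum borel_measurable_integrable int)
    show "AE x in lebesgue_on K. (\<Sum>i\<in>UNIV. u0 x $ i) = 1"
      using AE by eventually_elim (simp add: conc_simplex_def)
  qed simp
  also have "\<dots> = cell_measure K"
    using sets_cell[OF K] by (simp add: cell_measure_def measure_restrict_space)
  finally have "(\<Sum>i\<in>UNIV. LINT x | lebesgue_on K. u0 x $ i) = cell_measure K" .
  then show ?thesis
    using nonneg cell_measure_pos[OF K]
    by (auto simp: conc_simplex_def cell_average_def simp flip: sum_divide_distrib)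
qed

lemma total_mass_cell_average:
  assumes "\<And>K. K \<in> cells M \<Longrightarrow> v K = cell_average u0 K"
  shows "total_mass M v = (\<chi> i. LINT x | lebesgue_on \<Omega>. u0 x $ i)"
proof -
  have "(\<Sum>K\<in>cells M. cell_measure K * v K $ i) = (LINT x | lebesgue_on \<Omega>. u0 x $ i)" for i
  proof -
    have "(\<Sum>K\<in>cells M. cell_measure K * v K $ i) = (\<Sum>K\<in>cells M. LINT x | lebesgue_on K. u0 x $ i)"
      using cell_measure_pos by (intro sum.cong) (auto simp: assms cell_average_def less_le)
    then show ?thesis using sum_integral_cells[OF integrable_u0] by simp
  qed
  then show ?thesis by (simp add: total_mass_def)
qed

end

end

section \<open>The scheme on a mesh\<close>

text \<open>The tangent inequality for the convex function \<open>x ln x\<close>, with \<open>0 ln 0 = 0\<close>.\<close>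

lemma mult_ln_diff_le:
  fixes a b :: real
  assumes "0 < a" "0 \<le> b"
  shows "a * ln a - b * ln b \<le> (ln a + 1) * (a - b)"
proof (cases "b = 0")
  case True
  then show ?thesis using assms by (simp add: algebra_simps)
next
  case False
  then have b: "0 < b" using assms by simp
  then have "ln a - ln b \<le> a / b - 1"
    using ln_le_minus_one[of "a / b"] assms by (simp add: ln_div)
  then have "b * (ln a - ln b) \<le> b * (a / b - 1)" using b by (intro mult_left_mono) auto
  also have "\<dots> = a - b" using b by (simp add: right_diff_distrib)
  finally show ?thesis by (simp add: algebra_simps)
qed

context mesh_vec
begin

lemma sum_cell_faces_interior:
  assumes K: "K \<in> cells M" and ext: "\<And>\<sigma>. \<sigma> \<in> cell_faces M K \<inter> exterior_faces M \<Longrightarrow> g \<sigma> = (0::real)"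
  shows "(\<Sum>\<sigma>\<in>cell_faces M K. g \<sigma>) = (\<Sum>\<sigma>\<in>cell_faces M K \<inter> interior_faces M. g \<sigma>)"
proof (rule sum.mono_neutral_right)
  show "\<forall>\<sigma>\<in>cell_faces M K - cell_faces M K \<inter> interior_faces M. g \<sigma> = 0"
    using ext cell_faces_subset[OF K] by (auto simp: exterior_faces_def)
qed (use finite_cell_faces[OF K] in auto)

lemma scheme_sum_zero:
  assumes "eq_C M dt old v J" "eq_F3 M J" "K \<in> cells M"
  shows "cell_measure K * ((v K $ i - old K $ i) / dt)
    = - (\<Sum>\<sigma>\<in>cell_faces M K \<inter> interior_faces M. face_measure \<sigma> * J K \<sigma> $ i)"
proof -
  have "(\<Sum>\<sigma>\<in>cell_faces M K. face_measure \<sigma> * J K \<sigma> $ i)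
      = (\<Sum>\<sigma>\<in>cell_faces M K \<inter> interior_faces M. face_measure \<sigma> * J K \<sigma> $ i)"
    using assms(2,3) by (intro sum_cell_faces_interior) (auto simp: eq_F3_def)
  moreover have "cell_measure K * ((v K $ i - old K $ i) / dt)
      + (\<Sum>\<sigma>\<in>cell_faces M K. face_measure \<sigma> * J K \<sigma> $ i) = 0"
    using assms(1,3) unfolding eq_C_def by blast
  ultimately show ?thesis by linarith
qed

text \<open>The test function \<open>\<phi> = 1\<close> gives conservation of mass, and \<open>\<phi> = ln u\<^sub>i + 1\<close> the entropy balance.\<close>

lemma scheme_summation_by_parts:
  assumes "eq_C M dt old v J" "eq_F2 M J" "eq_F3 M J" "dt \<noteq> 0"
  shows "(\<Sum>K\<in>cells M. cell_measure K * (v K $ i - old K $ i) * \<phi> K)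
    = dt * (\<Sum>\<sigma>\<in>interior_faces M. let K = adjacent_cell M \<sigma> in
        face_measure \<sigma> * (J K \<sigma> $ i * (\<phi> (neighbour M K \<sigma>) - \<phi> K)))"
proof -
  have "(\<Sum>K\<in>cells M. cell_measure K * (v K $ i - old K $ i) * \<phi> K)
    = (\<Sum>K\<in>cells M. \<Sum>\<sigma>\<in>cell_faces M K \<inter> interior_faces M. - dt * (face_measure \<sigma> * J K \<sigma> $ i * \<phi> K))"
  proof (rule sum.cong[OF refl])
    fix K assume "K \<in> cells M"
    from scheme_sum_zero[OF assms(1,3) this, of i]
    have "cell_measure K * (v K $ i - old K $ i)
        = - dt * (\<Sum>\<sigma>\<in>cell_faces M K \<inter> interior_faces M. face_measure \<sigma> * J K \<sigma> $ i)"
      using assms(4) by (simp add: field_simps)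
    then show "cell_measure K * (v K $ i - old K $ i) * \<phi> K
        = (\<Sum>\<sigma>\<in>cell_faces M K \<inter> interior_faces M. - dt * (face_measure \<sigma> * J K \<sigma> $ i * \<phi> K))"
      by (simp add: sum_distrib_left sum_distrib_right mult.assoc)
  qed
  also have "\<dots> = (\<Sum>\<sigma>\<in>interior_faces M. dt * (let K = adjacent_cell M \<sigma> in
        face_measure \<sigma> * (J K \<sigma> $ i * (\<phi> (neighbour M K \<sigma>) - \<phi> K))))"
    unfolding sum_cells_interior_faces
  proof (rule sum.cong[OF refl])
    fix \<sigma> assume \<sigma>: "\<sigma> \<in> interior_faces M"
    define K L where "K = adjacent_cell M \<sigma>" and "L = neighbour M K \<sigma>"
    have "J L \<sigma> = - J K \<sigma>"
      using assms(2) adjacent_cell_common_face[OF \<sigma>] unfolding eq_F2_def K_def L_def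
      by (metis add_eq_0_iff)
    then show "- dt * (face_measure \<sigma> * J (adjacent_cell M \<sigma>) \<sigma> $ i * \<phi> (adjacent_cell M \<sigma>))
      + - dt * (face_measure \<sigma> * J (neighbour M (adjacent_cell M \<sigma>) \<sigma>) \<sigma> $ i * \<phi> (neighbour M (adjacent_cell M \<sigma>) \<sigma>))
      = dt * (let K = adjacent_cell M \<sigma> in face_measure \<sigma> * (J K \<sigma> $ i * (\<phi> (neighbour M K \<sigma>) - \<phi> K)))"
      by (simp add: Let_def algebra_simps flip: K_def L_def)
  qed
  finally show ?thesis by (simp add: sum_distrib_left)
qed

lemma scheme_total_mass:
  assumes "scheme M c dt old v J" "dt \<noteq> 0"
  shows "total_mass M v = total_mass M old"
proof -
  have "(\<Sum>K\<in>cells M. cell_measure K * (v K $ i - old K $ i)) = 0" for i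
    using scheme_summation_by_parts[of dt old v J i "\<lambda>_. 1"] assms
    by (simp add: scheme_def flux_equations_def)
  then show ?thesis by (simp add: total_mass_def right_diff_distrib sum_subtractf)
qed

end

locale cross_diffusion_mesh = mesh_vec \<Omega> M + cross_diffusion c
  for \<Omega> :: "(real ^ 'd::finite) set" and M and c :: "'n::finite \<Rightarrow> 'n \<Rightarrow> real"
begin

text \<open>The fluxes determined by a discrete function. Outside of \<open>\<E>\<^sub>K\<close> the values are irrelevant.\<close>

definition mesh_flux :: "('d, 'n) cell_fun \<Rightarrow> ('d, 'n) flux" where
  "mesh_flux v K \<sigma> = (if \<sigma> \<in> interior_faces M
     then edge_flux (face_dist M \<sigma>) (v K) (v (neighbour M K \<sigma>)) else 0)"

lemma eq_F1_iff:
  "eq_F1 M c v J \<longleftrightarrow> (\<forall>K\<in>cells M. \<forall>\<sigma>\<in>cell_faces M K \<inter> interior_faces M. J K \<sigma> = mesh_flux v K \<sigma>)"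
proof -
  have "(1 / face_dist M \<sigma>) *\<^sub>R jump M v K \<sigma> + c_star c *\<^sub>R J K \<sigma> + A_bar c (edge_value M v K \<sigma>) *v J K \<sigma> = 0
      \<longleftrightarrow> J K \<sigma> = mesh_flux v K \<sigma>" if "\<sigma> \<in> interior_faces M" for K \<sigma>
  proof -
    have "jump M v K \<sigma> = v (neighbour M K \<sigma>) - v K" using that by (simp add: jump_def across_def)
    moreover have "edge_value M v K \<sigma> = edge_means (v K) (v (neighbour M K \<sigma>))"
      using that by (simp add: edge_value_def edge_means_def across_def)
    ultimately show ?thesis using that by (simp only: edge_flux_unique mesh_flux_def if_True)
  qed
  then show ?thesis by (simp add: eq_F1_def)
qed

lemma flux_equations_mesh_flux: "flux_equations M c v (mesh_flux v)"
  unfolding flux_equations_def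
proof (intro conjI)
  show "eq_F1 M c v (mesh_flux v)" by (simp add: eq_F1_iff)
  show "eq_F2 M (mesh_flux v)"
    unfolding eq_F2_def
  proof (intro allI impI)
    fix K L \<sigma> assume KL: "common_face M K L \<sigma>"
    show "mesh_flux v K \<sigma> + mesh_flux v L \<sigma> = 0"
      using common_face_interior[OF KL] neighbour_eq[OF KL] neighbour_eq[OF common_face_commute[OF KL]]
        edge_flux_commute[of "face_dist M \<sigma>" "v L" "v K"]
      by (simp add: mesh_flux_def)
  qed
  show "eq_F3 M (mesh_flux v)" by (simp add: eq_F3_def mesh_flux_def exterior_faces_def)
qed

lemma flux_equations_unique:
  assumes "flux_equations M c v J" "K \<in> cells M" "\<sigma> \<in> cell_faces M K"
  shows "J K \<sigma> = mesh_flux v K \<sigma>"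
proof (cases "\<sigma> \<in> interior_faces M")
  case True
  then show ?thesis using assms by (simp add: flux_equations_def eq_F1_iff)
next
  case False
  then have "\<sigma> \<in> exterior_faces M" using assms(2,3) cell_faces_subset by (auto simp: exterior_faces_def)
  then show ?thesis using assms False by (simp add: flux_equations_def eq_F3_def mesh_flux_def)
qed

lemma mesh_flux_zero_sum:
  assumes "in_simplex M v" "K \<in> cells M" "\<sigma> \<in> cell_faces M K"
  shows "mesh_flux v K \<sigma> \<in> zero_sum_space"
proof (cases "\<sigma> \<in> interior_faces M")
  case True
  then have "neighbour M K \<sigma> \<in> cells M"
    using common_faceD(2)[OF common_face_neighbour] assms by blast
  then have "(\<Sum>i\<in>UNIV. v K $ i) = (\<Sum>i\<in>UNIV. v (neighbour M K \<sigma>) $ i)"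
    using assms by (simp add: in_simplex_def conc_simplex_def)
  from sum_edge_flux[OF this] show ?thesis using True by (simp add: mesh_flux_def zero_sum_space_def)
next
  case False
  then show ?thesis by (simp add: mesh_flux_def zero_sum_space_def)
qed

lemma entropy_estimate:
  assumes v: "in_simplex M v" "strictly_positive M v" and old: "in_simplex M old" and dt: "0 < dt"
    and C: "eq_C M dt old v (mesh_flux v)"
  shows "entropy M v + dt * dissipation M c v (mesh_flux v) \<le> entropy M old"
proof -
  let ?J = "mesh_flux v"
  have F: "eq_F2 M ?J" "eq_F3 M ?J" using flux_equations_mesh_flux by (auto simp: flux_equations_def)
  have parts: "(\<Sum>K\<in>cells M. cell_measure K * (v K $ i - old K $ i) * \<phi> K)
    = dt * (\<Sum>\<sigma>\<in>interior_faces M. let K = adjacent_cell M \<sigma> in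
        face_measure \<sigma> * (?J K \<sigma> $ i * (\<phi> (neighbour M K \<sigma>) - \<phi> K)))" for i \<phi>
    using scheme_summation_by_parts[OF C F] dt by simp
  have "entropy M v - entropy M old
      = (\<Sum>i\<in>UNIV. \<Sum>K\<in>cells M. cell_measure K * (v K $ i * ln (v K $ i) - old K $ i * ln (old K $ i)))"
    by (simp add: entropy_def sum_subtractf right_diff_distrib)
  also have "\<dots> \<le> (\<Sum>i\<in>UNIV. \<Sum>K\<in>cells M. cell_measure K * ((ln (v K $ i) + 1) * (v K $ i - old K $ i)))"
    using v(2) old cell_measure_pos
    by (intro sum_mono mult_left_mono mult_ln_diff_le)
      (auto simp: strictly_positive_def in_simplex_def conc_simplex_def intro: less_imp_le)
  also have "\<dots> = (\<Sum>i\<in>UNIV. \<Sum>K\<in>cells M. cell_measure K * (v K $ i - old K $ i) * (ln (v K $ i) + 1))"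
    by (simp add: mult_ac)
  also have "\<dots> = (\<Sum>i\<in>UNIV. dt * (\<Sum>\<sigma>\<in>interior_faces M. let K = adjacent_cell M \<sigma> in
        face_measure \<sigma> * (?J K \<sigma> $ i * (ln (v (neighbour M K \<sigma>) $ i) - ln (v K $ i)))))"
    unfolding parts by simp
  also have "\<dots> = dt * (\<Sum>\<sigma>\<in>interior_faces M. \<Sum>i\<in>UNIV. let K = adjacent_cell M \<sigma> in
        face_measure \<sigma> * (?J K \<sigma> $ i * (ln (v (neighbour M K \<sigma>) $ i) - ln (v K $ i))))"
    unfolding sum_distrib_left[symmetric] by (subst sum.swap) (rule refl)
  also have "\<dots> \<le> dt * (\<Sum>\<sigma>\<in>interior_faces M. - (let K = adjacent_cell M \<sigma> in
        c_star c / 2 * face_measure \<sigma> * face_dist M \<sigma> * (norm (?J K \<sigma>))\<^sup>2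
        + alpha c / 2 * transmissibility M \<sigma> * (norm (jump M (sqrt_fun v) K \<sigma>))\<^sup>2))"
  proof (intro mult_left_mono sum_mono)
    fix \<sigma> assume \<sigma>: "\<sigma> \<in> interior_faces M"
    define K L d m where "K = adjacent_cell M \<sigma>" and "L = neighbour M K \<sigma>"
      and "d = face_dist M \<sigma>" and "m = face_measure \<sigma>"
    note KL = common_faceD[OF adjacent_cell_common_face[OF \<sigma>], folded K_def, folded L_def]
    have J: "?J K \<sigma> = edge_flux d (v K) (v L)" using \<sigma> by (simp add: mesh_flux_def d_def L_def)
    have jump: "jump M (sqrt_fun v) K \<sigma> = (\<chi> i. sqrt (v L $ i)) - (\<chi> i. sqrt (v K $ i))"
      using \<sigma> by (simp add: jump_def across_def sqrt_fun_def L_def)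
    have m: "0 \<le> m" using face_measure_pos[OF KL(4)] by (simp add: m_def)
    have "c_star c / 2 * d * (norm (?J K \<sigma>))\<^sup>2 + alpha c / 2 * (1 / d) * (norm (jump M (sqrt_fun v) K \<sigma>))\<^sup>2
        \<le> - (\<Sum>i\<in>UNIV. ?J K \<sigma> $ i * (ln (v L $ i) - ln (v K $ i)))"
      unfolding J jump
      using v KL(1,2) face_dist_pos[OF \<sigma>]
      by (intro edge_dissipation) (auto simp: in_simplex_def strictly_positive_def d_def)
    from mult_left_mono[OF this m]
    have "(\<Sum>i\<in>UNIV. m * (?J K \<sigma> $ i * (ln (v L $ i) - ln (v K $ i))))
      \<le> - (m * (c_star c / 2 * d * (norm (?J K \<sigma>))\<^sup>2 + alpha c / 2 * (1 / d) * (norm (jump M (sqrt_fun v) K \<sigma>))\<^sup>2))"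
      unfolding sum_distrib_left[symmetric] by simp
    also have "\<dots> = - (c_star c / 2 * m * d * (norm (?J K \<sigma>))\<^sup>2 + alpha c / 2 * (m / d) * (norm (jump M (sqrt_fun v) K \<sigma>))\<^sup>2)"
      by (simp add: distrib_left mult_ac)
    finally show "(\<Sum>i\<in>UNIV. let K = adjacent_cell M \<sigma> in
        face_measure \<sigma> * (?J K \<sigma> $ i * (ln (v (neighbour M K \<sigma>) $ i) - ln (v K $ i))))
      \<le> - (let K = adjacent_cell M \<sigma> in
        c_star c / 2 * face_measure \<sigma> * face_dist M \<sigma> * (norm (?J K \<sigma>))\<^sup>2
        + alpha c / 2 * transmissibility M \<sigma> * (norm (jump M (sqrt_fun v) K \<sigma>))\<^sup>2)"
      by (simp only: Let_def K_def L_def d_def m_def transmissibility_def)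
  qed (use dt in simp)
  also have "\<dots> = - (dt * dissipation M c v ?J)"
    by (simp add: dissipation_def sum_negf)
  finally show ?thesis by simp
qed

text \<open>One step of the scheme, from a datum with positive masses to the next discrete function.\<close>

lemma time_step:
  assumes old: "in_simplex M old" and mass: "\<And>i. 0 < total_mass M old $ i" and dt: "0 < dt"
  shows "\<exists>v J. strictly_positive M v \<and> in_simplex M v \<and> scheme M c dt old v J \<and>
      total_mass M v = total_mass M old \<and>
      (\<forall>J'. flux_equations M c v J' \<longrightarrow>
         (\<forall>K\<in>cells M. \<forall>\<sigma>\<in>cell_faces M K. J' K \<sigma> = J K \<sigma>)) \<and>
      (\<forall>K\<in>cells M. \<forall>\<sigma>\<in>cell_faces M K. J K \<sigma> \<in> zero_sum_space) \<and>
      entropy M v + dt * dissipation M c v J \<le> entropy M old"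
proof -
  let ?E = "\<lambda>K. cell_faces M K \<inter> interior_faces M"
  have nb: "neighbour M K \<sigma> \<in> cells M" if "K \<in> cells M" "\<sigma> \<in> ?E K" for K \<sigma>
    using common_faceD(2)[OF common_face_neighbour[OF that]] .
  have wt: "0 < face_measure \<sigma>" if "K \<in> cells M" "\<sigma> \<in> ?E K" for K \<sigma>
    using that by (intro face_measure_pos) (auto simp: interior_faces_def)
  have d: "0 < face_dist M \<sigma>" if "K \<in> cells M" "\<sigma> \<in> ?E K" for K \<sigma>
    using that face_dist_pos by blast
  have oldK: "old K \<in> conc_simplex" if "K \<in> cells M" for K using old that by (simp add: in_simplex_def)
  have "\<exists>v. \<forall>K\<in>cells M. v K \<in> conc_simplex \<and> (\<forall>i. cell_measure K * ((v K $ i - old K $ i) / dt)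
        + (\<Sum>\<sigma>\<in>?E K. face_measure \<sigma> * edge_flux (face_dist M \<sigma>) (v K) (v (neighbour M K \<sigma>)) $ i) = 0)"
    by (rule discrete_problem_solvable) (fact finite_cells cell_measure_pos nb less_imp_le[OF wt] d oldK dt)+
  then obtain v where v: "\<And>K. K \<in> cells M \<Longrightarrow> v K \<in> conc_simplex"
    "\<And>K i. K \<in> cells M \<Longrightarrow> cell_measure K * ((v K $ i - old K $ i) / dt)
        + (\<Sum>\<sigma>\<in>?E K. face_measure \<sigma> * edge_flux (face_dist M \<sigma>) (v K) (v (neighbour M K \<sigma>)) $ i) = 0"
    by blast
  have F: "flux_equations M c v (mesh_flux v)" by (rule flux_equations_mesh_flux)
  have C: "eq_C M dt old v (mesh_flux v)"
    unfolding eq_C_def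
  proof (intro ballI allI)
    fix K i assume K: "K \<in> cells M"
    have "(\<Sum>\<sigma>\<in>cell_faces M K. face_measure \<sigma> * mesh_flux v K \<sigma> $ i) = (\<Sum>\<sigma>\<in>?E K. face_measure \<sigma> * mesh_flux v K \<sigma> $ i)"
      by (rule sum_cell_faces_interior[OF K]) (simp add: mesh_flux_def exterior_faces_def)
    also have "\<dots> = (\<Sum>\<sigma>\<in>?E K. face_measure \<sigma> * edge_flux (face_dist M \<sigma>) (v K) (v (neighbour M K \<sigma>)) $ i)"
      by (rule sum.cong) (auto simp: mesh_flux_def)
    finally show "cell_measure K * ((v K $ i - old K $ i) / dt)
        + (\<Sum>\<sigma>\<in>cell_faces M K. face_measure \<sigma> * mesh_flux v K \<sigma> $ i) = 0"
      using v(2)[OF K, of i] by simp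
  qed
  have S: "scheme M c dt old v (mesh_flux v)" using C F by (simp add: scheme_def)
  have total: "total_mass M v = total_mass M old" using scheme_total_mass[OF S] dt by simp
  have "0 < v K $ i" if "K \<in> cells M" for K i
  proof (rule discrete_solution_pos[of "cells M" cell_measure ?E "neighbour M" face_measure "face_dist M" old dt v])
    show "0 < (\<Sum>K\<in>cells M. cell_measure K * v K $ i)" for i
      using mass[of i] unfolding total[symmetric] by (simp add: total_mass_def)
    show "W = cells M" if "W \<subseteq> cells M" "W \<noteq> {}" "\<And>K \<sigma>. K \<in> W \<Longrightarrow> \<sigma> \<in> ?E K \<Longrightarrow> neighbour M K \<sigma> \<in> W" for W
      using that by (rule cells_connected)
  qed (fact that dt cell_measure_pos nb wt d oldK v | simp add: finite_cell_faces)+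
  then have pos: "strictly_positive M v" by (simp add: strictly_positive_def)
  have simplex: "in_simplex M v" using v(1) by (simp add: in_simplex_def)
  show ?thesis
    using pos simplex S total flux_equations_unique mesh_flux_zero_sum[OF simplex]
      entropy_estimate[OF simplex pos old dt C]
    by (intro exI[of _ v] exI[of _ "mesh_flux v"]) simp
qed

end

theorem theorem2p3:
  fixes \<Omega> :: "(real ^ 'd::finite) set"
    and M :: "(real ^ 'd) mesh"
    and c :: "'n::finite \<Rightarrow> 'n \<Rightarrow> real"
    and T :: real
    and t :: "nat \<Rightarrow> real"
    and P p :: nat
    and u0 :: "real ^ 'd \<Rightarrow> real ^ 'n"
    and u :: "nat \<Rightarrow> ('d, 'n) cell_fun"
  assumes "open \<Omega>" and "connected \<Omega>" and "\<Omega> \<noteq> {}" and "bounded \<Omega>" and "polyhedral \<Omega>"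
    and "admissible_mesh \<Omega> M"
    and "2 \<le> CARD('n)"
    and "\<And>i j. i \<noteq> j \<Longrightarrow> c i j = c j i"
    and "\<And>i j. i \<noteq> j \<Longrightarrow> 0 < c i j"
    and "0 < T"
    and "t 0 = 0" and "t P = T" and "\<And>q. q < P \<Longrightarrow> t q < t (Suc q)"
    and "u0 \<in> borel_measurable (lebesgue_on \<Omega>)"
    and "AE x in lebesgue_on \<Omega>. u0 x \<in> conc_simplex"
    and "\<And>i. 0 < (LINT x | lebesgue_on \<Omega>. u0 x $ i)"
    and "1 \<le> p" and "p \<le> P"
    and "\<And>K. K \<in> cells M \<Longrightarrow> u 0 K = cell_average u0 K"
    and "\<And>q. 1 \<le> q \<Longrightarrow> q < p \<Longrightarrow>
           strictly_positive M (u q) \<and> in_simplex M (u q) \<and>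
           (\<exists>J. scheme M c (t q - t (q - 1)) (u (q - 1)) (u q) J)"
  shows "\<exists>v J.
      strictly_positive M v \<and> in_simplex M v \<and>
      scheme M c (t p - t (p - 1)) (u (p - 1)) v J \<and>
      total_mass M v = (\<chi> i. LINT x | lebesgue_on \<Omega>. u0 x $ i) \<and>
      (\<forall>J'. flux_equations M c v J' \<longrightarrow>
         (\<forall>K\<in>cells M. \<forall>\<sigma>\<in>cell_faces M K. J' K \<sigma> = J K \<sigma>)) \<and>
      (\<forall>K\<in>cells M. \<forall>\<sigma>\<in>cell_faces M K. J K \<sigma> \<in> zero_sum_space) \<and>
      entropy M v + (t p - t (p - 1)) * dissipation M c v J \<le> entropy M (u (p - 1))"
proof -
  interpret cross_diffusion_mesh \<Omega> M c
    by unfold_locales (fact assms)+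
  have dt: "0 < t q - t (q - 1)" if "1 \<le> q" "q \<le> p" for q
    using assms(13)[of "q - 1"] that \<open>p \<le> P\<close> by simp
  have "in_simplex M (u q) \<and> total_mass M (u q) = (\<chi> i. LINT x | lebesgue_on \<Omega>. u0 x $ i)" if "q < p" for q
    using that
  proof (induction q)
    case 0
    show ?case
      using cell_average_in_simplex[OF assms(14,15)] total_mass_cell_average[OF assms(14,15,19)] assms(19)
      by (simp add: in_simplex_def)
  next
    case (Suc q)
    then obtain J where "scheme M c (t (Suc q) - t q) (u q) (u (Suc q)) J" "in_simplex M (u (Suc q))"
      using assms(20)[of "Suc q"] by auto
    moreover have "t (Suc q) - t q \<noteq> 0" using dt[of "Suc q"] Suc.prems by simp
    ultimately have "total_mass M (u (Suc q)) = total_mass M (u q)" "in_simplex M (u (Suc q))"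
      by (auto intro: scheme_total_mass)
    then show ?case using Suc.IH Suc.prems by simp
  qed
  then have prev: "in_simplex M (u (p - 1))"
    "total_mass M (u (p - 1)) = (\<chi> i. LINT x | lebesgue_on \<Omega>. u0 x $ i)"
    using \<open>1 \<le> p\<close> by auto
  show ?thesis
    using time_step[OF prev(1) _ dt[OF \<open>1 \<le> p\<close> order_refl]] assms(16) unfolding prev(2) by simp
qed

end
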